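(* Fix integers $q\ge2$ and $d\ge1$. Then $$\lim_{N\to\infty}\frac{\boldsymbol\lambda\big(\mathcal B_{\le d}(C_q^N)\big)}{\sqrt{\dim\mathcal B_{\le d}(C_q^N)}}=\frac1{\sqrt{d!}}\,\mathbb E\big|\mathrm{He}_d(Z)\big|,\qquad Z\sim\mathcal N(0,1).$$
   Context: $C_q\subset\mathbb C$ is the group of $q$-th roots of unity. For $\bm m\in\{0,\ldots,q-1\}^N$, $\chi_{\bm m}(x)=x_1^{m_1}\cdots x_N^{m_N}$ ($x\in C_q^N$) and $\operatorname{supp}(\bm m)=\{j:m_j\ne0\}$. $\mathcal B_{\le d}(C_q^N)=\operatorname{span}_{\mathbb C}\{\chi_{\bm m}:|\operatorname{supp}(\bm m)|\le d\}$, endowed with the supremum norm on $C_q^N$. For a subspace $X$ of a Banach space $Y$, $\boldsymbol\lambda(X,Y)=\inf\{\|P\|:P:Y\to X \text{ bounded linear},\ P|_X=\mathrm{id}_X\}$; the (absolute) projection constant of $X$ is $\boldsymbol\lambda(X)=\sup\boldsymbol\lambda(I(X),Y)$, the supremum over all Banach spaces $Y$ and all isometric embeddings $I:X\to Y$. $\mathrm{He}_d$ is the $d$-th probabilists' Hermite polynomial, given by $e^{xt-t^2/2}=\sum_{m\ge0}\mathrm{He}_m(x)t^m/m!$. *)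

theory Defs
  imports
    "HOL-Probability.Probability"
    "HOL-Computational_Algebra.Formal_Power_Series"
    "HOL-Library.Function_Algebras"
    "HOL-Algebra.Module"
begin

section \<open>Complex Banach spaces carried by a set\<close>

text \<open>The projection constant quantifies over all complex Banach spaces, so these are
  treated as objects: modules over the field of complex numbers with a norm. The record
  \<^type>\<open>module\<close> inherits a ring multiplication and unit, which play no role.\<close>

definition complex_ring :: "complex ring" where
  "complex_ring = \<lparr>carrier = UNIV, mult = (*), one = 1, zero = 0, add = (+)\<rparr>"

record 'v complex_normed = "(complex, 'v) module" +
  vnorm :: "'v \<Rightarrow> real"

locale complex_normed_space = Module.module complex_ring V
  for V :: "'v complex_normed" (structure) +
  assumes vnorm_nonneg: "x \<in> carrier V \<Longrightarrow> 0 \<le> vnorm V x"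
    and vnorm_eq_0_iff: "x \<in> carrier V \<Longrightarrow> vnorm V x = 0 \<longleftrightarrow> x = \<zero>\<^bsub>V\<^esub>"
    and vnorm_smult: "x \<in> carrier V \<Longrightarrow> vnorm V (c \<odot>\<^bsub>V\<^esub> x) = cmod c * vnorm V x"
    and vnorm_triangle:
      "x \<in> carrier V \<Longrightarrow> y \<in> carrier V \<Longrightarrow> vnorm V (x \<oplus>\<^bsub>V\<^esub> y) \<le> vnorm V x + vnorm V y"

text \<open>The locale \<^locale>\<open>Metric_space\<close> demands nonnegativity and symmetry on the whole type,
  not just on the carrier; hence the value 0 off the carrier.\<close>

definition vdist :: "'v complex_normed \<Rightarrow> 'v \<Rightarrow> 'v \<Rightarrow> real" where
  "vdist V x y = (if x \<in> carrier V \<and> y \<in> carrier V then vnorm V (x \<ominus>\<^bsub>V\<^esub> y) else 0)"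

locale complex_banach_space = complex_normed_space +
  assumes complete: "Metric_space.mcomplete (carrier V) (vdist V)"

definition complex_linear_map ::
    "'v complex_normed \<Rightarrow> 'w complex_normed \<Rightarrow> ('v \<Rightarrow> 'w) \<Rightarrow> bool" where
  "complex_linear_map V W T \<longleftrightarrow>
     T \<in> carrier V \<rightarrow> carrier W \<and>
     (\<forall>x\<in>carrier V. \<forall>y\<in>carrier V. T (x \<oplus>\<^bsub>V\<^esub> y) = T x \<oplus>\<^bsub>W\<^esub> T y) \<and>
     (\<forall>c. \<forall>x\<in>carrier V. T (c \<odot>\<^bsub>V\<^esub> x) = c \<odot>\<^bsub>W\<^esub> T x)"

definition bounded_complex_linear_map ::
    "'v complex_normed \<Rightarrow> 'w complex_normed \<Rightarrow> ('v \<Rightarrow> 'w) \<Rightarrow> bool" where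
  "bounded_complex_linear_map V W T \<longleftrightarrow>
     complex_linear_map V W T \<and> (\<exists>C. \<forall>x\<in>carrier V. vnorm W (T x) \<le> C * vnorm V x)"

definition isometric_embedding ::
    "'v complex_normed \<Rightarrow> 'w complex_normed \<Rightarrow> ('v \<Rightarrow> 'w) \<Rightarrow> bool" where
  "isometric_embedding V W T \<longleftrightarrow>
     complex_linear_map V W T \<and> (\<forall>x\<in>carrier V. vnorm W (T x) = vnorm V x)"

definition operator_norm ::
    "'v complex_normed \<Rightarrow> 'w complex_normed \<Rightarrow> ('v \<Rightarrow> 'w) \<Rightarrow> real" where
  "operator_norm V W T = (SUP x\<in>{x \<in> carrier V. vnorm V x \<le> 1}. vnorm W (T x))"


section \<open>Projection constants\<close>

text \<open>Here \<open>X\<close> is (the carrier of) a subspace of \<open>Y\<close>.\<close>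

definition projections_onto :: "'y set \<Rightarrow> 'y complex_normed \<Rightarrow> ('y \<Rightarrow> 'y) set" where
  "projections_onto X Y =
     {P. bounded_complex_linear_map Y Y P \<and> P ` carrier Y \<subseteq> X \<and> (\<forall>x\<in>X. P x = x)}"

definition relative_projection_constant :: "'y set \<Rightarrow> 'y complex_normed \<Rightarrow> ereal" where
  "relative_projection_constant X Y = (INF P\<in>projections_onto X Y. ereal (operator_norm Y Y P))"

text \<open>HOL cannot quantify over types inside a formula. The supremum therefore ranges over
  all complex Banach spaces whose underlying set is contained in the type \<open>'u\<close>; statements
  about \<open>projection_constant TYPE('u)\<close> are to be read for every \<open>'u\<close>, so that every Banach
  space is covered by some instance. As a nonzero complex Banach space contains a copy of the
  complex numbers, only types \<open>'u\<close> into which those inject carry any nonzero space.\<close>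

definition projection_constant :: "'u itself \<Rightarrow> 'x complex_normed \<Rightarrow> ereal" where
  "projection_constant (_ :: 'u itself) X =
     Sup {relative_projection_constant (I ` carrier X) Y | (Y :: 'u complex_normed) I.
            complex_banach_space Y \<and> isometric_embedding X Y I}"


section \<open>Functions of bounded degree on powers of a cyclic group\<close>

definition cyclic_cube :: "nat \<Rightarrow> nat \<Rightarrow> (nat \<Rightarrow> complex) set" where
  "cyclic_cube q N = {..<N} \<rightarrow>\<^sub>E {z. z ^ q = 1}"

text \<open>Functions on \<open>cyclic_cube q N\<close> are represented by functions on the whole type that
  vanish off the cube.\<close>

definition character :: "nat \<Rightarrow> nat \<Rightarrow> (nat \<Rightarrow> nat) \<Rightarrow> (nat \<Rightarrow> complex) \<Rightarrow> complex" where
  "character q N m x = (if x \<in> cyclic_cube q N then \<Prod>j<N. x j ^ m j else 0)"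

definition fun_scale :: "complex \<Rightarrow> ('a \<Rightarrow> complex) \<Rightarrow> 'a \<Rightarrow> complex" where
  "fun_scale c f = (\<lambda>x. c * f x)"

global_interpretation complex_fun: vector_space fun_scale
  defines complex_fun_span = complex_fun.span
    and complex_fun_dim = complex_fun.dim
  by unfold_locales (auto simp: fun_scale_def fun_eq_iff algebra_simps)

definition bounded_degree_functions :: "nat \<Rightarrow> nat \<Rightarrow> nat \<Rightarrow> ((nat \<Rightarrow> complex) \<Rightarrow> complex) set" where
  "bounded_degree_functions d q N =
     complex_fun_span {character q N m | m.
       m \<in> {..<N} \<rightarrow>\<^sub>E {..<q} \<and> card {j \<in> {..<N}. m j \<noteq> 0} \<le> d}"

definition bounded_degree_space ::
    "nat \<Rightarrow> nat \<Rightarrow> nat \<Rightarrow> ((nat \<Rightarrow> complex) \<Rightarrow> complex) complex_normed" where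
  "bounded_degree_space d q N =
     \<lparr>carrier = bounded_degree_functions d q N, mult = (*), one = 1, zero = 0, add = (+),
      smult = fun_scale, vnorm = (\<lambda>f. SUP x\<in>cyclic_cube q N. cmod (f x))\<rparr>"


section \<open>Probabilists' Hermite polynomials\<close>

text \<open>The generating function \<open>exp (x t - t^2/2)\<close> is read as a formal power series in \<open>t\<close>.\<close>

definition hermite_gf :: "real \<Rightarrow> real fps" where
  "hermite_gf x = fps_exp 1 oo (fps_const x * fps_X - fps_const (1/2) * fps_X ^ 2)"

definition He :: "nat \<Rightarrow> real \<Rightarrow> real" where
  "He m x = fact m * fps_nth (hermite_gf x) m"

end

theory Submission
  imports Defs
begin

text \<open>By Rudin's averaging argument, the projection constant of a translation-invariant space of
  functions on the cube equals the \<open>L\<^sup>1\<close> norm of its Dirichlet kernel \<open>D\<close>: convolution with \<open>D\<close>,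
  combined with Hahn--Banach extensions of the point evaluations, gives the upper bound, and the
  space of all functions on the cube, copied into \<open>'u\<close>, gives the lower bound. At \<open>x\<close> the part of \<open>D\<close>
  of degree \<open>k\<close> is the elementary symmetric polynomial of the independent centred variables
  \<open>y\<^sub>j = x\<^sub>j + \<dots> + x\<^sub>j\<^bsup>q-1\<^esup>\<close>. As \<open>y\<^sub>j\<close> takes only two values, these polynomials satisfy a three-term
  recurrence in \<open>y\<^sub>1 + \<dots> + y\<^sub>N\<close> (Krawtchouk polynomials), which after normalisation tends to the
  Hermite recurrence. The central limit theorem and exponential moment bounds finish the proof.\<close>

section \<open>Hermite and Krawtchouk polynomials\<close>

text \<open>The two values of \<open>y_j\<close> are the roots of
  \<open>y^2 = (q-1) + (q-2) y\<close>. Hence every power sum of the \<open>y_j\<close> is an affine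
  function of the first one, and by Newton's identities the whole kernel is a polynomial in that
  single sum: a one-dimensional limit theorem suffices. Two obstacles remain. Hermite polynomials
  are unbounded, so weak convergence alone says nothing about the mean of their absolute value;
  second moments bounded uniformly in \<open>N\<close> are required. And the polynomial itself
  changes with \<open>N\<close>, so its distance from \<open>He k\<close> is estimated pointwise by
  \<open>1 / sqrt N\<close> times a power of \<open>1 + \<bar>w\<bar>\<close>, which the same
  moments control. The projection constant is computed exactly for each \<open>N\<close> before any
  limit is taken. Its lower bound must realise the functions on the cube as a Banach space inside
  \<open>'u\<close>. They form a finite power of the complex numbers, which injects into
  \<open>complex\<close>, so one injection of \<open>complex\<close> into \<open>'u\<close> serves
  all cubes.\<close>

lemma He_0 [simp]: "He 0 x = 1"
  by (simp add: He_def hermite_gf_def)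

text \<open>The logarithmic derivative of \<open>exp (x t - t^2/2)\<close> is \<open>x - t\<close>;
  comparing coefficients in this differential equation yields the three-term recurrence.
  \<open>esym_fps_deriv\<close> treats the Krawtchouk side in the same way.\<close>

lemma fps_deriv_hermite_gf:
  "fps_deriv (hermite_gf x) = (fps_const x - fps_X) * hermite_gf x"
proof -
  let ?b = "fps_const x * fps_X - fps_const (1/2) * fps_X ^ 2 :: real fps"
  have "fps_deriv (hermite_gf x) = (fps_deriv (fps_exp 1) oo ?b) * fps_deriv ?b"
    unfolding hermite_gf_def by (rule fps_compose_deriv) simp
  also have "fps_deriv ?b = fps_const x - fps_X"
    by (simp add: fps_deriv_power fps_const_mult[symmetric] numeral_fps_const power2_eq_square
        del: fps_const_mult)
  finally show ?thesis by (simp add: hermite_gf_def mult.commute)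
qed

lemma hermite_gf_nth_Suc:
  "real (n + 1) * fps_nth (hermite_gf x) (n + 1)
     = x * fps_nth (hermite_gf x) n - (if n = 0 then 0 else fps_nth (hermite_gf x) (n - 1))"
  using arg_cong[OF fps_deriv_hermite_gf, of "\<lambda>F. fps_nth F n" x]
  by (simp add: left_diff_distrib fps_X_mult_nth)

lemma He_1 [simp]: "He (Suc 0) x = x"
  using hermite_gf_nth_Suc[of 0 x] He_0[of x] by (simp add: He_def)

lemma He_Suc_Suc: "He (Suc (Suc n)) x = x * He (Suc n) x - real (Suc n) * He n x"
proof -
  have "He (Suc (Suc n)) x
      = fact (Suc n) * (real (Suc n + 1) * fps_nth (hermite_gf x) (Suc n + 1))"
    by (simp add: He_def)
  also have "\<dots> = fact (Suc n) * (x * fps_nth (hermite_gf x) (Suc n) - fps_nth (hermite_gf x) n)"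
    by (subst hermite_gf_nth_Suc) simp
  also have "\<dots> = x * He (Suc n) x - real (Suc n) * He n x"
    by (simp add: He_def algebra_simps)
  finally show ?thesis .
qed

text \<open>Normalised Krawtchouk polynomials, in the variable \<open>w = (y\<^sub>1 + \<dots> + y\<^sub>N) / s\<close>
  with \<open>s = sqrt (N (q - 1))\<close> and skewness parameter \<open>a = q - 2\<close>.\<close>

fun kraw :: "real \<Rightarrow> real \<Rightarrow> real \<Rightarrow> nat \<Rightarrow> real \<Rightarrow> real" where
  "kraw a s n 0 w = 1"
| "kraw a s n (Suc 0) w = w"
| "kraw a s n (Suc (Suc k)) w =
     (w - a * real (Suc k) / s) * kraw a s n (Suc k) w
       - real (Suc k) * (1 - real k / n) * kraw a s n k w"

text \<open>Only the order of growth matters, for domination by moments. The base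
  \<open>1 + \<bar>w\<bar>\<close> is at least 1, so bounds for lower degrees are absorbed into
  those for higher ones.\<close>

lemma He_bound: "\<exists>C\<ge>0. \<forall>w. \<bar>He k w\<bar> \<le> C * (1 + \<bar>w\<bar>) ^ k"
proof (induction k rule: less_induct)
  case (less k)
  consider "k = 0" | "k = 1" | j where "k = Suc (Suc j)"
    by (metis One_nat_def not0_implies_Suc)
  then show ?case
  proof cases
    case 3
    obtain C where C: "C \<ge> 0" "\<And>w. \<bar>He (Suc j) w\<bar> \<le> C * (1 + \<bar>w\<bar>) ^ Suc j"
      using less[of "Suc j"] 3 by auto
    obtain C' where C': "C' \<ge> 0" "\<And>w. \<bar>He j w\<bar> \<le> C' * (1 + \<bar>w\<bar>) ^ j"
      using less[of j] 3 by auto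
    have "\<bar>He k w\<bar> \<le> (C + real (Suc j) * C') * (1 + \<bar>w\<bar>) ^ k" for w
    proof -
      let ?v = "1 + \<bar>w\<bar>"
      have "\<bar>He k w\<bar> \<le> \<bar>w\<bar> * \<bar>He (Suc j) w\<bar> + real (Suc j) * \<bar>He j w\<bar>"
        using abs_triangle_ineq4[of "w * He (Suc j) w" "real (Suc j) * He j w"]
        unfolding 3 He_Suc_Suc abs_mult by simp
      also have "\<dots> \<le> ?v * (C * ?v ^ Suc j) + real (Suc j) * (C' * ?v ^ j)"
        by (intro add_mono mult_mono C(2) C'(2) mult_nonneg_nonneg C(1) zero_le_power) auto
      also have "\<dots> \<le> ?v * (C * ?v ^ Suc j) + real (Suc j) * (C' * ?v ^ k)"
        using 3 C(1) by (intro add_mono mult_left_mono power_increasing C'(1)) auto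
      also have "\<dots> = (C + real (Suc j) * C') * ?v ^ k"
        using 3 by (simp add: algebra_simps)
      finally show ?thesis .
    qed
    with C C' show ?thesis by (intro exI[of _ "C + real (Suc j) * C'"]) auto
  qed (auto intro!: exI[of _ 1])
qed

text \<open>The two recurrences differ by a skewness term of size \<open>1 / sqrt n\<close> and a
  term of size \<open>1 / n\<close>; induction on the degree propagates the error. The constant
  depends neither on \<open>n\<close> nor on \<open>w\<close>, so the bound can be averaged over the
  cube.\<close>

lemma kraw_He_bound:
  assumes "a \<ge> 0" "b > 0"
  shows "\<exists>C\<ge>0. \<forall>n w. n > 0 \<longrightarrow>
           \<bar>kraw a (sqrt (b * real n)) (real n) k w - He k w\<bar> \<le> C / sqrt (real n) * (1 + \<bar>w\<bar>) ^ k"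
proof (induction k rule: less_induct)
  case (less k)
  consider "k = 0" | "k = 1" | j where "k = Suc (Suc j)"
    by (metis One_nat_def not0_implies_Suc)
  then show ?case
  proof cases
    case 3
    define h where "h n i w = kraw a (sqrt (b * real n)) (real n) i w" for n i w
    obtain C1 where C1: "C1 \<ge> 0"
      "\<And>n w. n > 0 \<Longrightarrow> \<bar>h n (Suc j) w - He (Suc j) w\<bar> \<le> C1 / sqrt (real n) * (1 + \<bar>w\<bar>) ^ Suc j"
      using less[of "Suc j"] 3 unfolding h_def by auto
    obtain C0 where C0: "C0 \<ge> 0"
      "\<And>n w. n > 0 \<Longrightarrow> \<bar>h n j w - He j w\<bar> \<le> C0 / sqrt (real n) * (1 + \<bar>w\<bar>) ^ j"
      using less[of j] 3 unfolding h_def by auto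
    obtain D1 where D1: "D1 \<ge> 0" "\<And>w. \<bar>He (Suc j) w\<bar> \<le> D1 * (1 + \<bar>w\<bar>) ^ Suc j"
      using He_bound by metis
    obtain D0 where D0: "D0 \<ge> 0" "\<And>w. \<bar>He j w\<bar> \<le> D0 * (1 + \<bar>w\<bar>) ^ j"
      using He_bound by metis
    \<comment> \<open>\<open>\<alpha> / sqrt n\<close> and \<open>\<beta> / n\<close> are the
      coefficients of the two terms by which the Krawtchouk recurrence departs from that of
      Hermite.\<close>
    define \<alpha> where "\<alpha> = a * real (Suc j) / sqrt b"
    define \<beta> where "\<beta> = real (Suc j) * real j"
    have [simp]: "\<alpha> \<ge> 0" "\<beta> \<ge> 0"
      using assms by (auto simp: \<alpha>_def \<beta>_def)
    define C where "C = C1 + real (Suc j) * C0 + \<alpha> * (C1 + D1) + \<beta> * (C0 + D0)"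
    have bound: "\<bar>h n k w - He k w\<bar> \<le> C / sqrt (real n) * (1 + \<bar>w\<bar>) ^ k" if n: "n > 0" for n w
    proof -
      let ?v = "1 + \<bar>w\<bar>" and ?r = "1 / sqrt (real n)"
      let ?d1 = "h n (Suc j) w - He (Suc j) w" and ?d0 = "h n j w - He j w"
      have r: "0 < ?r" "?r \<le> 1" "1 / real n \<le> ?r"
      proof -
        have "1 \<le> sqrt (real n)" "sqrt (real n) \<le> sqrt (real n) * sqrt (real n)"
          using n by (auto simp: real_sqrt_ge_1_iff intro: mult_right_mono[of 1 "sqrt (real n)" "sqrt (real n)", simplified])
        then show "0 < ?r" "?r \<le> 1" "1 / real n \<le> ?r"
          using n by (auto simp: frac_le)
      qed
      have v: "?v ^ j \<le> ?v ^ k" "?v ^ Suc j \<le> ?v ^ k" "?v * ?v ^ Suc j = ?v ^ k" "0 \<le> ?v"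
        using 3 by (auto intro!: power_increasing simp del: power_Suc) (simp add: power_Suc)
      have d1: "\<bar>?d1\<bar> \<le> C1 * ?r * ?v ^ Suc j" and d0: "\<bar>?d0\<bar> \<le> C0 * ?r * ?v ^ j"
        using C1(2)[OF n, of w] C0(2)[OF n, of w] by auto
      have h1: "\<bar>h n (Suc j) w\<bar> \<le> (C1 + D1) * ?v ^ Suc j"
      proof -
        have "C1 * ?r * ?v ^ Suc j \<le> C1 * 1 * ?v ^ Suc j"
          using r C1(1) by (intro mult_right_mono mult_left_mono) auto
        with d1 D1(2)[of w] show ?thesis by (simp only: distrib_right)
      qed
      have h0: "\<bar>h n j w\<bar> \<le> (C0 + D0) * ?v ^ j"
      proof -
        have "C0 * ?r * ?v ^ j \<le> C0 * 1 * ?v ^ j"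
          using r C0(1) by (intro mult_right_mono mult_left_mono) auto
        with d0 D0(2)[of w] show ?thesis by (simp only: distrib_right)
      qed
      have eq: "h n k w - He k w = w * ?d1 - real (Suc j) * ?d0
          - (\<alpha> * ?r) * h n (Suc j) w + (\<beta> * (1 / real n)) * h n j w"
        unfolding 3 h_def kraw.simps He_Suc_Suc \<alpha>_def \<beta>_def real_sqrt_mult
        by (simp add: algebra_simps add_divide_distrib)
      have "\<bar>h n k w - He k w\<bar> \<le> \<bar>w\<bar> * \<bar>?d1\<bar> + real (Suc j) * \<bar>?d0\<bar>
          + (\<alpha> * ?r) * \<bar>h n (Suc j) w\<bar> + (\<beta> * (1 / real n)) * \<bar>h n j w\<bar>"
      proof -
        have abs4: "\<bar>A - B - C + D\<bar> \<le> \<bar>A\<bar> + \<bar>B\<bar> + \<bar>C\<bar> + \<bar>D\<bar>" for A B C D :: real by linarith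
        show ?thesis unfolding eq by (rule order.trans[OF abs4]) (simp add: abs_mult)
      qed
      also have "\<dots> \<le> ?v * (C1 * ?r * ?v ^ Suc j) + real (Suc j) * (C0 * ?r * ?v ^ k)
          + (\<alpha> * ?r) * ((C1 + D1) * ?v ^ k) + (\<beta> * ?r) * ((C0 + D0) * ?v ^ k)"
      proof (intro add_mono mult_mono)
        show "\<bar>?d0\<bar> \<le> C0 * ?r * ?v ^ k"
          using r C0(1) by (intro order.trans[OF d0] mult_left_mono v) auto
        show "\<bar>h n (Suc j) w\<bar> \<le> (C1 + D1) * ?v ^ k"
          using C1(1) D1(1) by (intro order.trans[OF h1] mult_left_mono v) auto
        show "\<bar>h n j w\<bar> \<le> (C0 + D0) * ?v ^ k"
          using C0(1) D0(1) by (intro order.trans[OF h0] mult_left_mono v) auto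
      qed (use d1 r C1(1) C0(1) D1(1) D0(1) in auto)
      also have "?v * (C1 * ?r * ?v ^ Suc j) = C1 * ?r * ?v ^ k"
        unfolding v(3)[symmetric] by (simp only: mult_ac)
      finally show ?thesis by (simp add: C_def algebra_simps add_divide_distrib)
    qed
    have "C \<ge> 0" using C1(1) C0(1) D1(1) D0(1) by (simp add: C_def)
    then show ?thesis using bound unfolding h_def by blast
  qed (auto intro!: exI[of _ 0])
qed

section \<open>Central limit theorem on the cube\<close>

definition cube_mean :: "nat \<Rightarrow> nat \<Rightarrow> ((nat \<Rightarrow> complex) \<Rightarrow> real) \<Rightarrow> real" where
  "cube_mean q N f = (\<Sum>x\<in>cyclic_cube q N. f x) / real q ^ N"

text \<open>The value at \<open>z\<close> of \<open>z + z\<^sup>2 + \<dots> + z\<^bsup>q-1\<^esup>\<close>, for a \<open>q\<close>-th root of unity \<open>z\<close>.\<close>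

definition root_sum :: "nat \<Rightarrow> complex \<Rightarrow> real" where
  "root_sum q z = (if z = 1 then real q - 1 else - 1)"

text \<open>Under the uniform measure each \<open>root_sum\<close> has mean 0 and variance
  \<open>q - 1\<close>, so for \<open>N > 0\<close> this is the sum standardised to variance
  1.\<close>

definition norm_sum :: "nat \<Rightarrow> nat \<Rightarrow> (nat \<Rightarrow> complex) \<Rightarrow> real" where
  "norm_sum q N x = (\<Sum>j<N. root_sum q (x j)) / sqrt ((real q - 1) * real N)"

context
  fixes q :: nat
  assumes q: "2 \<le> q"
begin

lemma finite_roots [simp]: "finite {z::complex. z ^ q = 1}"
  using q by (intro finite_roots_unity) auto

lemma card_roots [simp]: "card {z::complex. z ^ q = 1} = q"
  using q by (intro card_roots_unity_eq) auto

lemma finite_cube [simp]: "finite (cyclic_cube q N)"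
  unfolding cyclic_cube_def by (intro finite_PiE) auto

lemma card_cube [simp]: "card (cyclic_cube q N) = q ^ N"
  unfolding cyclic_cube_def by (subst card_PiE) auto

lemma cube_nonempty [simp]: "cyclic_cube q N \<noteq> {}"
  using card_cube[of N] q by (metis card.empty power_not_zero not_numeral_le_zero)

text \<open>Independence of the coordinates in elementary form. The characteristic function and the
  exponential moments of the sum are both computed from it.\<close>

lemma sum_cube_prod:
  fixes g :: "complex \<Rightarrow> 'c :: comm_semiring_1"
  shows "(\<Sum>x\<in>cyclic_cube q N. \<Prod>j<N. g (x j)) = (\<Sum>z\<in>{z. z ^ q = 1}. g z) ^ N"
  using prod_sum_PiE[of "{..<N}" "\<lambda>_. {z. z ^ q = 1}" "\<lambda>_. g"]
  by (simp add: cyclic_cube_def)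

lemma sum_root_sum:
  fixes g :: "real \<Rightarrow> 'c :: comm_ring_1"
  shows "(\<Sum>z\<in>{z. z ^ q = 1}. g (root_sum q z)) = g (real q - 1) + of_nat (q - 1) * g (- 1)"
proof -
  have "(\<Sum>z\<in>{z. z ^ q = 1}. g (root_sum q z))
      = g (root_sum q 1) + (\<Sum>z\<in>{z. z ^ q = 1} - {1}. g (root_sum q z))"
    by (rule sum.remove) auto
  also have "(\<Sum>z\<in>{z. z ^ q = 1} - {1}. g (root_sum q z)) = (\<Sum>z\<in>{z::complex. z ^ q = 1} - {1}. g (- 1))"
    by (intro sum.cong) (auto simp: root_sum_def)
  also have "\<dots> = of_nat (card ({z::complex. z ^ q = 1} - {1})) * g (- 1)"
    by simp
  also have "card ({z::complex. z ^ q = 1} - {1}) = q - 1"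
    by (subst card_Diff_singleton) auto
  finally show ?thesis by (simp add: root_sum_def)
qed

lemma cube_mean_mono:
  "(\<And>x. x \<in> cyclic_cube q N \<Longrightarrow> f x \<le> g x) \<Longrightarrow> cube_mean q N f \<le> cube_mean q N g"
  unfolding cube_mean_def by (intro divide_right_mono sum_mono) auto

lemma cube_mean_add: "cube_mean q N (\<lambda>x. f x + g x) = cube_mean q N f + cube_mean q N g"
  by (simp add: cube_mean_def sum.distrib add_divide_distrib)

lemma cube_mean_diff: "cube_mean q N (\<lambda>x. f x - g x) = cube_mean q N f - cube_mean q N g"
  by (simp add: cube_mean_def sum_subtractf diff_divide_distrib)

lemma cube_mean_cmult: "cube_mean q N (\<lambda>x. c * f x) = c * cube_mean q N f"
  by (simp add: cube_mean_def sum_distrib_left)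

lemma cube_mean_sum: "cube_mean q N (\<lambda>x. \<Sum>k\<in>A. f k x) = (\<Sum>k\<in>A. cube_mean q N (f k))"
  unfolding cube_mean_def sum_divide_distrib[symmetric] by (subst sum.swap) simp

lemma cube_mean_abs_le: "\<bar>cube_mean q N f\<bar> \<le> cube_mean q N (\<lambda>x. \<bar>f x\<bar>)"
  unfolding cube_mean_def by (simp add: divide_right_mono)

lemma cube_mean_nonneg: "(\<And>x. x \<in> cyclic_cube q N \<Longrightarrow> 0 \<le> f x) \<Longrightarrow> 0 \<le> cube_mean q N f"
  unfolding cube_mean_def by (intro divide_nonneg_nonneg sum_nonneg) auto

text \<open>Levy's theorem speaks of laws on the real line; integrals against this one turn back
  into finite sums over the cube.\<close>

definition sum_distr :: "nat \<Rightarrow> real measure" where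
  "sum_distr N = distr (measure_pmf (pmf_of_set (cyclic_cube q N))) borel (norm_sum q N)"

lemma real_distribution_sum_distr: "real_distribution (sum_distr N)"
  unfolding sum_distr_def by (rule prob_space.real_distribution_distr) (auto simp: prob_space_measure_pmf)

lemma integral_sum_distr:
  fixes f :: "real \<Rightarrow> 'b::{banach, second_countable_topology}"
  assumes [measurable]: "f \<in> borel_measurable borel"
  shows "integral\<^sup>L (sum_distr N) f = (\<Sum>x\<in>cyclic_cube q N. f (norm_sum q N x)) /\<^sub>R real (q ^ N)"
proof -
  have "integral\<^sup>L (sum_distr N) f
      = integral\<^sup>L (measure_pmf (pmf_of_set (cyclic_cube q N))) (\<lambda>x. f (norm_sum q N x))"
    unfolding sum_distr_def by (subst integral_distr) auto
  also have "\<dots> = (\<Sum>x\<in>cyclic_cube q N. pmf (pmf_of_set (cyclic_cube q N)) x *\<^sub>R f (norm_sum q N x))"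
    by (rule integral_measure_pmf) auto
  also have "\<dots> = (\<Sum>x\<in>cyclic_cube q N. f (norm_sum q N x)) /\<^sub>R real (q ^ N)"
    unfolding scaleR_sum_right by (intro sum.cong) (auto simp: divide_inverse)
  finally show ?thesis .
qed

lemma integral_sum_distr_real:
  assumes [measurable]: "(f :: real \<Rightarrow> real) \<in> borel_measurable borel"
  shows "integral\<^sup>L (sum_distr N) f = cube_mean q N (\<lambda>x. f (norm_sum q N x))"
  by (simp add: integral_sum_distr cube_mean_def divide_inverse mult.commute)

lemma integrable_sum_distr:
  assumes [measurable]: "(f :: real \<Rightarrow> real) \<in> borel_measurable borel"
  shows "integrable (sum_distr N) f"
  unfolding sum_distr_def
  by (subst integrable_distr_eq) (auto intro!: integrable_measure_pmf_finite)

lemma char_sum_distr: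
  "char (sum_distr N) t
     = ((\<Sum>z\<in>{z. z ^ q = 1}. iexp (t / sqrt ((real q - 1) * real N) * root_sum q z)) / of_nat q) ^ N"
proof -
  have "iexp (t * norm_sum q N x)
      = (\<Prod>j<N. iexp (t / sqrt ((real q - 1) * real N) * root_sum q (x j)))" for x
    unfolding norm_sum_def
    by (simp add: exp_sum[symmetric] sum_distrib_left[symmetric] sum_divide_distrib[symmetric] field_simps)
  then show ?thesis
    unfolding char_def
    by (subst integral_sum_distr)
       (auto simp: sum_cube_prod[symmetric] power_divide scaleR_conv_of_real field_simps)
qed

text \<open>Second-order Taylor expansion of the characteristic function of one
  \<open>root_sum\<close>, whose first two moments are 0 and \<open>q - 1\<close>. The cubic
  remainder is estimated crudely by \<open>\<bar>root_sum q z\<bar> \<le> q\<close>.\<close>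

lemma root_sum_char_approx:
  "cmod ((\<Sum>z\<in>{z. z ^ q = 1}. iexp (u * root_sum q z)) / of_nat q - of_real (1 - (real q - 1) * u\<^sup>2 / 2))
     \<le> \<bar>u\<bar> ^ 3 * real q ^ 3"
proof -
  let ?R = "{z::complex. z ^ q = 1}"
  let ?T = "\<lambda>z. (\<Sum>k\<le>2. (\<i> * complex_of_real (u * root_sum q z)) ^ k / fact k)"
  have T: "?T z = 1 + \<i> * of_real u * of_real (root_sum q z) - of_real (u\<^sup>2 / 2) * of_real ((root_sum q z)\<^sup>2)" for z
    by (simp add: eval_nat_numeral power2_eq_square algebra_simps)
  have s1: "(\<Sum>z\<in>?R. complex_of_real (root_sum q z)) = 0"
    using q by (subst sum_root_sum[of complex_of_real]) (simp add: of_nat_diff)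
  have s2: "(\<Sum>z\<in>?R. complex_of_real ((root_sum q z)\<^sup>2)) = of_real (real q * (real q - 1))"
    using q by (subst sum_root_sum[of "\<lambda>y. complex_of_real (y\<^sup>2)"])
      (simp add: of_nat_diff power2_eq_square algebra_simps)
  have "(\<Sum>z\<in>?R. ?T z) = of_nat q - of_real (u\<^sup>2 / 2) * of_real (real q * (real q - 1))"
    unfolding T sum.distrib sum_subtractf sum_distrib_left[symmetric] s1 s2 by simp
  also have "\<dots> = of_nat q * of_real (1 - (real q - 1) * u\<^sup>2 / 2)"
    by (simp add: algebra_simps)
  finally have eq: "of_real (1 - (real q - 1) * u\<^sup>2 / 2) = (\<Sum>z\<in>?R. ?T z) / of_nat q"
    using q by (simp add: field_simps)
  have "cmod ((\<Sum>z\<in>?R. iexp (u * root_sum q z)) / of_nat q - of_real (1 - (real q - 1) * u\<^sup>2 / 2))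
      = cmod (\<Sum>z\<in>?R. iexp (u * root_sum q z) - ?T z) / real q"
    unfolding eq diff_divide_distrib[symmetric] sum_subtractf[symmetric] by (simp add: norm_divide)
  also have "\<dots> \<le> (\<Sum>z\<in>?R. \<bar>u\<bar> ^ 3 * real q ^ 3) / real q"
  proof (intro divide_right_mono order.trans[OF norm_sum] sum_mono)
    fix z
    have "cmod (iexp (u * root_sum q z) - ?T z) \<le> \<bar>u * root_sum q z\<bar> ^ 3 / 6"
      using iexp_approx1[of "u * root_sum q z" 2] by (simp add: eval_nat_numeral)
    also have "\<dots> \<le> \<bar>u * root_sum q z\<bar> ^ 3" by simp
    also have "\<dots> = \<bar>u\<bar> ^ 3 * \<bar>root_sum q z\<bar> ^ 3" by (simp add: abs_mult power_mult_distrib)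
    also have "\<dots> \<le> \<bar>u\<bar> ^ 3 * real q ^ 3"
      using q by (intro mult_left_mono power_mono) (auto simp: root_sum_def)
    finally show "cmod (iexp (u * root_sum q z) - ?T z) \<le> \<bar>u\<bar> ^ 3 * real q ^ 3" .
  qed auto
  also have "\<dots> = \<bar>u\<bar> ^ 3 * real q ^ 3" using q by simp
  finally show ?thesis .
qed

text \<open>Each cube is a probability space of its own, so Levy's continuity theorem is applied to
  the laws directly. The characteristic function is an \<open>N\<close>-th power, compared with
  \<open>(1 - t^2/(2N))^N\<close> through \<open>|a^N - b^N| \<le> N |a - b|\<close> for numbers of
  modulus at most 1; \<open>N\<close> times the cubic error is of order
  \<open>1 / sqrt N\<close>.\<close>

lemma weak_conv_sum_distr: "weak_conv_m sum_distr std_normal_distribution"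
proof (rule levy_continuity)
  fix t :: real
  define b where "b = real q - 1"
  have b: "b > 0" using q by (simp add: b_def)
  define \<phi> where "\<phi> u = (\<Sum>z\<in>{z. z ^ q = 1}. iexp (u * root_sum q z)) / of_nat q" for u
  have \<phi>1: "cmod (\<phi> u) \<le> 1" for u
  proof -
    have "cmod (\<phi> u) \<le> (\<Sum>z\<in>{z::complex. z ^ q = 1}. 1) / real q"
      unfolding \<phi>_def norm_divide norm_of_nat
      by (intro divide_right_mono order.trans[OF norm_sum] sum_mono) auto
    then show ?thesis using q by simp
  qed
  have "\<forall>\<^sub>F N in sequentially. cmod (char (sum_distr N) t - of_real ((1 + (- (t\<^sup>2) / 2) / real N) ^ N))
      \<le> (\<bar>t\<bar> ^ 3 * real q ^ 3 / (b * sqrt b)) / sqrt (real N)"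
  proof (rule eventually_sequentiallyI)
    \<comment> \<open>The threshold ensures \<open>1 - t^2/(2N) \<ge> -1\<close>, so that both bases
      have modulus at most 1.\<close>
    fix N assume N': "N \<ge> nat \<lceil>t\<^sup>2 / 4\<rceil> + 1"
    then have N: "real N \<ge> t\<^sup>2 / 4" "N > 0" by linarith+
    let ?u = "t / sqrt (b * real N)"
    have u2: "b * ?u\<^sup>2 = t\<^sup>2 / real N"
      using b N by (simp add: power_divide)
    have u3: "real N * \<bar>?u\<bar> ^ 3 = \<bar>t\<bar> ^ 3 / (b * sqrt b) / sqrt (real N)"
      using b N by (simp add: power_divide abs_mult real_sqrt_mult power_mult_distrib field_simps power3_eq_cube)
    have "cmod (char (sum_distr N) t - of_real ((1 + (- (t\<^sup>2) / 2) / real N) ^ N))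
        = cmod (\<phi> ?u ^ N - of_real (1 + (- (t\<^sup>2) / 2) / real N) ^ N)"
      by (simp add: char_sum_distr \<phi>_def b_def)
    also have "\<dots> \<le> real N * cmod (\<phi> ?u - of_real (1 + (- (t\<^sup>2) / 2) / real N))"
    proof (rule norm_power_diff[OF \<phi>1])
      have "\<bar>1 + (- (t\<^sup>2) / 2) / real N\<bar> \<le> 1"
        using N by (intro abs_leI) (auto simp: field_simps)
      then show "cmod (of_real (1 + (- (t\<^sup>2) / 2) / real N)) \<le> 1" by (simp only: norm_of_real)
    qed
    also have "\<dots> \<le> real N * (\<bar>?u\<bar> ^ 3 * real q ^ 3)"
    proof (rule mult_left_mono)
      have eq: "1 + (- (t\<^sup>2) / 2) / real N = 1 - b * ?u\<^sup>2 / 2" unfolding u2 by simp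
      show "cmod (\<phi> ?u - of_real (1 + (- (t\<^sup>2) / 2) / real N)) \<le> \<bar>?u\<bar> ^ 3 * real q ^ 3"
        unfolding eq \<phi>_def b_def by (rule root_sum_char_approx)
    qed simp
    also have "\<dots> = (\<bar>t\<bar> ^ 3 / (b * sqrt b) / sqrt (real N)) * real q ^ 3"
      unfolding u3[symmetric] by simp
    finally show "cmod (char (sum_distr N) t - of_real ((1 + (- (t\<^sup>2) / 2) / real N) ^ N))
      \<le> (\<bar>t\<bar> ^ 3 * real q ^ 3 / (b * sqrt b)) / sqrt (real N)"
      by (simp only: times_divide_eq_left mult.commute[of "real q ^ 3"])
  qed
  moreover have "(\<lambda>N. (\<bar>t\<bar> ^ 3 * real q ^ 3 / (b * sqrt b)) / sqrt (real N)) \<longlonglongrightarrow> 0"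
    by (intro real_tendsto_divide_at_top[OF tendsto_const] filterlim_compose[OF sqrt_at_top] filterlim_real_sequentially)
  ultimately have "(\<lambda>N. char (sum_distr N) t - of_real ((1 + (- (t\<^sup>2) / 2) / real N) ^ N)) \<longlonglongrightarrow> 0"
    by (rule Lim_null_comparison)
  moreover have "(\<lambda>N. complex_of_real ((1 + (- (t\<^sup>2) / 2) / real N) ^ N)) \<longlonglongrightarrow> complex_of_real (exp (- (t\<^sup>2) / 2))"
    by (rule isCont_tendsto_compose [OF _ tendsto_exp_limit_sequentially]) auto
  ultimately have "(\<lambda>N. char (sum_distr N) t) \<longlonglongrightarrow> complex_of_real (exp (- (t\<^sup>2) / 2))"
    by (rule Lim_transform[rotated])
  then show "(\<lambda>N. char (sum_distr N) t) \<longlonglongrightarrow> char std_normal_distribution t"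
    by (simp add: char_std_normal_distribution)
qed (auto intro: real_distribution_sum_distr real_dist_normal_dist)

text \<open>For \<open>x = -u < 0\<close> the claim reads
  \<open>1 \<le> (1 - u + u^2) exp u\<close>, and replacing \<open>exp u\<close> by its quadratic
  Taylor polynomial already suffices. The linear term is kept exact because it averages to zero in
  the moment bound.\<close>

lemma exp_le_quadratic:
  fixes x :: real
  assumes "x \<le> 1" shows "exp x \<le> 1 + x + x\<^sup>2"
proof (cases "0 \<le> x")
  case True
  then show ?thesis using exp_bound assms by auto
next
  case False
  define u where "u = - x"
  have u: "u \<ge> 0" using False by (simp add: u_def)
  have "1 \<le> (1 - u + u\<^sup>2) * (1 + u + u\<^sup>2 / 2)"
  proof -
    have "(1 - u + u\<^sup>2) * (1 + u + u\<^sup>2 / 2) = 1 + u\<^sup>2 / 2 + u ^ 3 / 2 + u ^ 4 / 2"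
      by (simp add: algebra_simps add_divide_distrib diff_divide_distrib
          power2_eq_square power3_eq_cube power4_eq_xxxx)
    then show ?thesis using u by simp
  qed
  also have "\<dots> \<le> (1 - u + u\<^sup>2) * exp u"
  proof (rule mult_left_mono[OF exp_lower_Taylor_quadratic[OF u]])
    have "1 - u + u\<^sup>2 = (u - 1 / 2)\<^sup>2 + 3 / 4" by (simp add: power2_eq_square algebra_simps)
    then show "0 \<le> 1 - u + u\<^sup>2" by simp
  qed
  finally show ?thesis
    using u by (simp add: u_def exp_minus field_simps)
qed

text \<open>The mean factors into \<open>N\<close> equal means of \<open>exp (l y)\<close>. In each
  the linear term averages to 0 and the quadratic one to \<open>(q - 1) l^2 = 1 / N\<close>, so the
  product is at most \<open>(1 + 1/N)^N\<close>. The condition \<open>q \<le> N\<close> gives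
  \<open>|l y| \<le> 1\<close>, the range of \<open>exp_le_quadratic\<close>.\<close>

lemma cube_mean_exp_norm_sum:
  assumes N: "q \<le> N" and c: "\<bar>c\<bar> = 1"
  shows "cube_mean q N (\<lambda>x. exp (c * norm_sum q N x)) \<le> exp 1"
proof -
  define b where "b = real q - 1"
  have b: "b > 0" using q by (simp add: b_def)
  define l where "l = c / sqrt (b * real N)"
  have N0: "0 < N" "b \<le> real N" using N q by (auto simp: b_def)
  have l2: "b * l\<^sup>2 = 1 / real N"
  proof -
    have "c\<^sup>2 = 1" using c by (metis power2_abs one_power2)
    then show ?thesis using b N0 by (simp add: l_def power_divide)
  qed
  have lb: "\<bar>l\<bar> * b \<le> 1"
  proof -
    have "(\<bar>l\<bar> * b)\<^sup>2 = b / real N" using l2 by (simp add: power_mult_distrib power2_eq_square field_simps)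
    also have "\<dots> \<le> 1\<^sup>2" using N0 by simp
    finally show ?thesis by (rule power2_le_imp_le) simp
  qed
  have lr: "l * root_sum q z \<le> 1" for z
  proof -
    have "l * root_sum q z \<le> \<bar>l\<bar> * \<bar>root_sum q z\<bar>" by (metis abs_ge_self abs_mult)
    also have "\<dots> \<le> \<bar>l\<bar> * b" using q by (intro mult_left_mono) (auto simp: root_sum_def b_def)
    finally show ?thesis using lb by simp
  qed
  have "(\<Sum>z\<in>{z::complex. z ^ q = 1}. exp (l * root_sum q z))
      \<le> (\<Sum>z\<in>{z. z ^ q = 1}. 1 + l * root_sum q z + (l * root_sum q z)\<^sup>2)"
    by (intro sum_mono exp_le_quadratic lr)
  also have "\<dots> = real q * (1 + b * l\<^sup>2)"
    using q by (subst sum_root_sum[of "\<lambda>y. 1 + l * y + (l * y)\<^sup>2"])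
      (simp add: of_nat_diff power2_eq_square algebra_simps b_def)
  finally have le: "(\<Sum>z\<in>{z::complex. z ^ q = 1}. exp (l * root_sum q z)) / real q \<le> 1 + 1 / real N"
    using q l2 by (simp add: field_simps)
  have "exp (c * norm_sum q N x) = (\<Prod>j<N. exp (l * root_sum q (x j)))" for x
    by (simp add: exp_sum[symmetric] norm_sum_def l_def sum_distrib_left[symmetric] b_def
          sum_divide_distrib[symmetric])
  then have "cube_mean q N (\<lambda>x. exp (c * norm_sum q N x))
      = ((\<Sum>z\<in>{z::complex. z ^ q = 1}. exp (l * root_sum q z)) / real q) ^ N"
    by (simp add: cube_mean_def sum_cube_prod[of "\<lambda>z. exp (l * root_sum q z)"] power_divide)
  also have "\<dots> \<le> (1 + 1 / real N) ^ N"
    by (intro power_mono le divide_nonneg_nonneg sum_nonneg) auto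
  also have "\<dots> \<le> exp (1 / real N) ^ N"
    by (intro power_mono exp_ge_add_one_self) auto
  also have "\<dots> = exp 1"
    using N0 by (simp add: exp_of_nat_mult[symmetric])
  finally show ?thesis .
qed

text \<open>A single term of the exponential series bounds the power by \<open>k!\<close> times
  \<open>exp (1 + \<bar>w\<bar>)\<close>, and \<open>exp \<bar>w\<bar>\<close> is at most the sum of
  the two exponentials already controlled.\<close>

lemma cube_mean_moment:
  "\<exists>B. \<forall>N\<ge>q. cube_mean q N (\<lambda>x. (1 + \<bar>norm_sum q N x\<bar>) ^ k) \<le> B"
proof (intro exI allI impI)
  fix N assume N: "q \<le> N"
  have "(1 + \<bar>w\<bar>) ^ k \<le> (fact k * exp 1) * (exp (1 * w) + exp (- 1 * w))" for w :: real
  proof -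
    have "(1 + \<bar>w\<bar>) ^ k / fact k \<le> exp (1 + \<bar>w\<bar>)"
    proof -
      have "(\<Sum>n\<in>{k}. (1 + \<bar>w\<bar>) ^ n /\<^sub>R fact n) \<le> (\<Sum>n. (1 + \<bar>w\<bar>) ^ n /\<^sub>R fact n)"
        by (rule sum_le_suminf[OF summable_exp_generic]) auto
      then show ?thesis by (simp add: exp_def divide_inverse mult.commute)
    qed
    also have "\<dots> = exp 1 * exp \<bar>w\<bar>" by (simp add: exp_add)
    also have "exp \<bar>w\<bar> \<le> exp (1 * w) + exp (- 1 * w)" by (cases "w \<ge> 0") auto
    finally show ?thesis by (simp add: field_simps)
  qed
  then have "cube_mean q N (\<lambda>x. (1 + \<bar>norm_sum q N x\<bar>) ^ k)
      \<le> cube_mean q N (\<lambda>x. (fact k * exp 1) * (exp (1 * norm_sum q N x) + exp (- 1 * norm_sum q N x)))"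
    by (intro cube_mean_mono)
  also have "\<dots> \<le> (fact k * exp 1) * (exp 1 + exp 1)"
    unfolding cube_mean_cmult cube_mean_add
    by (intro mult_left_mono add_mono cube_mean_exp_norm_sum N) auto
  \<comment> \<open>The schematic bound left by \<open>exI\<close> is instantiated here, by an
    expression free of \<open>N\<close>.\<close>
  finally show "cube_mean q N (\<lambda>x. (1 + \<bar>norm_sum q N x\<bar>) ^ k) \<le> (fact k * exp 1) * (exp 1 + exp 1)" .
qed

end

section \<open>Convergence of absolute moments under weak convergence\<close>

text \<open>The difference \<open>\<bar>f\<bar> - min \<bar>f\<bar> R\<close> vanishes where
  \<open>\<bar>f\<bar> \<le> R\<close>; elsewhere it is at most \<open>\<bar>f\<bar>\<close>, hence
  at most \<open>f^2 / R\<close>.\<close>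

lemma (in prob_space) truncation_error:
  fixes f :: "'a \<Rightarrow> real"
  assumes [measurable]: "f \<in> borel_measurable M" and int: "integrable M (\<lambda>x. (f x)\<^sup>2)" and "R > 0"
  shows "\<bar>expectation (\<lambda>x. \<bar>f x\<bar>) - expectation (\<lambda>x. (min \<bar>f x\<bar> R))\<bar> \<le> expectation (\<lambda>x. (f x)\<^sup>2) / R"
proof -
  have i1: "integrable M (\<lambda>x. \<bar>f x\<bar>)"
    using square_integrable_imp_integrable[OF _ int] by simp
  have i2: "integrable M (\<lambda>x. (min \<bar>f x\<bar> R))"
    using \<open>R > 0\<close> by (intro Bochner_Integration.integrable_bound[OF i1]) auto
  have "expectation (\<lambda>x. \<bar>f x\<bar>) - expectation (\<lambda>x. (min \<bar>f x\<bar> R))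
      = expectation (\<lambda>x. \<bar>f x\<bar> - (min \<bar>f x\<bar> R))"
    using i1 i2 by simp
  moreover have "0 \<le> expectation (\<lambda>x. \<bar>f x\<bar> - (min \<bar>f x\<bar> R))"
    by (intro integral_nonneg_AE) auto
  moreover have "expectation (\<lambda>x. \<bar>f x\<bar> - (min \<bar>f x\<bar> R)) \<le> expectation (\<lambda>x. (f x)\<^sup>2 / R)"
  proof (intro integral_mono)
    fix x
    show "\<bar>f x\<bar> - (min \<bar>f x\<bar> R) \<le> (f x)\<^sup>2 / R"
    proof (cases "\<bar>f x\<bar> \<le> R")
      case False
      then have "\<bar>f x\<bar> * R \<le> \<bar>f x\<bar> * \<bar>f x\<bar>" by (intro mult_left_mono) auto
      then show ?thesis using False \<open>R > 0\<close>
        by (simp add: field_simps power2_eq_square add_increasing)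
    qed (use \<open>R > 0\<close> in auto)
  qed (use i1 i2 int in auto)
  ultimately show ?thesis by simp
qed

text \<open>Uniform integrability in disguise: weak convergence handles the bounded continuous
  function \<open>min \<bar>f\<bar> R\<close>, and bounded second moments make the truncation error
  small uniformly in \<open>n\<close>.\<close>

lemma weak_conv_imp_abs_moment_conv:
  fixes \<mu> :: "nat \<Rightarrow> real measure" and f :: "real \<Rightarrow> real"
  assumes \<mu>: "\<And>n. real_distribution (\<mu> n)" and \<nu>: "real_distribution \<nu>" and wc: "weak_conv_m \<mu> \<nu>"
    and f: "continuous_on UNIV f"
    and int: "\<And>n. integrable (\<mu> n) (\<lambda>x. (f x)\<^sup>2)" and int': "integrable \<nu> (\<lambda>x. (f x)\<^sup>2)"
    and bound: "\<forall>\<^sub>F n in sequentially. integral\<^sup>L (\<mu> n) (\<lambda>x. (f x)\<^sup>2) \<le> B"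
  shows "(\<lambda>n. integral\<^sup>L (\<mu> n) (\<lambda>x. \<bar>f x\<bar>)) \<longlonglongrightarrow> integral\<^sup>L \<nu> (\<lambda>x. \<bar>f x\<bar>)"
proof (rule tendstoI)
  fix e :: real assume e: "e > 0"
  interpret \<nu>: real_distribution \<nu> by fact
  have [measurable]: "f \<in> borel_measurable borel"
    using f by (rule borel_measurable_continuous_onI)
  \<comment> \<open>One bound for the second moments of the sequence and of the limit; the 1 makes
    it positive, so that the truncation level below is positive too.\<close>
  define B' where "B' = max 1 (max B (integral\<^sup>L \<nu> (\<lambda>x. (f x)\<^sup>2)))"
  have B': "B' > 0" "B \<le> B'" "integral\<^sup>L \<nu> (\<lambda>x. (f x)\<^sup>2) \<le> B'" by (auto simp: B'_def)
  \<comment> \<open>Each truncation then costs at most \<open>e / 4\<close>, which leaves room in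
    the split of \<open>e\<close> into three parts.\<close>
  define R where "R = 4 * B' / e"
  have R: "R > 0" "B' / R < e / 3" using B' e by (auto simp: R_def field_simps)
  have "(\<lambda>n. integral\<^sup>L (\<mu> n) (\<lambda>x. (min \<bar>f x\<bar> R))) \<longlonglongrightarrow> integral\<^sup>L \<nu> (\<lambda>x. (min \<bar>f x\<bar> R))"
  proof (rule weak_conv_imp_integral_bdd_continuous_conv[OF \<mu> \<nu> wc, where B = R])
    fix x
    have "continuous_on UNIV (\<lambda>x. (min \<bar>f x\<bar> R))" using f by (intro continuous_intros)
    then show "isCont (\<lambda>x. (min \<bar>f x\<bar> R)) x" by (simp add: continuous_on_eq_continuous_at)
    show "norm ((min \<bar>f x\<bar> R)) \<le> R" using R by auto
  qed
  then have "\<forall>\<^sub>F n in sequentially.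
      dist (integral\<^sup>L (\<mu> n) (\<lambda>x. (min \<bar>f x\<bar> R))) (integral\<^sup>L \<nu> (\<lambda>x. (min \<bar>f x\<bar> R))) < e / 3"
    using e by (intro tendstoD) auto
  with bound show "\<forall>\<^sub>F n in sequentially.
      dist (integral\<^sup>L (\<mu> n) (\<lambda>x. \<bar>f x\<bar>)) (integral\<^sup>L \<nu> (\<lambda>x. \<bar>f x\<bar>)) < e"
  proof eventually_elim
    case (elim n)
    interpret \<mu>: real_distribution "\<mu> n" by fact
    have "\<bar>integral\<^sup>L (\<mu> n) (\<lambda>x. \<bar>f x\<bar>) - integral\<^sup>L (\<mu> n) (\<lambda>x. (min \<bar>f x\<bar> R))\<bar>
        \<le> integral\<^sup>L (\<mu> n) (\<lambda>x. (f x)\<^sup>2) / R"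
      by (rule \<mu>.truncation_error[OF _ int R(1)]) simp
    also have "\<dots> \<le> B' / R" using elim B' R by (intro divide_right_mono) auto
    finally have 1: "\<bar>integral\<^sup>L (\<mu> n) (\<lambda>x. \<bar>f x\<bar>) - integral\<^sup>L (\<mu> n) (\<lambda>x. (min \<bar>f x\<bar> R))\<bar> \<le> B' / R" .
    have "\<bar>integral\<^sup>L \<nu> (\<lambda>x. \<bar>f x\<bar>) - integral\<^sup>L \<nu> (\<lambda>x. (min \<bar>f x\<bar> R))\<bar>
        \<le> integral\<^sup>L \<nu> (\<lambda>x. (f x)\<^sup>2) / R"
      by (rule \<nu>.truncation_error[OF _ int' R(1)]) simp
    also have "\<dots> \<le> B' / R" using B' R by (intro divide_right_mono) auto
    finally show ?case using 1 elim(2) R(2) unfolding dist_real_def by linarith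
  qed
qed

lemma continuous_He [continuous_intros]: "continuous_on A (He k)"
proof (induction k rule: less_induct)
  case (less k)
  consider "k = 0" | "k = 1" | j where "k = Suc (Suc j)"
    by (metis One_nat_def not0_implies_Suc)
  then show ?case
  proof cases
    case 3
    then have "continuous_on A (He (Suc j))" "continuous_on A (He j)" using less by auto
    then show ?thesis unfolding 3 He_Suc_Suc[abs_def] by (intro continuous_intros)
  qed (auto simp: He_0[abs_def] He_1[abs_def] continuous_on_id)
qed

text \<open>Domination by a multiple of \<open>1 + x^(2k)\<close>: the even exponent removes the
  absolute value, and the normal law has all moments.\<close>

lemma integrable_std_normal_He_sq: "integrable std_normal_distribution (\<lambda>x. (He k x)\<^sup>2)"
proof -
  obtain C where C: "C \<ge> 0" "\<And>w. \<bar>He k w\<bar> \<le> C * (1 + \<bar>w\<bar>) ^ k" using He_bound by metis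
  have [measurable]: "He k \<in> borel_measurable borel"
    by (rule borel_measurable_continuous_onI) (rule continuous_He)
  have "integrable std_normal_distribution (\<lambda>x. C\<^sup>2 * 2 ^ (2 * k) * (1 + x ^ (2 * k)))"
    by (intro integrable_mult_right Bochner_Integration.integrable_add integrable_std_normal_distribution_moment)
      (auto intro!: real_distribution.finite_borel_measure_M
        finite_measure.integrable_const prob_space_imp_subprob_space
        simp: prob_space.finite_measure prob_space_normal_density)
  then show ?thesis
  proof (rule Bochner_Integration.integrable_bound)
    show "AE x in std_normal_distribution. norm ((He k x)\<^sup>2) \<le> norm (C\<^sup>2 * 2 ^ (2 * k) * (1 + x ^ (2 * k)))"
    proof (intro AE_I2)
      fix x :: real
      have "(1 + \<bar>x\<bar>) ^ (2 * k) \<le> (2 * max 1 \<bar>x\<bar>) ^ (2 * k)" by (intro power_mono) auto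
      also have "\<dots> = 2 ^ (2 * k) * max 1 \<bar>x\<bar> ^ (2 * k)" by (simp add: power_mult_distrib)
      also have "max 1 \<bar>x\<bar> ^ (2 * k) \<le> 1 + \<bar>x\<bar> ^ (2 * k)" by (auto simp: max_def)
      also have "\<bar>x\<bar> ^ (2 * k) = x ^ (2 * k)" by (simp add: power_even_abs)
      finally have le: "(1 + \<bar>x\<bar>) ^ (2 * k) \<le> 2 ^ (2 * k) * (1 + x ^ (2 * k))" by simp
      have "(He k x)\<^sup>2 \<le> (C * (1 + \<bar>x\<bar>) ^ k)\<^sup>2" using C(2)[of x] by (metis abs_ge_zero power2_abs power_mono)
      also have "\<dots> = C\<^sup>2 * (1 + \<bar>x\<bar>) ^ (2 * k)" by (simp add: power_mult_distrib power_mult mult.commute power_even_eq)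
      also have "\<dots> \<le> C\<^sup>2 * (2 ^ (2 * k) * (1 + x ^ (2 * k)))" using le by (intro mult_left_mono) auto
      finally show "norm ((He k x)\<^sup>2) \<le> norm (C\<^sup>2 * 2 ^ (2 * k) * (1 + x ^ (2 * k)))" by simp
    qed
  qed simp
qed

section \<open>Limits of means of Hermite and Krawtchouk polynomials on the cube\<close>

lemma cube_mean_He_tendsto:
  assumes q: "2 \<le> q"
  shows "(\<lambda>N. cube_mean q N (\<lambda>x. \<bar>He k (norm_sum q N x)\<bar>))
           \<longlonglongrightarrow> integral\<^sup>L std_normal_distribution (\<lambda>x. \<bar>He k x\<bar>)"
proof -
  have [measurable]: "He k \<in> borel_measurable borel"
    by (rule borel_measurable_continuous_onI) (rule continuous_He)
  obtain C where C: "C \<ge> 0" "\<And>w. \<bar>He k w\<bar> \<le> C * (1 + \<bar>w\<bar>) ^ k" using He_bound by metis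
  obtain B where B: "\<And>N. q \<le> N \<Longrightarrow> cube_mean q N (\<lambda>x. (1 + \<bar>norm_sum q N x\<bar>) ^ (2 * k)) \<le> B"
    using cube_mean_moment[OF q] by blast
  have "(\<lambda>N. integral\<^sup>L (sum_distr q N) (\<lambda>x. \<bar>He k x\<bar>))
      \<longlonglongrightarrow> integral\<^sup>L std_normal_distribution (\<lambda>x. \<bar>He k x\<bar>)"
  proof (rule weak_conv_imp_abs_moment_conv)
    show "\<forall>\<^sub>F N in sequentially. integral\<^sup>L (sum_distr q N) (\<lambda>x. (He k x)\<^sup>2) \<le> C\<^sup>2 * B"
    proof (rule eventually_sequentiallyI[of q])
      fix N assume N: "q \<le> N"
      have "(He k w)\<^sup>2 \<le> C\<^sup>2 * (1 + \<bar>w\<bar>) ^ (2 * k)" for w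
      proof -
        have "(He k w)\<^sup>2 \<le> (C * (1 + \<bar>w\<bar>) ^ k)\<^sup>2" using C(2)[of w] by (metis abs_ge_zero power2_abs power_mono)
        then show ?thesis by (simp add: power_mult_distrib power_even_eq)
      qed
      then have "cube_mean q N (\<lambda>x. (He k (norm_sum q N x))\<^sup>2)
          \<le> cube_mean q N (\<lambda>x. C\<^sup>2 * (1 + \<bar>norm_sum q N x\<bar>) ^ (2 * k))"
        by (intro cube_mean_mono[OF q])
      also have "\<dots> \<le> C\<^sup>2 * B" unfolding cube_mean_cmult[OF q] using B[OF N] by (intro mult_left_mono) auto
      finally show "integral\<^sup>L (sum_distr q N) (\<lambda>x. (He k x)\<^sup>2) \<le> C\<^sup>2 * B"
        by (simp add: integral_sum_distr_real[OF q])
    qed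
  qed (auto intro!: real_distribution_sum_distr[OF q] real_dist_normal_dist weak_conv_sum_distr[OF q]
        continuous_He integrable_sum_distr[OF q] integrable_std_normal_He_sq)
  then show ?thesis by (simp add: integral_sum_distr_real[OF q])
qed

text \<open>Averaging the pointwise bound of \<open>kraw_He_bound\<close> against the bounded moment
  of order \<open>k\<close> leaves an error \<open>C B / sqrt N\<close>.\<close>

lemma cube_mean_kraw_tendsto:
  assumes q: "2 \<le> q"
  shows "(\<lambda>N. cube_mean q N (\<lambda>x. \<bar>kraw (real q - 2) (sqrt ((real q - 1) * real N)) (real N) k (norm_sum q N x)\<bar>))
           \<longlonglongrightarrow> integral\<^sup>L std_normal_distribution (\<lambda>x. \<bar>He k x\<bar>)"
proof -
  let ?h = "\<lambda>N x. kraw (real q - 2) (sqrt ((real q - 1) * real N)) (real N) k (norm_sum q N x)"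
  let ?H = "\<lambda>N x. He k (norm_sum q N x)"
  obtain C where C: "C \<ge> 0" "\<And>n w. n > 0 \<Longrightarrow>
      \<bar>kraw (real q - 2) (sqrt ((real q - 1) * real n)) (real n) k w - He k w\<bar> \<le> C / sqrt (real n) * (1 + \<bar>w\<bar>) ^ k"
    using kraw_He_bound[of "real q - 2" "real q - 1" k] q by auto
  obtain B where B: "\<And>N. q \<le> N \<Longrightarrow> cube_mean q N (\<lambda>x. (1 + \<bar>norm_sum q N x\<bar>) ^ k) \<le> B"
    using cube_mean_moment[OF q] by blast
  have "\<forall>\<^sub>F N in sequentially. norm (cube_mean q N (\<lambda>x. \<bar>?h N x\<bar>) - cube_mean q N (\<lambda>x. \<bar>?H N x\<bar>))
      \<le> C * B / sqrt (real N)"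
  proof (rule eventually_sequentiallyI[of q])
    fix N assume N: "q \<le> N"
    have "norm (cube_mean q N (\<lambda>x. \<bar>?h N x\<bar>) - cube_mean q N (\<lambda>x. \<bar>?H N x\<bar>))
        \<le> cube_mean q N (\<lambda>x. \<bar>\<bar>?h N x\<bar> - \<bar>?H N x\<bar>\<bar>)"
      unfolding cube_mean_diff[OF q, symmetric] real_norm_def by (rule cube_mean_abs_le[OF q])
    also have "\<dots> \<le> cube_mean q N (\<lambda>x. C / sqrt (real N) * (1 + \<bar>norm_sum q N x\<bar>) ^ k)"
      using N q by (intro cube_mean_mono[OF q] order.trans[OF abs_triangle_ineq3] C) auto
    also have "\<dots> \<le> C / sqrt (real N) * B"
      unfolding cube_mean_cmult[OF q] using C(1) by (intro mult_left_mono B N) auto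
    finally show "norm (cube_mean q N (\<lambda>x. \<bar>?h N x\<bar>) - cube_mean q N (\<lambda>x. \<bar>?H N x\<bar>))
      \<le> C * B / sqrt (real N)" by simp
  qed
  moreover have "(\<lambda>N. C * B / sqrt (real N)) \<longlonglongrightarrow> 0"
    by (intro real_tendsto_divide_at_top[OF tendsto_const] filterlim_compose[OF sqrt_at_top] filterlim_real_sequentially)
  ultimately have "(\<lambda>N. cube_mean q N (\<lambda>x. \<bar>?h N x\<bar>) - cube_mean q N (\<lambda>x. \<bar>?H N x\<bar>)) \<longlonglongrightarrow> 0"
    by (rule Lim_null_comparison)
  with cube_mean_He_tendsto[OF q, of k] show ?thesis
    by (rule Lim_transform)
qed

text \<open>The part of degree \<open>k\<close> has mean size \<open>s^k\<close>; after division by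
  \<open>s^d\<close> each part with \<open>k < d\<close> is a convergent mean times a negative power
  of \<open>s\<close>, so only the top degree survives.\<close>

lemma cube_mean_kraw_sum_tendsto:
  assumes q: "2 \<le> q"
  defines "s \<equiv> \<lambda>N. sqrt ((real q - 1) * real N)"
  shows "(\<lambda>N. cube_mean q N (\<lambda>x. \<bar>\<Sum>k\<le>d. s N ^ k / fact k * kraw (real q - 2) (s N) (real N) k (norm_sum q N x)\<bar>) / s N ^ d)
           \<longlonglongrightarrow> integral\<^sup>L std_normal_distribution (\<lambda>x. \<bar>He d x\<bar>) / fact d"
proof -
  define h where "h N k x = kraw (real q - 2) (s N) (real N) k (norm_sum q N x)" for N k x
  define I where "I k = integral\<^sup>L std_normal_distribution (\<lambda>x. \<bar>He k x\<bar>)" for k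
  let ?A = "\<lambda>N k. cube_mean q N (\<lambda>x. \<bar>h N k x\<bar>)"
  let ?L = "\<lambda>N. cube_mean q N (\<lambda>x. \<bar>\<Sum>k\<le>d. s N ^ k / fact k * h N k x\<bar>) / s N ^ d"
  have A: "(\<lambda>N. ?A N k) \<longlonglongrightarrow> I k" for k
    using cube_mean_kraw_tendsto[OF q] by (simp add: h_def I_def s_def)
  have s_top: "filterlim s at_top sequentially"
    unfolding s_def using q
    by (intro filterlim_compose[OF sqrt_at_top] filterlim_tendsto_pos_mult_at_top[OF tendsto_const]
          filterlim_real_sequentially) auto
  have "\<forall>\<^sub>F N in sequentially. norm (?L N - ?A N d / fact d)
      \<le> (\<Sum>k<d. (1 / s N ^ (d - k)) * (?A N k / fact k))"
  proof (rule eventually_sequentiallyI[of 1])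
    fix N :: nat assume N: "1 \<le> N"
    have s: "s N > 0" using N q by (simp add: s_def)
    have L: "?L N = cube_mean q N (\<lambda>x. \<bar>\<Sum>k\<le>d. s N ^ k / s N ^ d / fact k * h N k x\<bar>)"
    proof -
      have "\<bar>\<Sum>k\<le>d. s N ^ k / s N ^ d / fact k * h N k x\<bar> = 1 / s N ^ d * \<bar>\<Sum>k\<le>d. s N ^ k / fact k * h N k x\<bar>" for x
      proof -
        have "(\<Sum>k\<le>d. s N ^ k / s N ^ d / fact k * h N k x) = 1 / s N ^ d * (\<Sum>k\<le>d. s N ^ k / fact k * h N k x)"
          by (simp add: sum_distrib_left field_simps)
        then show ?thesis using s by (simp add: abs_mult)
      qed
      then show ?thesis by (simp only: cube_mean_cmult[OF q]) simp
    qed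
    have Ad: "?A N d / fact d = cube_mean q N (\<lambda>x. \<bar>1 / fact d * h N d x\<bar>)"
      using cube_mean_cmult[OF q, of N "1 / fact d" "\<lambda>x. \<bar>h N d x\<bar>"] by (simp add: abs_mult)
    have "norm (?L N - ?A N d / fact d)
        \<le> cube_mean q N (\<lambda>x. \<bar>\<bar>\<Sum>k\<le>d. s N ^ k / s N ^ d / fact k * h N k x\<bar> - \<bar>1 / fact d * h N d x\<bar>\<bar>)"
      unfolding L Ad cube_mean_diff[OF q, symmetric] real_norm_def by (rule cube_mean_abs_le[OF q])
    also have "\<dots> \<le> cube_mean q N (\<lambda>x. \<Sum>k<d. (1 / s N ^ (d - k) / fact k) * \<bar>h N k x\<bar>)"
    proof (intro cube_mean_mono[OF q])
      fix x
      have "(\<Sum>k\<le>d. s N ^ k / s N ^ d / fact k * h N k x)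
          = 1 / fact d * h N d x + (\<Sum>k<d. s N ^ k / s N ^ d / fact k * h N k x)"
        using s by (simp add: lessThan_Suc_atMost[symmetric])
      then have "\<bar>\<bar>\<Sum>k\<le>d. s N ^ k / s N ^ d / fact k * h N k x\<bar> - \<bar>1 / fact d * h N d x\<bar>\<bar>
          \<le> \<bar>\<Sum>k<d. s N ^ k / s N ^ d / fact k * h N k x\<bar>" by linarith
      also have "\<dots> \<le> (\<Sum>k<d. \<bar>s N ^ k / s N ^ d / fact k * h N k x\<bar>)" by (rule sum_abs)
      also have "\<dots> = (\<Sum>k<d. (1 / s N ^ (d - k) / fact k) * \<bar>h N k x\<bar>)"
        using s by (intro sum.cong) (auto simp: abs_mult power_diff)
      finally show "\<bar>\<bar>\<Sum>k\<le>d. s N ^ k / s N ^ d / fact k * h N k x\<bar> - \<bar>1 / fact d * h N d x\<bar>\<bar>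
          \<le> (\<Sum>k<d. (1 / s N ^ (d - k) / fact k) * \<bar>h N k x\<bar>)" .
    qed
    also have "\<dots> = (\<Sum>k<d. (1 / s N ^ (d - k)) * (?A N k / fact k))"
      unfolding cube_mean_sum[OF q] cube_mean_cmult[OF q] by simp
    finally show "norm (?L N - ?A N d / fact d) \<le> (\<Sum>k<d. (1 / s N ^ (d - k)) * (?A N k / fact k))" .
  qed
  moreover have "(\<lambda>N. \<Sum>k<d. (1 / s N ^ (d - k)) * (?A N k / fact k)) \<longlonglongrightarrow> 0"
  proof (rule tendsto_null_sum)
    fix k assume "k \<in> {..<d}"
    then have "0 < d - k" by simp
    then have "filterlim (\<lambda>N. s N ^ (d - k)) at_top sequentially"
      by (rule filterlim_pow_at_top[OF _ s_top])
    then have "(\<lambda>N. 1 / s N ^ (d - k)) \<longlonglongrightarrow> 0"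
      by (rule real_tendsto_divide_at_top[OF tendsto_const])
    moreover have "(\<lambda>N. ?A N k / fact k) \<longlonglongrightarrow> I k / fact k"
      by (rule tendsto_divide[OF A tendsto_const]) simp
    ultimately have "(\<lambda>N. (1 / s N ^ (d - k)) * (?A N k / fact k)) \<longlonglongrightarrow> 0 * (I k / fact k)"
      by (rule tendsto_mult)
    then show "(\<lambda>N. (1 / s N ^ (d - k)) * (?A N k / fact k)) \<longlonglongrightarrow> 0"
      by (simp only: mult_zero_left)
  qed
  ultimately have "(\<lambda>N. ?L N - ?A N d / fact d) \<longlonglongrightarrow> 0"
    by (rule Lim_null_comparison)
  moreover have "(\<lambda>N. ?A N d / fact d) \<longlonglongrightarrow> I d / fact d"
    by (rule tendsto_divide[OF A tendsto_const]) simp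
  ultimately show ?thesis
    unfolding h_def I_def by (rule Lim_transform[rotated])
qed

section \<open>Fourier analysis on the cube\<close>

lemma root_unity_norm:
  assumes "(z::complex) ^ q = 1" "2 \<le> (q::nat)"
  shows "cmod z = 1"
proof -
  have "cmod z ^ q = 1 ^ q" using assms(1) by (metis norm_power norm_one power_one)
  then show ?thesis using assms(2) by (subst (asm) power_eq_iff_eq_base) auto
qed

lemma root_unity_cnj:
  assumes "(z::complex) ^ q = 1" "2 \<le> (q::nat)"
  shows "z * cnj z = 1" "cnj z * z = 1"
  using root_unity_norm[OF assms] by (simp_all add: complex_norm_square[symmetric] mult.commute)

lemma sum_apply_fun: "(\<Sum>i\<in>A. f i) x = (\<Sum>i\<in>A. (f i :: 'b \<Rightarrow> 'c :: comm_monoid_add) x)"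
  by (induction A rule: infinite_finite_induct) auto

lemma fun_scale_apply: "fun_scale c f x = c * f x"
  by (simp add: fun_scale_def)

definition frequencies :: "nat \<Rightarrow> nat \<Rightarrow> (nat \<Rightarrow> nat) set" where
  "frequencies q N = {..<N} \<rightarrow>\<^sub>E {..<q}"

definition fourier :: "nat \<Rightarrow> nat \<Rightarrow> ((nat \<Rightarrow> complex) \<Rightarrow> complex) \<Rightarrow> (nat \<Rightarrow> nat) \<Rightarrow> complex" where
  "fourier q N f m = (\<Sum>y\<in>cyclic_cube q N. f y * cnj (character q N m y)) / of_nat (q ^ N)"

definition dirichlet :: "nat \<Rightarrow> nat \<Rightarrow> (nat \<Rightarrow> nat) set \<Rightarrow> (nat \<Rightarrow> complex) \<Rightarrow> complex" where
  "dirichlet q N S x = (\<Sum>m\<in>S. character q N m x)"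

text \<open>For \<open>S\<close> within the frequencies this is the orthogonal projection onto the
  span of the characters in \<open>S\<close>, equivalently convolution with the Dirichlet
  kernel.\<close>

definition partial_sum ::
    "nat \<Rightarrow> nat \<Rightarrow> (nat \<Rightarrow> nat) set \<Rightarrow> ((nat \<Rightarrow> complex) \<Rightarrow> complex) \<Rightarrow> (nat \<Rightarrow> complex) \<Rightarrow> complex" where
  "partial_sum q N S f x = (\<Sum>m\<in>S. fourier q N f m * character q N m x)"

text \<open>The quotient \<open>x / y\<close> in the group, as conjugation inverts roots of unity.
  The restriction keeps the value \<open>undefined\<close> off the index set, so that the result
  stays in the extensional product.\<close>

definition cube_div :: "nat \<Rightarrow> (nat \<Rightarrow> complex) \<Rightarrow> (nat \<Rightarrow> complex) \<Rightarrow> nat \<Rightarrow> complex" where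
  "cube_div N x y = (\<lambda>j\<in>{..<N}. x j * cnj (y j))"

definition cube_functions :: "nat \<Rightarrow> nat \<Rightarrow> ((nat \<Rightarrow> complex) \<Rightarrow> complex) set" where
  "cube_functions q N = {f. \<forall>x. x \<notin> cyclic_cube q N \<longrightarrow> f x = 0}"

lemma cube_functions_closed [simp]:
  "0 \<in> cube_functions q N"
  "f \<in> cube_functions q N \<Longrightarrow> g \<in> cube_functions q N \<Longrightarrow> f + g \<in> cube_functions q N"
  "f \<in> cube_functions q N \<Longrightarrow> fun_scale c f \<in> cube_functions q N"
  by (auto simp: cube_functions_def fun_scale_apply)

lemma cube_functions_minus [simp]:
  "f \<in> cube_functions q N \<Longrightarrow> - f \<in> cube_functions q N"
  "f \<in> cube_functions q N \<Longrightarrow> g \<in> cube_functions q N \<Longrightarrow> f - g \<in> cube_functions q N"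
  by (auto simp: cube_functions_def)

context
  fixes q :: nat
  assumes q: "2 \<le> q"
begin

text \<open>Multiplication by the primitive root \<open>\<omega>\<close> permutes the roots and
  multiplies the sum by \<open>\<omega>^a cnj \<omega>^b\<close>. For \<open>a \<noteq> b\<close>
  this factor differs from 1, so the sum vanishes.\<close>

lemma roots_sum_orthogonal:
  assumes "a < q" "b < q"
  shows "(\<Sum>z\<in>{z::complex. z ^ q = 1}. z ^ a * cnj z ^ b) = (if a = b then of_nat q else 0)"
proof (cases "a = b")
  case True
  have "(\<Sum>z\<in>{z::complex. z ^ q = 1}. z ^ a * cnj z ^ b) = (\<Sum>z\<in>{z::complex. z ^ q = 1}. 1)"
    using q by (intro sum.cong) (auto simp: True power_mult_distrib[symmetric] root_unity_cnj)
  then show ?thesis using True card_roots[OF q] by simp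
next
  case False
  define \<omega> where "\<omega> = cis (2 * pi / real q)"
  have \<omega>: "\<omega> ^ k = cis (2 * pi * real k / real q)" for k
    unfolding \<omega>_def Complex.DeMoivre by (simp add: mult_ac)
  have \<omega>q: "\<omega> ^ q = 1" using q by (simp add: \<omega>)
  note \<omega>1 = root_unity_cnj[OF \<omega>q q]
  have "\<omega> ^ a \<noteq> \<omega> ^ b"
    using bij_betw_imp_inj_on[OF Complex.bij_betw_roots_unity[of q]] assms q False
    unfolding \<omega> inj_on_def by auto
  then have ne: "\<omega> ^ a * cnj \<omega> ^ b \<noteq> 1"
  proof (rule contrapos_nn)
    assume "\<omega> ^ a * cnj \<omega> ^ b = 1"
    then have "\<omega> ^ a * (cnj \<omega> * \<omega>) ^ b = \<omega> ^ b" by (simp add: power_mult_distrib mult.assoc[symmetric])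
    then show "\<omega> ^ a = \<omega> ^ b" by (simp add: \<omega>1)
  qed
  let ?T = "\<Sum>z\<in>{z::complex. z ^ q = 1}. z ^ a * cnj z ^ b"
  have "?T = (\<Sum>z\<in>{z::complex. z ^ q = 1}. (\<omega> * z) ^ a * cnj (\<omega> * z) ^ b)"
  proof (rule sum.reindex_bij_witness[of _ "\<lambda>z. \<omega> * z" "\<lambda>z. cnj \<omega> * z"])
    show "cnj \<omega> * z \<in> {z. z ^ q = 1}" if "z \<in> {z. z ^ q = 1}" for z
      using that \<omega>q by (simp add: power_mult_distrib flip: complex_cnj_power)
    show "\<omega> * z \<in> {z. z ^ q = 1}" if "z \<in> {z. z ^ q = 1}" for z
      using that \<omega>q by (simp add: power_mult_distrib)
  qed (simp_all add: \<omega>1 mult.assoc[symmetric])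
  also have "\<dots> = (\<omega> ^ a * cnj \<omega> ^ b) * ?T"
    by (simp add: power_mult_distrib sum_distrib_left mult_ac)
  finally have "(1 - \<omega> ^ a * cnj \<omega> ^ b) * ?T = 0" by (simp add: algebra_simps)
  with ne False show ?thesis by simp
qed

text \<open>The dual relation, summed over exponents: a geometric series in
  \<open>u = z cnj w\<close>, where \<open>u^q = 1\<close> and \<open>u \<noteq> 1\<close> unless
  \<open>z = w\<close>.\<close>

lemma powers_sum_orthogonal:
  assumes z: "(z::complex) ^ q = 1" and w: "w ^ q = 1"
  shows "(\<Sum>a<q. z ^ a * cnj w ^ a) = (if z = w then of_nat q else 0)"
proof -
  let ?u = "z * cnj w"
  have eq: "(\<Sum>a<q. z ^ a * cnj w ^ a) = (\<Sum>a<q. ?u ^ a)" by (simp add: power_mult_distrib)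
  show ?thesis
  proof (cases "z = w")
    case True
    then show ?thesis unfolding eq by (simp add: root_unity_cnj[OF w q])
  next
    case False
    have "?u \<noteq> 1"
    proof
      assume "?u = 1"
      then have "z * (cnj w * w) = w" by (simp add: mult.assoc[symmetric])
      with False show False by (simp add: root_unity_cnj[OF w q])
    qed
    moreover have "?u ^ q = 1" using z w by (simp add: power_mult_distrib flip: complex_cnj_power)
    ultimately show ?thesis using False one_diff_power_eq[of ?u q] unfolding eq by simp
  qed
qed

text \<open>Last step of both orthogonality relations on the cube; extensionality turns agreement on
  the index set into equality of functions.\<close>

lemma prod_delta_PiE:
  fixes c :: "'c :: comm_semiring_1"
  assumes "x \<in> PiE {..<N} B" "y \<in> PiE {..<N} B'"
  shows "(\<Prod>j<N. if x j = y j then c else 0) = (if x = y then c ^ N else 0)"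
proof (cases "x = y")
  case False
  then obtain j where "j < N" "x j \<noteq> y j"
    using assms by (metis PiE_ext PiE_iff extensional_arb lessThan_iff ext)
  then have "(\<Prod>j<N. if x j = y j then c else 0) = 0" by (intro prod_zero) auto
  with False show ?thesis by simp
qed simp

lemma character_orthogonal:
  assumes m: "m \<in> frequencies q N" and k: "k \<in> frequencies q N"
  shows "(\<Sum>x\<in>cyclic_cube q N. character q N m x * cnj (character q N k x))
           = (if m = k then of_nat (q ^ N) else 0)"
proof -
  have "(\<Sum>x\<in>cyclic_cube q N. character q N m x * cnj (character q N k x))
      = (\<Sum>x\<in>cyclic_cube q N. \<Prod>j<N. x j ^ m j * cnj (x j) ^ k j)"
    by (intro sum.cong) (auto simp: character_def prod.distrib)
  also have "\<dots> = (\<Prod>j<N. \<Sum>z\<in>{z. z ^ q = 1}. z ^ m j * cnj z ^ k j)"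
    unfolding cyclic_cube_def using q by (subst prod_sum_PiE) auto
  also have "\<dots> = (\<Prod>j<N. if m j = k j then of_nat q else 0)"
    using m k by (intro prod.cong roots_sum_orthogonal) (auto simp: frequencies_def)
  also have "\<dots> = (if m = k then of_nat (q ^ N) else 0)"
    using m k by (subst prod_delta_PiE) (auto simp: frequencies_def)
  finally show ?thesis .
qed

lemma character_complete:
  assumes x: "x \<in> cyclic_cube q N" and y: "y \<in> cyclic_cube q N"
  shows "(\<Sum>m\<in>frequencies q N. character q N m x * cnj (character q N m y))
           = (if x = y then of_nat (q ^ N) else 0)"
proof -
  have "(\<Sum>m\<in>frequencies q N. character q N m x * cnj (character q N m y))
      = (\<Sum>m\<in>frequencies q N. \<Prod>j<N. x j ^ m j * cnj (y j) ^ m j)"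
    using x y by (intro sum.cong) (auto simp: character_def prod.distrib)
  also have "\<dots> = (\<Prod>j<N. \<Sum>a<q. x j ^ a * cnj (y j) ^ a)"
    unfolding frequencies_def by (subst prod_sum_PiE) auto
  also have "\<dots> = (\<Prod>j<N. if x j = y j then of_nat q else 0)"
    using x y by (intro prod.cong powers_sum_orthogonal) (auto simp: cyclic_cube_def)
  also have "\<dots> = (if x = y then of_nat (q ^ N) else 0)"
    using x y by (subst prod_delta_PiE) (auto simp: cyclic_cube_def)
  finally show ?thesis .
qed

lemma finite_frequencies [simp]: "finite (frequencies q N)"
  unfolding frequencies_def by (intro finite_PiE) auto

lemma fourier_character:
  "m \<in> frequencies q N \<Longrightarrow> k \<in> frequencies q N \<Longrightarrow>
     fourier q N (character q N m) k = (if m = k then 1 else 0)"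
  using q by (simp add: fourier_def character_orthogonal)

lemma fourier_add: "fourier q N (f + g) m = fourier q N f m + fourier q N g m"
  by (simp add: fourier_def sum.distrib algebra_simps add_divide_distrib)

lemma fourier_scale: "fourier q N (fun_scale c f) m = c * fourier q N f m"
  by (simp add: fourier_def sum_distrib_left fun_scale_def mult_ac)

lemma character_cube_div:
  assumes "x \<in> cyclic_cube q N" "y \<in> cyclic_cube q N"
  shows "cube_div N x y \<in> cyclic_cube q N"
    and "character q N m (cube_div N x y) = character q N m x * cnj (character q N m y)"
proof -
  have "cnj (y j) ^ q = 1" if "j < N" for j
    using assms(2) that by (auto simp: cyclic_cube_def simp flip: complex_cnj_power)
  then show 1: "cube_div N x y \<in> cyclic_cube q N"
    using assms(1) by (auto simp: cyclic_cube_def cube_div_def power_mult_distrib)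
  show "character q N m (cube_div N x y) = character q N m x * cnj (character q N m y)"
    using assms 1 by (simp add: character_def) (simp add: cube_div_def power_mult_distrib prod.distrib)
qed

text \<open>The map sending \<open>y\<close> to \<open>x / y\<close> is an involution of the cube,
  which serves as its own inverse when sums over the group are reindexed.\<close>

lemma cube_div_cube_div:
  assumes x: "x \<in> cyclic_cube q N" and y: "y \<in> cyclic_cube q N"
  shows "cube_div N x (cube_div N x y) = y"
proof
  fix j
  show "cube_div N x (cube_div N x y) j = y j"
  proof (cases "j < N")
    case True
    then have "x j * cnj (x j) = 1"
      using x by (intro root_unity_cnj[OF _ q]) (auto simp: cyclic_cube_def)
    with True show ?thesis by (simp add: cube_div_def mult.assoc[symmetric])
  next
    case False
    then have "y j = undefined"
      by (intro PiE_arb[OF y[unfolded cyclic_cube_def]]) simp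
    with False show ?thesis by (simp add: cube_div_def)
  qed
qed

lemma dirichlet_cube_div:
  assumes "x \<in> cyclic_cube q N" "y \<in> cyclic_cube q N"
  shows "dirichlet q N S (cube_div N x y) = (\<Sum>m\<in>S. character q N m x * cnj (character q N m y))"
  using assms by (simp add: dirichlet_def character_cube_div)

lemma partial_sum_add: "partial_sum q N S (f + g) = partial_sum q N S f + partial_sum q N S g"
  by (rule ext) (simp add: partial_sum_def fourier_add ring_distribs sum.distrib)

lemma partial_sum_scale: "partial_sum q N S (fun_scale c f) = fun_scale c (partial_sum q N S f)"
  by (rule ext) (simp add: partial_sum_def fourier_scale sum_distrib_left mult.assoc fun_scale_apply)

text \<open>By linearity it suffices to check single characters, where orthogonality applies. This
  is the projection property of the convolution operator, and it also expands any element of the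
  span in characters.\<close>

lemma span_characters_expansion:
  assumes S: "S \<subseteq> frequencies q N" and f: "f \<in> complex_fun_span (character q N ` S)"
  shows "partial_sum q N S f = f"
  using f
proof (induction rule: complex_fun.span_induct_alt)
  case base
  then show ?case by (simp add: partial_sum_def fourier_def fun_eq_iff)
next
  case (step c x y)
  have fin: "finite S" using S finite_frequencies by (rule finite_subset)
  obtain k where k: "k \<in> S" "x = character q N k" using step by blast
  have "partial_sum q N S x = x"
  proof
    fix z
    have "partial_sum q N S x z = (\<Sum>m\<in>S. if m = k then x z else 0)"
      unfolding partial_sum_def using k S by (intro sum.cong) (auto simp: fourier_character subset_iff)
    then show "partial_sum q N S x z = x z" using fin k by simp
  qed
  with step show ?case by (simp only: partial_sum_add partial_sum_scale)
qed

lemma partial_sum_in_span: "partial_sum q N S f \<in> complex_fun_span (character q N ` S)"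
proof -
  have "partial_sum q N S f = (\<Sum>m\<in>S. fun_scale (fourier q N f m) (character q N m))"
    by (simp add: fun_eq_iff partial_sum_def sum_apply_fun fun_scale_def)
  also have "\<dots> \<in> complex_fun_span (character q N ` S)"
    by (intro complex_fun.span_sum complex_fun.span_scale complex_fun.span_base) auto
  finally show ?thesis .
qed

lemma span_characters_vanish:
  assumes "S \<subseteq> frequencies q N" "f \<in> complex_fun_span (character q N ` S)"
  shows "f \<in> cube_functions q N"
proof -
  have "partial_sum q N S f \<in> cube_functions q N"
    by (auto simp: partial_sum_def cube_functions_def character_def)
  then show ?thesis using span_characters_expansion[OF assms] by simp
qed

text \<open>The partial sum at \<open>x\<close> is the mean over \<open>y\<close> of
  \<open>f y\<close> times the kernel at \<open>x / y\<close>; reindexing by the involution above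
  removes \<open>x\<close> from the resulting bound.\<close>

lemma partial_sum_bound:
  assumes x: "x \<in> cyclic_cube q N" and B: "\<And>y. y \<in> cyclic_cube q N \<Longrightarrow> cmod (f y) \<le> B"
  shows "cmod (partial_sum q N S f x) \<le> cube_mean q N (\<lambda>x. cmod (dirichlet q N S x)) * B"
proof -
  let ?G = "cyclic_cube q N" and ?n = "of_nat (q ^ N) :: complex"
  have "partial_sum q N S f x
      = (\<Sum>y\<in>?G. f y * (\<Sum>m\<in>S. character q N m x * cnj (character q N m y))) / ?n"
    unfolding partial_sum_def fourier_def sum_divide_distrib sum_distrib_right sum_distrib_left
    by (subst sum.swap) (simp add: mult_ac)
  also have "\<dots> = (\<Sum>y\<in>?G. f y * dirichlet q N S (cube_div N x y)) / ?n"
    using x by (simp add: dirichlet_cube_div)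
  finally have "cmod (partial_sum q N S f x) = cmod (\<Sum>y\<in>?G. f y * dirichlet q N S (cube_div N x y)) / real q ^ N"
    by (simp add: norm_divide norm_power)
  also have "\<dots> \<le> (\<Sum>y\<in>?G. B * cmod (dirichlet q N S (cube_div N x y))) / real q ^ N"
    by (intro divide_right_mono order.trans[OF norm_sum] sum_mono) (auto simp: norm_mult intro!: mult_right_mono B)
  also have "(\<Sum>y\<in>?G. B * cmod (dirichlet q N S (cube_div N x y))) = (\<Sum>y\<in>?G. B * cmod (dirichlet q N S y))"
    using x by (intro sum.reindex_bij_witness[of _ "cube_div N x" "cube_div N x"])
      (auto simp: cube_div_cube_div character_cube_div)
  finally show ?thesis
    by (simp add: cube_mean_def sum_distrib_left[symmetric] mult.commute)
qed

lemma fourier_inversion: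
  assumes x: "x \<in> cyclic_cube q N"
  shows "(\<Sum>m\<in>frequencies q N. fourier q N f m * character q N m x) = f x"
proof -
  have "(\<Sum>m\<in>frequencies q N. fourier q N f m * character q N m x)
      = (\<Sum>y\<in>cyclic_cube q N. f y * (\<Sum>m\<in>frequencies q N. character q N m x * cnj (character q N m y))) / of_nat (q ^ N)"
    unfolding fourier_def sum_divide_distrib sum_distrib_right sum_distrib_left
    by (subst sum.swap) (simp add: mult_ac)
  also have "\<dots> = (\<Sum>y\<in>cyclic_cube q N. if x = y then f y * of_nat (q ^ N) else 0) / of_nat (q ^ N)"
    using x by (intro arg_cong2[of _ _ _ _ "(/)"] sum.cong) (auto simp: character_complete)
  also have "\<dots> = f x" using x q finite_cube[OF q] by (simp add: sum.delta')
  finally show ?thesis .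
qed

text \<open>Testing \<open>P\<close> on the translates of \<open>sgn D\<close>, with \<open>D\<close> the Dirichlet kernel, and averaging over
  the group extracts the trace of \<open>P\<close> against \<open>sgn D\<close>, which depends only on \<open>P\<close> being a projection.\<close>

lemma projection_norm_lower_bound:
  fixes P :: "((nat \<Rightarrow> complex) \<Rightarrow> complex) \<Rightarrow> (nat \<Rightarrow> complex) \<Rightarrow> complex"
  assumes S: "S \<subseteq> frequencies q N"
    and add: "\<And>f g. f \<in> cube_functions q N \<Longrightarrow> g \<in> cube_functions q N \<Longrightarrow> P (f + g) = P f + P g"
    and scale: "\<And>c f. f \<in> cube_functions q N \<Longrightarrow> P (fun_scale c f) = fun_scale c (P f)"
    and range: "\<And>f. f \<in> cube_functions q N \<Longrightarrow> P f \<in> complex_fun_span (character q N ` S)"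
    and proj: "\<And>f. f \<in> complex_fun_span (character q N ` S) \<Longrightarrow> P f = f"
    and bound: "\<And>f x. f \<in> cube_functions q N \<Longrightarrow> (\<And>y. y \<in> cyclic_cube q N \<Longrightarrow> cmod (f y) \<le> 1) \<Longrightarrow>
                  x \<in> cyclic_cube q N \<Longrightarrow> cmod (P f x) \<le> C"
  shows "cube_mean q N (\<lambda>x. cmod (dirichlet q N S x)) \<le> C"
proof -
  let ?G = "cyclic_cube q N" and ?M = "frequencies q N" and ?\<chi> = "character q N"
  define n where "n = (of_nat (q ^ N) :: complex)"
  have n: "n \<noteq> 0" using q by (simp add: n_def)
  \<comment> \<open>Chosen so that \<open>s\<close> times the conjugate of the kernel is its
    modulus; where the kernel vanishes \<open>sgn\<close> is 0, so \<open>|s| \<le> 1\<close>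
    everywhere.\<close>
  define s where "s z = sgn (dirichlet q N S z)" for z
  define c where "c = fourier q N s"
  have \<chi>_cube: "?\<chi> m \<in> cube_functions q N" for m
    by (simp add: cube_functions_def character_def)
  \<comment> \<open>Membership is carried along in the induction because additivity of
    \<open>P\<close> is available only on cube functions.\<close>
  have lin: "(\<Sum>m\<in>A. fun_scale (a m) (?\<chi> m)) \<in> cube_functions q N \<and>
      P (\<Sum>m\<in>A. fun_scale (a m) (?\<chi> m)) = (\<Sum>m\<in>A. fun_scale (a m) (P (?\<chi> m)))" if "finite A" for A a
    using that
  proof induction
    case empty
    have "P (fun_scale 0 (?\<chi> m)) = fun_scale 0 (P (?\<chi> m))" for m by (rule scale[OF \<chi>_cube])
    then have "P 0 = 0" by (simp add: fun_scale_def zero_fun_def)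
    then show ?case by (simp add: cube_functions_def zero_fun_def)
  next
    case (insert m A)
    have *: "fun_scale (a m) (?\<chi> m) \<in> cube_functions q N" using \<chi>_cube by simp
    note IH = conjunct1[OF insert.IH] conjunct2[OF insert.IH]
    show ?case
      unfolding sum.insert[OF insert.hyps] add[OF * IH(1)] scale[OF \<chi>_cube] IH(2)
      using cube_functions_closed(2)[OF * IH(1)] by blast
  qed
  \<comment> \<open>The translate of \<open>s\<close> by \<open>g\<close>, written as a Fourier
    series so that \<open>P\<close> can be applied to each character and the value off the cube is
    0.\<close>
  define F where "F g = (\<Sum>m\<in>?M. fun_scale (c m * cnj (?\<chi> m g)) (?\<chi> m))" for g
  have F_cube: "F g \<in> cube_functions q N" for g
    unfolding F_def using lin by simp
  have F_val: "F g y = s (cube_div N y g)" if "g \<in> ?G" "y \<in> ?G" for g y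
  proof -
    have "F g y = (\<Sum>m\<in>?M. c m * ?\<chi> m (cube_div N y g))"
      using that by (simp add: F_def sum_apply_fun fun_scale_def character_cube_div mult_ac)
    also have "\<dots> = s (cube_div N y g)"
      unfolding c_def using that by (intro fourier_inversion character_cube_div)
    finally show ?thesis .
  qed
  have PF: "cmod (P (F g) g) \<le> C" if "g \<in> ?G" for g
    using that by (intro bound F_cube) (auto simp: F_val s_def norm_sgn)
  \<comment> \<open>Up to the factor \<open>n\<close> this is the \<open>m\<close>-th Fourier
    coefficient of \<open>P \<chi>_m\<close>: for \<open>m\<close> in \<open>S\<close> the
    projection fixes the character, otherwise the range of \<open>P\<close> is orthogonal to
    it.\<close>
  have tr: "(\<Sum>g\<in>?G. cnj (?\<chi> m g) * P (?\<chi> m) g) = (if m \<in> S then n else 0)" if m: "m \<in> ?M" for m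
  proof (cases "m \<in> S")
    case True
    then have "P (?\<chi> m) = ?\<chi> m" by (intro proj complex_fun.span_base) auto
    with True m character_orthogonal[OF m m] show ?thesis by (simp add: mult.commute n_def)
  next
    case False
    let ?h = "P (?\<chi> m)"
    have "(\<Sum>g\<in>?G. cnj (?\<chi> m g) * ?h g) = (\<Sum>g\<in>?G. cnj (?\<chi> m g) * partial_sum q N S ?h g)"
      using span_characters_expansion[OF S range[OF \<chi>_cube]] by simp
    also have "\<dots> = (\<Sum>k\<in>S. fourier q N ?h k * (\<Sum>g\<in>?G. ?\<chi> k g * cnj (?\<chi> m g)))"
      unfolding partial_sum_def sum_distrib_left by (subst sum.swap) (simp add: mult_ac)
    also have "\<dots> = 0"
      using False S m by (intro sum.neutral) (auto simp: character_orthogonal subset_iff)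
    finally show ?thesis using False by simp
  qed
  \<comment> \<open>Summing over \<open>g\<close> leaves \<open>n\<close> times the sum of
    \<open>c m\<close> over \<open>S\<close>, which is the pairing of \<open>s\<close> with the
    kernel and hence the sum of its absolute values.\<close>
  have "P (F g) g = (\<Sum>m\<in>?M. c m * cnj (?\<chi> m g) * P (?\<chi> m) g)" for g
    by (simp only: F_def conjunct2[OF lin[OF finite_frequencies]] sum_apply_fun fun_scale_apply)
  then have "(\<Sum>g\<in>?G. P (F g) g) = (\<Sum>m\<in>?M. c m * (\<Sum>g\<in>?G. cnj (?\<chi> m g) * P (?\<chi> m) g))"
    by (simp add: sum_distrib_left mult.assoc) (rule sum.swap)
  also have "\<dots> = (\<Sum>m\<in>?M. if m \<in> S then c m * n else 0)"
    by (intro sum.cong) (auto simp: tr)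
  also have "\<dots> = (\<Sum>m\<in>S. c m * n)"
    using S by (simp add: sum.If_cases Int_absorb1)
  also have "\<dots> = (\<Sum>m\<in>S. \<Sum>y\<in>?G. s y * cnj (?\<chi> m y))"
    using n by (simp add: c_def fourier_def n_def)
  also have "\<dots> = (\<Sum>y\<in>?G. s y * cnj (dirichlet q N S y))"
    unfolding dirichlet_def cnj_sum sum_distrib_left by (rule sum.swap)
  also have "\<dots> = of_real (\<Sum>y\<in>?G. cmod (dirichlet q N S y))"
  proof -
    have "s y * cnj (dirichlet q N S y) = of_real (cmod (dirichlet q N S y))" for y
      by (simp add: s_def sgn_eq complex_norm_square[symmetric] power2_eq_square)
    then show ?thesis by simp
  qed
  finally have "(\<Sum>y\<in>?G. cmod (dirichlet q N S y)) = cmod (\<Sum>g\<in>?G. P (F g) g)"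
    by (simp only: norm_of_real abs_of_nonneg[OF sum_nonneg] norm_ge_zero)
  also have "\<dots> \<le> (\<Sum>g\<in>?G. C)"
    by (intro order.trans[OF norm_sum] sum_mono PF)
  also have "\<dots> = real q ^ N * C" using card_cube[OF q] by simp
  finally show ?thesis using q by (simp add: cube_mean_def field_simps)
qed

lemma inj_on_character: "inj_on (character q N) (frequencies q N)"
proof (rule inj_onI)
  fix m k assume mk: "m \<in> frequencies q N" "k \<in> frequencies q N" "character q N m = character q N k"
  then show "m = k"
    using fourier_character[of m N k] fourier_character[of k N k] by (simp split: if_splits)
qed

text \<open>Pairing a vanishing linear combination with one of its characters isolates the
  coefficient of that character.\<close>

lemma dim_span_characters:
  assumes S: "S \<subseteq> frequencies q N"
  shows "complex_fun_dim (complex_fun_span (character q N ` S)) = card S"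
proof -
  have fin: "finite S" using S finite_frequencies by (rule finite_subset)
  have inj: "inj_on (character q N) S" using inj_on_character S by (rule inj_on_subset)
  have "complex_fun.independent (character q N ` S)"
  proof
    assume "complex_fun.dependent (character q N ` S)"
    then obtain u where u: "\<exists>v\<in>character q N ` S. u v \<noteq> 0"
      "(\<Sum>v\<in>character q N ` S. fun_scale (u v) v) = 0"
      using fin by (auto simp: complex_fun.dependent_finite)
    then obtain k where k: "k \<in> S" "u (character q N k) \<noteq> 0" by auto
    have "(\<Sum>m\<in>S. u (character q N m) * character q N m x) = 0" for x
    proof -
      have "(\<Sum>m\<in>S. fun_scale (u (character q N m)) (character q N m)) = 0"
        using u(2) inj by (simp add: sum.reindex)
      then show ?thesis by (simp add: fun_eq_iff sum_apply_fun fun_scale_def)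
    qed
    then have "0 = (\<Sum>x\<in>cyclic_cube q N. (\<Sum>m\<in>S. u (character q N m) * character q N m x) * cnj (character q N k x))"
      by simp
    also have "\<dots> = (\<Sum>m\<in>S. u (character q N m) * (\<Sum>x\<in>cyclic_cube q N. character q N m x * cnj (character q N k x)))"
      unfolding sum_distrib_left sum_distrib_right by (subst sum.swap) (simp add: mult_ac)
    also have "\<dots> = (\<Sum>m\<in>S. if m = k then u (character q N k) * of_nat (q ^ N) else 0)"
      using k S by (intro sum.cong) (auto simp: character_orthogonal subset_iff)
    also have "\<dots> = u (character q N k) * of_nat (q ^ N)" using fin k by simp
    finally show False using k q by simp
  qed
  then show ?thesis
    using complex_fun.dim_span_eq_card_independent card_image[OF inj] by metis
qed

end

section \<open>The complex Hahn--Banach theorem\<close>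

lemma complex_ring_simps [simp]:
  "carrier complex_ring = UNIV" "x \<otimes>\<^bsub>complex_ring\<^esub> y = x * y" "x \<oplus>\<^bsub>complex_ring\<^esub> y = x + y"
  "\<one>\<^bsub>complex_ring\<^esub> = 1" "\<zero>\<^bsub>complex_ring\<^esub> = 0"
  by (simp_all add: complex_ring_def)

context complex_normed_space
begin

lemma scale_closed [simp]: "x \<in> carrier V \<Longrightarrow> c \<odot>\<^bsub>V\<^esub> x \<in> carrier V"
  by (rule smult_closed) simp_all

lemma scale_add_left: "x \<in> carrier V \<Longrightarrow> (c + d) \<odot>\<^bsub>V\<^esub> x = c \<odot>\<^bsub>V\<^esub> x \<oplus>\<^bsub>V\<^esub> d \<odot>\<^bsub>V\<^esub> x"
  using smult_l_distr[of c d x] by simp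

lemma scale_add_right:
  "x \<in> carrier V \<Longrightarrow> y \<in> carrier V \<Longrightarrow> c \<odot>\<^bsub>V\<^esub> (x \<oplus>\<^bsub>V\<^esub> y) = c \<odot>\<^bsub>V\<^esub> x \<oplus>\<^bsub>V\<^esub> c \<odot>\<^bsub>V\<^esub> y"
  using smult_r_distr[of c x y] by simp

lemma scale_scale: "x \<in> carrier V \<Longrightarrow> c \<odot>\<^bsub>V\<^esub> (d \<odot>\<^bsub>V\<^esub> x) = (c * d) \<odot>\<^bsub>V\<^esub> x"
  using smult_assoc1[of c d x] by simp

lemma scale_one [simp]: "x \<in> carrier V \<Longrightarrow> 1 \<odot>\<^bsub>V\<^esub> x = x"
  using smult_one[of x] by simp

lemma scale_zero_left [simp]: "x \<in> carrier V \<Longrightarrow> 0 \<odot>\<^bsub>V\<^esub> x = \<zero>\<^bsub>V\<^esub>"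
  using smult_l_null[of x] by simp

lemma scale_zero_right [simp]: "c \<odot>\<^bsub>V\<^esub> \<zero>\<^bsub>V\<^esub> = \<zero>\<^bsub>V\<^esub>"
  using smult_r_null[of c] by simp

lemma add_neg_scale: "x \<in> carrier V \<Longrightarrow> x \<oplus>\<^bsub>V\<^esub> (- 1) \<odot>\<^bsub>V\<^esub> x = \<zero>\<^bsub>V\<^esub>"
  using scale_add_left[of x 1 "- 1"] by simp

lemma neg_scale_add: "x \<in> carrier V \<Longrightarrow> (- 1) \<odot>\<^bsub>V\<^esub> x \<oplus>\<^bsub>V\<^esub> x = \<zero>\<^bsub>V\<^esub>"
  using scale_add_left[of x "- 1" 1] by simp

lemma add_swap_middle:
  assumes "x \<in> carrier V" "y \<in> carrier V" "z \<in> carrier V" "w \<in> carrier V"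
  shows "(x \<oplus>\<^bsub>V\<^esub> y) \<oplus>\<^bsub>V\<^esub> (z \<oplus>\<^bsub>V\<^esub> w) = (x \<oplus>\<^bsub>V\<^esub> z) \<oplus>\<^bsub>V\<^esub> (y \<oplus>\<^bsub>V\<^esub> w)"
  using assms by (simp add: M.a_ac)

section \<open>Linear functionals below sublinear ones\<close>

text \<open>The real half of the Hahn-Banach theorem runs on the same complex space with scalars
  restricted to the reals, whence the embedded \<open>t\<close>. Negative values of \<open>p\<close>
  are allowed.\<close>

definition sublinear :: "('v \<Rightarrow> real) \<Rightarrow> bool" where
  "sublinear p \<longleftrightarrow>
     (\<forall>x\<in>carrier V. \<forall>y\<in>carrier V. p (x \<oplus>\<^bsub>V\<^esub> y) \<le> p x + p y) \<and>
     (\<forall>t\<ge>0. \<forall>x\<in>carrier V. p (complex_of_real t \<odot>\<^bsub>V\<^esub> x) = t * p x)"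

lemma sublinear_add:
  "sublinear p \<Longrightarrow> x \<in> carrier V \<Longrightarrow> y \<in> carrier V \<Longrightarrow> p (x \<oplus>\<^bsub>V\<^esub> y) \<le> p x + p y"
  by (auto simp: sublinear_def)

lemma sublinear_scale:
  "sublinear p \<Longrightarrow> x \<in> carrier V \<Longrightarrow> 0 \<le> t \<Longrightarrow> p (complex_of_real t \<odot>\<^bsub>V\<^esub> x) = t * p x"
  by (auto simp: sublinear_def)

lemma sublinear_zero: "sublinear p \<Longrightarrow> p \<zero>\<^bsub>V\<^esub> = 0"
  using sublinear_scale[of p "\<zero>\<^bsub>V\<^esub>" 0] by simp

lemma sublinear_lower: "sublinear p \<Longrightarrow> x \<in> carrier V \<Longrightarrow> - p ((- 1) \<odot>\<^bsub>V\<^esub> x) \<le> p x"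
  using sublinear_add[of p x "(- 1) \<odot>\<^bsub>V\<^esub> x"] by (simp add: add_neg_scale sublinear_zero)

text \<open>Provides the lower bounds, independent of the index, that keep the infima below
  finite.\<close>

lemma sublinear_add_lower:
  assumes "sublinear p" "x \<in> carrier V" "y \<in> carrier V"
  shows "p y - p ((- 1) \<odot>\<^bsub>V\<^esub> x) \<le> p (x \<oplus>\<^bsub>V\<^esub> y)"
proof -
  have "y = (- 1) \<odot>\<^bsub>V\<^esub> x \<oplus>\<^bsub>V\<^esub> (x \<oplus>\<^bsub>V\<^esub> y)"
    using assms by (simp add: M.a_assoc[symmetric] neg_scale_add)
  then have "p y \<le> p ((- 1) \<odot>\<^bsub>V\<^esub> x) + p (x \<oplus>\<^bsub>V\<^esub> y)"
    using sublinear_add[OF assms(1), of "(- 1) \<odot>\<^bsub>V\<^esub> x" "x \<oplus>\<^bsub>V\<^esub> y"] assms by simp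
  then show ?thesis by simp
qed

text \<open>Used for three infima: over a chain in Zorn's lemma, over the real parameter in the
  minimality argument, and over the subspace in \<open>hahn_banach\<close>. The index
  \<open>k\<close> may depend on the points, and homogeneity is assumed only as an inequality for
  \<open>t > 0\<close>, since applying it to \<open>1 / t\<close> gives the converse.\<close>

lemma sublinear_INF:
  fixes g :: "'i \<Rightarrow> 'v \<Rightarrow> real"
  assumes I: "I \<noteq> {}"
    and lower: "\<And>i x. i \<in> I \<Longrightarrow> x \<in> carrier V \<Longrightarrow> L x \<le> g i x"
    and add: "\<And>i j x y. i \<in> I \<Longrightarrow> j \<in> I \<Longrightarrow> x \<in> carrier V \<Longrightarrow> y \<in> carrier V \<Longrightarrow>
                \<exists>k\<in>I. g k (x \<oplus>\<^bsub>V\<^esub> y) \<le> g i x + g j y"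
    and scale: "\<And>i t x. i \<in> I \<Longrightarrow> 0 < t \<Longrightarrow> x \<in> carrier V \<Longrightarrow>
                \<exists>k\<in>I. g k (complex_of_real t \<odot>\<^bsub>V\<^esub> x) \<le> t * g i x"
    and f: "\<And>x. x \<in> carrier V \<Longrightarrow> f x = (INF i\<in>I. g i x)"
  shows "sublinear f"
proof -
  have bdd: "bdd_below ((\<lambda>i. g i x) ` I)" if "x \<in> carrier V" for x
    using lower that by (intro bdd_belowI[of _ "L x"]) auto
  have le: "f x \<le> g i x" if "i \<in> I" "x \<in> carrier V" for i x
    using cINF_lower[OF bdd[OF that(2)] that(1)] f[OF that(2)] by simp
  have ge: "c \<le> f x" if "x \<in> carrier V" "\<And>i. i \<in> I \<Longrightarrow> c \<le> g i x" for c x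
    using that I by (simp add: f cINF_greatest)
  have sc: "f (complex_of_real t \<odot>\<^bsub>V\<^esub> x) \<le> t * f x" if t: "0 < t" and x: "x \<in> carrier V" for t x
  proof -
    have "f (complex_of_real t \<odot>\<^bsub>V\<^esub> x) / t \<le> f x"
    proof (rule ge[OF x])
      fix i assume "i \<in> I"
      then obtain k where "k \<in> I" "g k (complex_of_real t \<odot>\<^bsub>V\<^esub> x) \<le> t * g i x"
        using scale t x by blast
      with le[of k "complex_of_real t \<odot>\<^bsub>V\<^esub> x"] x t
      show "f (complex_of_real t \<odot>\<^bsub>V\<^esub> x) / t \<le> g i x" by (simp add: field_simps)
    qed
    then show ?thesis using t by (simp add: field_simps)
  qed
  \<comment> \<open>The factor 2 gives that this value is at least 0, the factor \<open>1/2\<close>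
    that it is at most 0.\<close>
  have zero: "f \<zero>\<^bsub>V\<^esub> = 0"
    using sc[of 2 "\<zero>\<^bsub>V\<^esub>"] sc[of "1/2" "\<zero>\<^bsub>V\<^esub>"] by simp
  show ?thesis
    unfolding sublinear_def
  proof (intro conjI ballI allI impI)
    fix x y assume x: "x \<in> carrier V" and y: "y \<in> carrier V"
    have 1: "f (x \<oplus>\<^bsub>V\<^esub> y) \<le> g i x + g j y" if "i \<in> I" "j \<in> I" for i j
      using add[OF that x y] le[of _ "x \<oplus>\<^bsub>V\<^esub> y"] x y by (meson M.add.m_closed order.trans)
    have "f (x \<oplus>\<^bsub>V\<^esub> y) - g j y \<le> f x" if "j \<in> I" for j
      using 1 that by (intro ge[OF x]) (auto simp: algebra_simps)
    then have "f (x \<oplus>\<^bsub>V\<^esub> y) - f x \<le> f y"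
      by (intro ge[OF y]) (auto simp: algebra_simps)
    then show "f (x \<oplus>\<^bsub>V\<^esub> y) \<le> f x + f y" by simp
  next
    fix t :: real and x assume t: "0 \<le> t" and x: "x \<in> carrier V"
    show "f (complex_of_real t \<odot>\<^bsub>V\<^esub> x) = t * f x"
    proof (cases "t = 0")
      case False
      then have t: "t > 0" using t by simp
      have "f x \<le> 1 / t * f (complex_of_real t \<odot>\<^bsub>V\<^esub> x)"
        using sc[of "1 / t" "complex_of_real t \<odot>\<^bsub>V\<^esub> x"] t x by (simp add: scale_scale)
      with sc[OF t x] t show ?thesis by (simp add: field_simps)
    qed (use x zero in simp)
  qed
qed

text \<open>A minimal sublinear functional \<open>m\<close> is linear: for every \<open>a\<close>, the sublinear functional
  \<open>x \<mapsto> INF t\<ge>0. m (x + t a) - t m a\<close> is dominated by \<open>m\<close>, hence equals \<open>m\<close>.\<close>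

lemma linear_below_sublinear:
  assumes p: "sublinear p"
  obtains l where "\<And>x. x \<in> carrier V \<Longrightarrow> l x \<le> p x"
    and "\<And>x y. x \<in> carrier V \<Longrightarrow> y \<in> carrier V \<Longrightarrow> l (x \<oplus>\<^bsub>V\<^esub> y) = l x + l y"
    and "\<And>t x. x \<in> carrier V \<Longrightarrow> l (complex_of_real t \<odot>\<^bsub>V\<^esub> x) = t * l x"
proof -
  \<comment> \<open>Functionals are made extensional so that the order on the function type reflects
    the order on the carrier and minimality yields equality of functions.\<close>
  define A where "A = {m \<in> extensional (carrier V). sublinear m \<and> (\<forall>x\<in>carrier V. m x \<le> p x)}"
  have restr: "sublinear (restrict m (carrier V)) \<longleftrightarrow> sublinear m" for m
    by (auto simp: sublinear_def)
  \<comment> \<open>Zorn's lemma for the reversed order: maximal elements are the minimal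
    functionals.\<close>
  have "\<exists>m\<in>A. \<forall>a\<in>A. a \<le> m \<longrightarrow> a = m"
  proof (rule predicate_Zorn)
    show "partial_order_on A (relation_of (\<lambda>m a. a \<le> m) A)"
      by (rule partial_order_on_relation_ofI) auto
  next
    fix C assume C: "C \<in> Chains (relation_of (\<lambda>m a. a \<le> m) A)"
    then have CA: "C \<subseteq> A" and tot: "\<And>a b. a \<in> C \<Longrightarrow> b \<in> C \<Longrightarrow> a \<le> b \<or> b \<le> a"
      by (auto simp: Chains_def relation_of_def)
    show "\<exists>u\<in>A. \<forall>a\<in>C. u \<le> a"
    proof (cases "C = {}")
      case True
      then show ?thesis
        using p by (intro bexI[of _ "restrict p (carrier V)"]) (auto simp: A_def restr)
    next
      case False
      define u where "u = restrict (\<lambda>x. INF m\<in>C. m x) (carrier V)"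
      \<comment> \<open>Since \<open>m x \<ge> - m (-x) \<ge> - p (-x)\<close>, the whole chain has
        a common lower bound at each point.\<close>
      have lower: "- p ((- 1) \<odot>\<^bsub>V\<^esub> x) \<le> m x" if "m \<in> C" "x \<in> carrier V" for m x
      proof -
        have "sublinear m" "m ((- 1) \<odot>\<^bsub>V\<^esub> x) \<le> p ((- 1) \<odot>\<^bsub>V\<^esub> x)" using CA that by (auto simp: A_def)
        with sublinear_lower[of m x] that show ?thesis by simp
      qed
      have u_le: "u x \<le> m x" if "m \<in> C" "x \<in> carrier V" for m x
        using that lower[of _ x] by (auto simp: u_def intro!: cINF_lower bdd_belowI[of _ "- p ((- 1) \<odot>\<^bsub>V\<^esub> x)"])
      have "sublinear u"
      proof (rule sublinear_INF[where I = C and g = "\<lambda>m. m" and L = "\<lambda>x. - p ((- 1) \<odot>\<^bsub>V\<^esub> x)"])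
        fix i j x y assume ij: "i \<in> C" "j \<in> C" and xy: "x \<in> carrier V" "y \<in> carrier V"
        have "sublinear i" "sublinear j" using CA ij by (auto simp: A_def)
        note s = sublinear_add[OF this(1) xy] sublinear_add[OF this(2) xy]
        \<comment> \<open>The smaller of the two members of the chain serves at both points.\<close>
        from tot[OF ij] show "\<exists>k\<in>C. k (x \<oplus>\<^bsub>V\<^esub> y) \<le> i x + j y"
        proof
          assume "i \<le> j"
          then have "i y \<le> j y" by (rule le_funD)
          with s ij show ?thesis by (intro bexI[of _ i]) auto
        next
          assume "j \<le> i"
          then have "j x \<le> i x" by (rule le_funD)
          with s ij show ?thesis by (intro bexI[of _ j]) auto
        qed
      next
        fix i and t :: real and x assume "i \<in> C" "0 < t" "x \<in> carrier V"
        then show "\<exists>k\<in>C. k (complex_of_real t \<odot>\<^bsub>V\<^esub> x) \<le> t * i x"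
          using CA sublinear_scale[of i x t] by (intro bexI[of _ i]) (auto simp: A_def)
      qed (use False lower in \<open>auto simp: u_def\<close>)
      moreover have "u x \<le> p x" if "x \<in> carrier V" for x
      proof -
        obtain m where "m \<in> C" using False by blast
        then have "u x \<le> m x" "m x \<le> p x" using u_le that CA by (auto simp: A_def)
        then show ?thesis by simp
      qed
      moreover have "u \<in> extensional (carrier V)" by (simp add: u_def)
      ultimately have "u \<in> A" by (simp add: A_def)
      moreover have "u \<le> m" if "m \<in> C" for m
      proof (rule le_funI)
        fix x
        show "u x \<le> m x"
          using u_le[OF that, of x] that CA by (cases "x \<in> carrier V") (auto simp: A_def u_def extensional_def)
      qed
      ultimately show ?thesis by blast
    qed
  qed
  then obtain m where mA: "m \<in> A" and min: "\<And>a. a \<in> A \<Longrightarrow> a \<le> m \<Longrightarrow> a = m" by blast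
  then have m: "sublinear m" and mp: "\<And>x. x \<in> carrier V \<Longrightarrow> m x \<le> p x" by (auto simp: A_def)
  have add: "m (x \<oplus>\<^bsub>V\<^esub> a) = m x + m a" if x: "x \<in> carrier V" and a: "a \<in> carrier V" for x a
  proof -
    let ?g = "\<lambda>t x. m (x \<oplus>\<^bsub>V\<^esub> complex_of_real t \<odot>\<^bsub>V\<^esub> a) - t * m a"
    define f where "f = restrict (\<lambda>x. INF t\<in>{0..}. ?g t x) (carrier V)"
    have lower: "- m ((- 1) \<odot>\<^bsub>V\<^esub> y) \<le> ?g t y" if "t \<in> {0..}" "y \<in> carrier V" for t y
      using sublinear_add_lower[OF m that(2), of "complex_of_real t \<odot>\<^bsub>V\<^esub> a"] sublinear_scale[OF m a] that a
      by simp
    have f_le: "f y \<le> ?g t y" if "t \<in> {0..}" "y \<in> carrier V" for t y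
      using that lower[of _ y] by (auto simp: f_def intro!: cINF_lower bdd_belowI[of _ "- m ((- 1) \<odot>\<^bsub>V\<^esub> y)"])
    have "sublinear f"
    proof (rule sublinear_INF[where I = "{0..}" and g = ?g and L = "\<lambda>x. - m ((- 1) \<odot>\<^bsub>V\<^esub> x)"])
      fix t s :: real and y z
      assume ts: "t \<in> {0..}" "s \<in> {0..}" and yz: "y \<in> carrier V" "z \<in> carrier V"
      have "(y \<oplus>\<^bsub>V\<^esub> z) \<oplus>\<^bsub>V\<^esub> complex_of_real (t + s) \<odot>\<^bsub>V\<^esub> a
          = (y \<oplus>\<^bsub>V\<^esub> complex_of_real t \<odot>\<^bsub>V\<^esub> a) \<oplus>\<^bsub>V\<^esub> (z \<oplus>\<^bsub>V\<^esub> complex_of_real s \<odot>\<^bsub>V\<^esub> a)"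
        using yz a by (simp add: scale_add_left add_swap_middle)
      then show "\<exists>k\<in>{0..}. ?g k (y \<oplus>\<^bsub>V\<^esub> z) \<le> ?g t y + ?g s z"
        using ts yz a sublinear_add[OF m, of "y \<oplus>\<^bsub>V\<^esub> complex_of_real t \<odot>\<^bsub>V\<^esub> a" "z \<oplus>\<^bsub>V\<^esub> complex_of_real s \<odot>\<^bsub>V\<^esub> a"]
        by (intro bexI[of _ "t + s"]) (auto simp: algebra_simps)
    next
      fix s c :: real and y assume s: "s \<in> {0..}" and c: "0 < c" and y: "y \<in> carrier V"
      have "complex_of_real c \<odot>\<^bsub>V\<^esub> y \<oplus>\<^bsub>V\<^esub> complex_of_real (c * s) \<odot>\<^bsub>V\<^esub> a
          = complex_of_real c \<odot>\<^bsub>V\<^esub> (y \<oplus>\<^bsub>V\<^esub> complex_of_real s \<odot>\<^bsub>V\<^esub> a)"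
        using y a by (simp add: scale_add_right scale_scale)
      then show "\<exists>k\<in>{0..}. ?g k (complex_of_real c \<odot>\<^bsub>V\<^esub> y) \<le> c * ?g s y"
        using s c y a sublinear_scale[OF m, of "y \<oplus>\<^bsub>V\<^esub> complex_of_real s \<odot>\<^bsub>V\<^esub> a" c]
        by (intro bexI[of _ "c * s"]) (auto simp: algebra_simps)
    qed (use lower in \<open>auto simp: f_def\<close>)
    moreover have fm: "f y \<le> m y" if "y \<in> carrier V" for y
      using f_le[of 0 y] that a by simp
    moreover have "f \<in> extensional (carrier V)" by (simp add: f_def)
    ultimately have "f \<in> A" using order.trans[OF fm mp] by (simp add: A_def)
    moreover have "f \<le> m"
    proof (rule le_funI)
      fix y
      show "f y \<le> m y"
        using fm[of y] mA by (cases "y \<in> carrier V") (auto simp: A_def f_def extensional_def)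
    qed
    ultimately have "f = m" by (rule min)
    \<comment> \<open>The bound \<open>f \<le> ?g 1\<close>, read with \<open>f = m\<close>, is the
      inequality opposite to subadditivity.\<close>
    then have "m x \<le> m (x \<oplus>\<^bsub>V\<^esub> a) - m a"
      using f_le[of 1 x] x a by simp
    with sublinear_add[OF m x a] show ?thesis by simp
  qed
  have neg: "m ((- 1) \<odot>\<^bsub>V\<^esub> x) = - m x" if "x \<in> carrier V" for x
    using add[of x "(- 1) \<odot>\<^bsub>V\<^esub> x"] that by (simp add: add_neg_scale sublinear_zero[OF m])
  have "m (complex_of_real t \<odot>\<^bsub>V\<^esub> x) = t * m x" if x: "x \<in> carrier V" for t x
  proof (cases "0 \<le> t")
    case True
    then show ?thesis using sublinear_scale[OF m x] by simp
  next
    case False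
    have "m (complex_of_real t \<odot>\<^bsub>V\<^esub> x) = m ((- 1) \<odot>\<^bsub>V\<^esub> (complex_of_real (- t) \<odot>\<^bsub>V\<^esub> x))"
      using x by (simp add: scale_scale)
    also have "\<dots> = t * m x"
      using False x sublinear_scale[OF m x, of "- t"] by (simp add: neg)
    finally show ?thesis .
  qed
  with mp add show ?thesis by (rule that)
qed

lemma sublinear_vnorm: "sublinear (vnorm V)"
  by (auto simp: sublinear_def vnorm_triangle vnorm_smult)

text \<open>With \<open>p x\<close> the infimum of \<open>vnorm V (x + y) - Re (\<phi> y)\<close>
  over \<open>y\<close> in \<open>F\<close>, any real-linear \<open>l \<le> p\<close> is an
  extension: \<open>y = 0\<close> gives \<open>l x \<le> vnorm V x\<close>, and
  \<open>y = -x\<close> gives \<open>l x \<le> Re (\<phi> x)\<close> on \<open>F\<close>, with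
  equality after replacing \<open>x\<close> by \<open>-x\<close>. Thus no extension by one dimension
  at a time takes place.\<close>

theorem hahn_banach:
  assumes F: "F \<subseteq> carrier V" "\<zero>\<^bsub>V\<^esub> \<in> F"
    and F_add: "\<And>x y. x \<in> F \<Longrightarrow> y \<in> F \<Longrightarrow> x \<oplus>\<^bsub>V\<^esub> y \<in> F"
    and F_scale: "\<And>c x. x \<in> F \<Longrightarrow> c \<odot>\<^bsub>V\<^esub> x \<in> F"
    and \<phi>_add: "\<And>x y. x \<in> F \<Longrightarrow> y \<in> F \<Longrightarrow> \<phi> (x \<oplus>\<^bsub>V\<^esub> y) = \<phi> x + \<phi> y"
    and \<phi>_scale: "\<And>c x. x \<in> F \<Longrightarrow> \<phi> (c \<odot>\<^bsub>V\<^esub> x) = c * \<phi> x"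
    and \<phi>_bound: "\<And>x. x \<in> F \<Longrightarrow> cmod (\<phi> x) \<le> vnorm V x"
  obtains \<psi> where "\<And>x. x \<in> F \<Longrightarrow> \<psi> x = \<phi> x"
    and "\<And>x y. x \<in> carrier V \<Longrightarrow> y \<in> carrier V \<Longrightarrow> \<psi> (x \<oplus>\<^bsub>V\<^esub> y) = \<psi> x + \<psi> y"
    and "\<And>c x. x \<in> carrier V \<Longrightarrow> \<psi> (c \<odot>\<^bsub>V\<^esub> x) = c * \<psi> x"
    and "\<And>x. x \<in> carrier V \<Longrightarrow> cmod (\<psi> x) \<le> vnorm V x"
proof -
  note Fc = subsetD[OF F(1)]
  let ?g = "\<lambda>y x. vnorm V (x \<oplus>\<^bsub>V\<^esub> y) - Re (\<phi> y)"
  define p where "p x = (INF y\<in>F. ?g y x)" for x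
  have Re_le: "Re (\<phi> y) \<le> vnorm V y" if "y \<in> F" for y
    using \<phi>_bound[OF that] complex_Re_le_cmod[of "\<phi> y"] by simp
  have lower: "- vnorm V ((- 1) \<odot>\<^bsub>V\<^esub> x) \<le> ?g y x" if "y \<in> F" "x \<in> carrier V" for x y
    using sublinear_add_lower[OF sublinear_vnorm that(2) Fc[OF that(1)]] Re_le[OF that(1)] by simp
  have p_le: "p x \<le> ?g y x" if "y \<in> F" "x \<in> carrier V" for x y
    using that lower[of _ x] by (auto simp: p_def intro!: cINF_lower bdd_belowI[of _ "- vnorm V ((- 1) \<odot>\<^bsub>V\<^esub> x)"])
  have "sublinear p"
  proof (rule sublinear_INF[where I = F and g = ?g and L = "\<lambda>x. - vnorm V ((- 1) \<odot>\<^bsub>V\<^esub> x)"])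
    fix y z x w assume yz: "y \<in> F" "z \<in> F" and xw: "x \<in> carrier V" "w \<in> carrier V"
    have "(x \<oplus>\<^bsub>V\<^esub> w) \<oplus>\<^bsub>V\<^esub> (y \<oplus>\<^bsub>V\<^esub> z) = (x \<oplus>\<^bsub>V\<^esub> y) \<oplus>\<^bsub>V\<^esub> (w \<oplus>\<^bsub>V\<^esub> z)"
      using yz xw Fc by (simp add: add_swap_middle)
    then show "\<exists>k\<in>F. ?g k (x \<oplus>\<^bsub>V\<^esub> w) \<le> ?g y x + ?g z w"
      using yz xw Fc vnorm_triangle[of "x \<oplus>\<^bsub>V\<^esub> y" "w \<oplus>\<^bsub>V\<^esub> z"]
      by (intro bexI[of _ "y \<oplus>\<^bsub>V\<^esub> z"]) (auto simp: \<phi>_add F_add)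
  next
    fix y and c :: real and x assume y: "y \<in> F" and c: "0 < c" and x: "x \<in> carrier V"
    have "complex_of_real c \<odot>\<^bsub>V\<^esub> x \<oplus>\<^bsub>V\<^esub> complex_of_real c \<odot>\<^bsub>V\<^esub> y = complex_of_real c \<odot>\<^bsub>V\<^esub> (x \<oplus>\<^bsub>V\<^esub> y)"
      using x y Fc by (simp add: scale_add_right)
    then show "\<exists>k\<in>F. ?g k (complex_of_real c \<odot>\<^bsub>V\<^esub> x) \<le> c * ?g y x"
      using x y c Fc by (intro bexI[of _ "complex_of_real c \<odot>\<^bsub>V\<^esub> y"])
        (auto simp: \<phi>_scale F_scale vnorm_smult algebra_simps)
  qed (use F(2) lower in \<open>auto simp: p_def\<close>)
  then obtain l where l: "\<And>x. x \<in> carrier V \<Longrightarrow> l x \<le> p x"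
    and l_add: "\<And>x y. x \<in> carrier V \<Longrightarrow> y \<in> carrier V \<Longrightarrow> l (x \<oplus>\<^bsub>V\<^esub> y) = l x + l y"
    and l_scale: "\<And>t x. x \<in> carrier V \<Longrightarrow> l (complex_of_real t \<odot>\<^bsub>V\<^esub> x) = t * l x"
    using linear_below_sublinear by blast
  have \<phi>0: "\<phi> \<zero>\<^bsub>V\<^esub> = 0" using \<phi>_scale[OF F(2), of 0] by simp
  have l_norm: "l x \<le> vnorm V x" if "x \<in> carrier V" for x
    using l[OF that] p_le[OF F(2) that] that by (simp add: \<phi>0)
  have l_neg: "l ((- 1) \<odot>\<^bsub>V\<^esub> x) = - l x" if "x \<in> carrier V" for x
    using l_scale[OF that, of "- 1"] by simp
  have l_le: "l x \<le> Re (\<phi> x)" if x: "x \<in> F" for x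
  proof -
    have "l x \<le> vnorm V (x \<oplus>\<^bsub>V\<^esub> (- 1) \<odot>\<^bsub>V\<^esub> x) - Re (\<phi> ((- 1) \<odot>\<^bsub>V\<^esub> x))"
      using l[of x] p_le[of "(- 1) \<odot>\<^bsub>V\<^esub> x" x] x Fc F_scale by (meson order.trans)
    then show ?thesis
      using x Fc sublinear_zero[OF sublinear_vnorm] by (simp add: add_neg_scale \<phi>_scale)
  qed
  have l_eq: "l x = Re (\<phi> x)" if x: "x \<in> F" for x
    using l_le[OF x] l_le[OF F_scale[OF x, of "- 1"]] x Fc by (simp add: l_neg \<phi>_scale)
  \<comment> \<open>The only complex-linear functional with real part \<open>l\<close>.\<close>
  define \<psi> where "\<psi> x = Complex (l x) (- l (\<i> \<odot>\<^bsub>V\<^esub> x))" for x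
  show ?thesis
  proof (rule that)
    show "\<psi> x = \<phi> x" if "x \<in> F" for x
      using that by (simp add: \<psi>_def complex_eq_iff l_eq F_scale \<phi>_scale)
    show add: "\<psi> (x \<oplus>\<^bsub>V\<^esub> y) = \<psi> x + \<psi> y" if "x \<in> carrier V" "y \<in> carrier V" for x y
      using that by (simp add: \<psi>_def complex_eq_iff l_add scale_add_right)
    show scale: "\<psi> (c \<odot>\<^bsub>V\<^esub> x) = c * \<psi> x" if x: "x \<in> carrier V" for c x
    proof -
      have re: "\<psi> (complex_of_real t \<odot>\<^bsub>V\<^esub> y) = complex_of_real t * \<psi> y" if "y \<in> carrier V" for t y
      proof -
        have "\<i> \<odot>\<^bsub>V\<^esub> (complex_of_real t \<odot>\<^bsub>V\<^esub> y) = complex_of_real t \<odot>\<^bsub>V\<^esub> (\<i> \<odot>\<^bsub>V\<^esub> y)"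
          using that by (simp add: scale_scale mult.commute)
        then show ?thesis using that by (simp add: \<psi>_def complex_eq_iff l_scale)
      qed
      have im: "\<psi> (\<i> \<odot>\<^bsub>V\<^esub> x) = \<i> * \<psi> x"
        using x by (simp add: \<psi>_def complex_eq_iff scale_scale l_neg)
      have "c \<odot>\<^bsub>V\<^esub> x = complex_of_real (Re c) \<odot>\<^bsub>V\<^esub> x \<oplus>\<^bsub>V\<^esub> complex_of_real (Im c) \<odot>\<^bsub>V\<^esub> (\<i> \<odot>\<^bsub>V\<^esub> x)"
      proof -
        have "complex_of_real (Re c) + complex_of_real (Im c) * \<i> = c" by (simp add: complex_eq_iff)
        then show ?thesis using x by (simp add: scale_scale scale_add_left[symmetric])
      qed
      then have "\<psi> (c \<odot>\<^bsub>V\<^esub> x) = complex_of_real (Re c) * \<psi> x + complex_of_real (Im c) * (\<i> * \<psi> x)"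
        using x by (simp add: add re im)
      also have "\<dots> = c * \<psi> x" by (simp add: complex_eq_iff algebra_simps)
      finally show ?thesis .
    qed
    show "cmod (\<psi> x) \<le> vnorm V x" if x: "x \<in> carrier V" for x
    proof -
      \<comment> \<open>Rotating \<open>x\<close> by the conjugate phase makes the value real and
        equal to the modulus, where the bound for \<open>l\<close> applies. If the value is 0, so is
        \<open>?c\<close>.\<close>
      let ?c = "cnj (sgn (\<psi> x))"
      have "?c * \<psi> x = (\<psi> x * cnj (\<psi> x)) / of_real (cmod (\<psi> x))" by (simp add: sgn_eq)
      also have "\<dots> = of_real (cmod (\<psi> x))"
        by (simp add: complex_norm_square[symmetric] power2_eq_square)
      finally have "?c * \<psi> x = of_real (cmod (\<psi> x))" .
      then have "cmod (\<psi> x) = Re (\<psi> (?c \<odot>\<^bsub>V\<^esub> x))" using x by (simp add: scale)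
      also have "\<dots> = l (?c \<odot>\<^bsub>V\<^esub> x)" by (simp add: \<psi>_def)
      also have "\<dots> \<le> cmod ?c * vnorm V x" using x l_norm[of "?c \<odot>\<^bsub>V\<^esub> x"] by (simp add: vnorm_smult)
      also have "\<dots> \<le> 1 * vnorm V x"
        using vnorm_nonneg[OF x] by (intro mult_right_mono) (auto simp: norm_sgn)
      finally show ?thesis by simp
    qed
  qed
qed

end

section \<open>The projection constant as a mean of the Dirichlet kernel\<close>

lemma cring_complex_ring: "cring complex_ring"
proof (rule cringI)
  show "abelian_group complex_ring"
  proof (rule abelian_groupI)
    show "\<exists>y\<in>carrier complex_ring. y \<oplus>\<^bsub>complex_ring\<^esub> x = \<zero>\<^bsub>complex_ring\<^esub>" for x
      by (auto intro: exI[of _ "- x"])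
  qed auto
  show "comm_monoid complex_ring"
    by (rule comm_monoidI) auto
qed (auto simp: ring_distribs)

context complex_normed_space
begin

lemma minus_eq_scale: "x \<in> carrier V \<Longrightarrow> y \<in> carrier V \<Longrightarrow> x \<ominus>\<^bsub>V\<^esub> y = x \<oplus>\<^bsub>V\<^esub> (- 1) \<odot>\<^bsub>V\<^esub> y"
  using M.minus_equality[OF neg_scale_add, of y] by (simp add: a_minus_def)

lemma Metric_space_vdist: "Metric_space (carrier V) (vdist V)"
proof
  fix x y
  show "0 \<le> vdist V x y" by (simp add: vdist_def vnorm_nonneg)
  show "vdist V x y = vdist V y x"
  proof (cases "x \<in> carrier V \<and> y \<in> carrier V")
    case True
    then have "y \<ominus>\<^bsub>V\<^esub> x = (- 1) \<odot>\<^bsub>V\<^esub> (x \<ominus>\<^bsub>V\<^esub> y)"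
      by (simp add: minus_eq_scale scale_add_right scale_scale M.a_comm)
    with True show ?thesis by (simp add: vdist_def vnorm_smult)
  qed (auto simp: vdist_def)
next
  fix x y assume xy: "x \<in> carrier V" "y \<in> carrier V"
  have "x = y" if "x \<oplus>\<^bsub>V\<^esub> (- 1) \<odot>\<^bsub>V\<^esub> y = \<zero>\<^bsub>V\<^esub>"
  proof -
    have "x = (x \<oplus>\<^bsub>V\<^esub> (- 1) \<odot>\<^bsub>V\<^esub> y) \<oplus>\<^bsub>V\<^esub> y"
      using xy by (simp add: M.a_assoc neg_scale_add)
    with that xy show ?thesis by simp
  qed
  with xy show "vdist V x y = 0 \<longleftrightarrow> x = y"
    by (auto simp: vdist_def vnorm_eq_0_iff minus_eq_scale add_neg_scale)
next
  fix x y z assume c: "x \<in> carrier V" "y \<in> carrier V" "z \<in> carrier V"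
  have "x \<ominus>\<^bsub>V\<^esub> z = (x \<ominus>\<^bsub>V\<^esub> y) \<oplus>\<^bsub>V\<^esub> (y \<ominus>\<^bsub>V\<^esub> z)"
  proof -
    have "(x \<ominus>\<^bsub>V\<^esub> y) \<oplus>\<^bsub>V\<^esub> (y \<ominus>\<^bsub>V\<^esub> z)
        = x \<oplus>\<^bsub>V\<^esub> (((- 1) \<odot>\<^bsub>V\<^esub> y \<oplus>\<^bsub>V\<^esub> y) \<oplus>\<^bsub>V\<^esub> (- 1) \<odot>\<^bsub>V\<^esub> z)"
      using c by (simp add: minus_eq_scale M.a_assoc)
    then show ?thesis using c by (simp add: neg_scale_add minus_eq_scale)
  qed
  then show "vdist V x z \<le> vdist V x y + vdist V y z"
    using c vnorm_triangle[of "x \<ominus>\<^bsub>V\<^esub> y" "y \<ominus>\<^bsub>V\<^esub> z"] by (simp add: vdist_def)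
qed

end

text \<open>Each new point contributes one more complex value, and a bijection between
  \<open>complex \<times> complex\<close> and \<open>complex\<close> merges it with the code of the
  rest. This is why a type that receives \<open>complex\<close> has room for every function space on
  a finite set.\<close>

lemma exists_inj_on_finite_support:
  assumes "finite S"
  shows "\<exists>\<iota>::('b \<Rightarrow> complex) \<Rightarrow> complex. inj_on \<iota> {f. \<forall>x. x \<notin> S \<longrightarrow> f x = 0}"
  using assms
proof (induction S)
  case empty
  have "inj_on (\<lambda>_. 0 :: complex) {f :: 'b \<Rightarrow> complex. \<forall>x. x \<notin> {} \<longrightarrow> f x = 0}"
    by (auto simp: inj_on_def fun_eq_iff)
  then show ?case by blast
next
  case (insert a S)
  then obtain \<iota> :: "('b \<Rightarrow> complex) \<Rightarrow> complex" where \<iota>: "inj_on \<iota> {f. \<forall>x. x \<notin> S \<longrightarrow> f x = 0}" by blast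
  obtain p where p: "bij_betw p (UNIV \<times> UNIV :: (complex \<times> complex) set) (UNIV :: complex set)"
    using card_of_Times_same_infinite[OF infinite_UNIV_char_0[where 'a = complex],
        unfolded card_of_ordIso[symmetric]] by blast
  have p_inj: "u = v" if "p u = p v" for u v
    by (rule inj_onD[OF bij_betw_imp_inj_on[OF p] that]) simp_all
  have "inj_on (\<lambda>f. p (f a, \<iota> (f(a := 0)))) {f. \<forall>x. x \<notin> insert a S \<longrightarrow> f x = 0}"
  proof (rule inj_onI)
    fix f g :: "'b \<Rightarrow> complex"
    assume fg: "f \<in> {f. \<forall>x. x \<notin> insert a S \<longrightarrow> f x = 0}" "g \<in> {f. \<forall>x. x \<notin> insert a S \<longrightarrow> f x = 0}"
      and p_eq: "p (f a, \<iota> (f(a := 0))) = p (g a, \<iota> (g(a := 0)))"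
    have eq: "f a = g a" "\<iota> (f(a := 0)) = \<iota> (g(a := 0))" using p_inj[OF p_eq] by simp_all
    have "f(a := 0) = g(a := 0)"
      by (rule inj_onD[OF \<iota>, of "f(a := 0)" "g(a := 0)"]) (use fg eq(2) in auto)
    with eq(1) show "f = g" by (metis fun_upd_triv fun_upd_upd)
  qed
  then show ?case by blast
qed

section \<open>The space of all functions on the cube with the supremum norm\<close>

definition cube_sup :: "nat \<Rightarrow> nat \<Rightarrow> ((nat \<Rightarrow> complex) \<Rightarrow> complex) \<Rightarrow> real" where
  "cube_sup q N f = (SUP x\<in>cyclic_cube q N. cmod (f x))"

definition degree_freqs :: "nat \<Rightarrow> nat \<Rightarrow> nat \<Rightarrow> (nat \<Rightarrow> nat) set" where
  "degree_freqs d q N = {m \<in> frequencies q N. card {j \<in> {..<N}. m j \<noteq> 0} \<le> d}"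

lemma degree_freqs_subset: "degree_freqs d q N \<subseteq> frequencies q N"
  by (auto simp: degree_freqs_def)

lemma bounded_degree_functions_eq:
  "bounded_degree_functions d q N = complex_fun_span (character q N ` degree_freqs d q N)"
  unfolding bounded_degree_functions_def degree_freqs_def frequencies_def
  by (rule arg_cong[where f = complex_fun_span]) auto

context
  fixes q N :: nat
  assumes q: "2 \<le> q"
begin

lemma cube_sup_upper: "x \<in> cyclic_cube q N \<Longrightarrow> cmod (f x) \<le> cube_sup q N f"
  unfolding cube_sup_def using finite_cube[OF q] by (intro cSUP_upper) auto

lemma cube_sup_le: "(\<And>x. x \<in> cyclic_cube q N \<Longrightarrow> cmod (f x) \<le> B) \<Longrightarrow> cube_sup q N f \<le> B"
  unfolding cube_sup_def using cube_nonempty[OF q] by (intro cSUP_least) auto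

lemma cube_sup_nonneg: "0 \<le> cube_sup q N f"
proof -
  obtain x where "x \<in> cyclic_cube q N" using cube_nonempty[OF q] by blast
  then have "cmod (f x) \<le> cube_sup q N f" by (rule cube_sup_upper)
  then show ?thesis by (rule order.trans[OF norm_ge_zero])
qed

lemma cube_sup_eq_0_iff:
  assumes "f \<in> cube_functions q N"
  shows "cube_sup q N f = 0 \<longleftrightarrow> f = 0"
proof
  assume *: "cube_sup q N f = 0"
  show "f = 0"
  proof
    fix x
    show "f x = 0 x"
      using cube_sup_upper[of x f] * assms by (cases "x \<in> cyclic_cube q N") (auto simp: cube_functions_def)
  qed
next
  assume "f = 0"
  then have "cube_sup q N f \<le> 0" by (intro cube_sup_le) auto
  with cube_sup_nonneg[of f] show "cube_sup q N f = 0" by simp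
qed

lemma cube_sup_scale: "cube_sup q N (fun_scale c f) = cmod c * cube_sup q N f"
proof (rule antisym)
  show "cube_sup q N (fun_scale c f) \<le> cmod c * cube_sup q N f"
    by (intro cube_sup_le) (auto simp: fun_scale_apply norm_mult intro!: mult_left_mono cube_sup_upper)
  show "cmod c * cube_sup q N f \<le> cube_sup q N (fun_scale c f)"
  proof (cases "c = 0")
    case False
    have "cube_sup q N f \<le> cube_sup q N (fun_scale c f) / cmod c"
    proof (rule cube_sup_le)
      fix x assume "x \<in> cyclic_cube q N"
      then have "cmod c * cmod (f x) \<le> cube_sup q N (fun_scale c f)"
        using cube_sup_upper[of x "fun_scale c f"] by (simp add: fun_scale_apply norm_mult)
      then show "cmod (f x) \<le> cube_sup q N (fun_scale c f) / cmod c"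
        using False by (simp add: field_simps)
    qed
    then show ?thesis using False by (simp add: field_simps)
  qed (simp add: cube_sup_nonneg)
qed

lemma cube_sup_add: "cube_sup q N (f + g) \<le> cube_sup q N f + cube_sup q N g"
proof (rule cube_sup_le)
  fix x assume "x \<in> cyclic_cube q N"
  then show "cmod ((f + g) x) \<le> cube_sup q N f + cube_sup q N g"
    using norm_triangle_ineq[of "f x" "g x"] cube_sup_upper[of x f] cube_sup_upper[of x g] by simp
qed

text \<open>A copy, inside the type \<open>'u\<close>, of the space of all functions on the cube with the supremum norm.
  The ring multiplication and unit of the record are irrelevant.\<close>

definition sup_space :: "(((nat \<Rightarrow> complex) \<Rightarrow> complex) \<Rightarrow> 'u) \<Rightarrow> 'u complex_normed" where
  "sup_space \<iota> = (let \<kappa> = inv_into (cube_functions q N) \<iota> in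
     \<lparr>carrier = \<iota> ` cube_functions q N, mult = (\<lambda>u v. u), one = \<iota> 0, zero = \<iota> 0,
      add = (\<lambda>u v. \<iota> (\<kappa> u + \<kappa> v)), smult = (\<lambda>c u. \<iota> (fun_scale c (\<kappa> u))),
      vnorm = (\<lambda>u. cube_sup q N (\<kappa> u))\<rparr>)"

context
  fixes \<iota> :: "((nat \<Rightarrow> complex) \<Rightarrow> complex) \<Rightarrow> 'u"
  assumes \<iota>: "inj_on \<iota> (cube_functions q N)"
begin

abbreviation \<kappa> where "\<kappa> \<equiv> inv_into (cube_functions q N) \<iota>"

lemma \<kappa>_\<iota> [simp]: "f \<in> cube_functions q N \<Longrightarrow> \<kappa> (\<iota> f) = f"
  using \<iota> by (rule inv_into_f_f)

lemma sup_space_simps [simp]: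
  "carrier (sup_space \<iota>) = \<iota> ` cube_functions q N" "\<zero>\<^bsub>sup_space \<iota>\<^esub> = \<iota> 0"
  "u \<oplus>\<^bsub>sup_space \<iota>\<^esub> v = \<iota> (\<kappa> u + \<kappa> v)" "c \<odot>\<^bsub>sup_space \<iota>\<^esub> u = \<iota> (fun_scale c (\<kappa> u))"
  "vnorm (sup_space \<iota>) u = cube_sup q N (\<kappa> u)"
  by (simp_all add: sup_space_def Let_def)

lemma complex_normed_space_sup_space: "complex_normed_space (sup_space \<iota>)"
proof (intro complex_normed_space.intro complex_normed_space_axioms.intro)
  show "Module.module complex_ring (sup_space \<iota>)"
  proof (rule moduleI)
    show "abelian_group (sup_space \<iota>)"
    proof (rule abelian_groupI)
      fix u assume "u \<in> carrier (sup_space \<iota>)"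
      then obtain f where f: "f \<in> cube_functions q N" "u = \<iota> f" by auto
      have "fun_scale (- 1) f + f = 0" by (rule ext) (simp add: fun_scale_apply)
      then show "\<exists>v\<in>carrier (sup_space \<iota>). v \<oplus>\<^bsub>sup_space \<iota>\<^esub> u = \<zero>\<^bsub>sup_space \<iota>\<^esub>"
        using f by (intro bexI[of _ "\<iota> (fun_scale (- 1) f)"]) auto
    qed (auto simp: add_ac)
  next
    fix a b u assume "u \<in> carrier (sup_space \<iota>)"
    then obtain f where f: "f \<in> cube_functions q N" "u = \<iota> f" by auto
    have "fun_scale (a + b) f = fun_scale a f + fun_scale b f"
      by (rule ext) (simp add: fun_scale_apply ring_distribs)
    then show "(a \<oplus>\<^bsub>complex_ring\<^esub> b) \<odot>\<^bsub>sup_space \<iota>\<^esub> u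
        = a \<odot>\<^bsub>sup_space \<iota>\<^esub> u \<oplus>\<^bsub>sup_space \<iota>\<^esub> b \<odot>\<^bsub>sup_space \<iota>\<^esub> u"
      using f by simp
    have "fun_scale (a * b) f = fun_scale a (fun_scale b f)"
      by (rule ext) (simp add: fun_scale_apply)
    then show "(a \<otimes>\<^bsub>complex_ring\<^esub> b) \<odot>\<^bsub>sup_space \<iota>\<^esub> u = a \<odot>\<^bsub>sup_space \<iota>\<^esub> (b \<odot>\<^bsub>sup_space \<iota>\<^esub> u)"
      using f by simp
    have "fun_scale 1 f = f" by (rule ext) (simp add: fun_scale_apply)
    then show "\<one>\<^bsub>complex_ring\<^esub> \<odot>\<^bsub>sup_space \<iota>\<^esub> u = u" using f by simp
  next
    fix a u v assume "u \<in> carrier (sup_space \<iota>)" "v \<in> carrier (sup_space \<iota>)"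
    then obtain f g where fg: "f \<in> cube_functions q N" "u = \<iota> f" "g \<in> cube_functions q N" "v = \<iota> g" by auto
    have "fun_scale a (f + g) = fun_scale a f + fun_scale a g"
      by (rule ext) (simp add: fun_scale_apply ring_distribs)
    then show "a \<odot>\<^bsub>sup_space \<iota>\<^esub> (u \<oplus>\<^bsub>sup_space \<iota>\<^esub> v)
        = a \<odot>\<^bsub>sup_space \<iota>\<^esub> u \<oplus>\<^bsub>sup_space \<iota>\<^esub> a \<odot>\<^bsub>sup_space \<iota>\<^esub> v"
      using fg by simp
  qed (auto simp: cring_complex_ring)
next
  fix u assume "u \<in> carrier (sup_space \<iota>)"
  then obtain f where f: "f \<in> cube_functions q N" "u = \<iota> f" by auto
  show "0 \<le> vnorm (sup_space \<iota>) u" using f by (simp add: cube_sup_nonneg)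
  have "\<iota> f = \<iota> 0 \<longleftrightarrow> f = 0" using inj_on_eq_iff[OF \<iota> f(1), of 0] by simp
  then show "vnorm (sup_space \<iota>) u = 0 \<longleftrightarrow> u = \<zero>\<^bsub>sup_space \<iota>\<^esub>"
    using f by (simp add: cube_sup_eq_0_iff)
  show "vnorm (sup_space \<iota>) (c \<odot>\<^bsub>sup_space \<iota>\<^esub> u) = cmod c * vnorm (sup_space \<iota>) u" for c
    using f by (simp add: cube_sup_scale)
next
  fix u v assume "u \<in> carrier (sup_space \<iota>)" "v \<in> carrier (sup_space \<iota>)"
  then show "vnorm (sup_space \<iota>) (u \<oplus>\<^bsub>sup_space \<iota>\<^esub> v) \<le> vnorm (sup_space \<iota>) u + vnorm (sup_space \<iota>) v"
    by (auto simp: cube_sup_add)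
qed

lemma vdist_sup_space:
  assumes "f \<in> cube_functions q N" "g \<in> cube_functions q N"
  shows "vdist (sup_space \<iota>) (\<iota> f) (\<iota> g) = cube_sup q N (f - g)"
proof -
  interpret complex_normed_space "sup_space \<iota>" by (rule complex_normed_space_sup_space)
  show ?thesis using assms by (simp add: vdist_def minus_eq_scale)
qed

text \<open>Pointwise limits exist by completeness of the complex numbers, and the Cauchy estimate
  passes to the limit at each point, uniformly over the cube.\<close>

lemma complex_banach_space_sup_space: "complex_banach_space (sup_space \<iota>)"
proof -
  interpret complex_normed_space "sup_space \<iota>" by (rule complex_normed_space_sup_space)
  interpret Metric_space "carrier (sup_space \<iota>)" "vdist (sup_space \<iota>)" by (rule Metric_space_vdist)
  have "mcomplete"
    unfolding mcomplete_def
  proof (intro allI impI)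
    fix \<sigma> assume C: "MCauchy \<sigma>"
    define f where "f n = \<kappa> (\<sigma> n)" for n
    have f: "f n \<in> cube_functions q N" "\<sigma> n = \<iota> (f n)" for n
    proof -
      have "\<sigma> n \<in> \<iota> ` cube_functions q N" using C unfolding MCauchy_def by auto
      then show "f n \<in> cube_functions q N" "\<sigma> n = \<iota> (f n)"
        unfolding f_def by (rule inv_into_into, rule f_inv_into_f[symmetric])
    qed
    have Cf: "\<exists>M. \<forall>m\<ge>M. \<forall>n\<ge>M. cube_sup q N (f m - f n) < e" if "e > 0" for e
      using C that vdist_sup_space[OF f(1) f(1)] unfolding MCauchy_def f(2) by metis
    have up: "norm (f m x - f n x) \<le> cube_sup q N (f m - f n)" if "x \<in> cyclic_cube q N" for x m n
      using cube_sup_upper[OF that, of "f m - f n"] by simp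
    have "Cauchy (\<lambda>n. f n x)" if x: "x \<in> cyclic_cube q N" for x
    proof (rule CauchyI)
      fix e :: real assume "0 < e"
      then obtain M where "\<And>m n. m \<ge> M \<Longrightarrow> n \<ge> M \<Longrightarrow> cube_sup q N (f m - f n) < e" using Cf by blast
      then show "\<exists>M. \<forall>m\<ge>M. \<forall>n\<ge>M. norm (f m x - f n x) < e"
        using up[OF x] by (meson le_less_trans)
    qed
    then have "\<forall>x\<in>cyclic_cube q N. \<exists>l. (\<lambda>n. f n x) \<longlonglongrightarrow> l"
      using Cauchy_convergent_iff convergent_def by blast
    then obtain L where L: "\<And>x. x \<in> cyclic_cube q N \<Longrightarrow> (\<lambda>n. f n x) \<longlonglongrightarrow> L x" by metis
    define l where "l x = (if x \<in> cyclic_cube q N then L x else 0)" for x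
    have l: "l \<in> cube_functions q N" by (simp add: cube_functions_def l_def)
    have lim: "(\<lambda>n. f n x) \<longlonglongrightarrow> l x" if "x \<in> cyclic_cube q N" for x
      using L[OF that] that by (simp add: l_def)
    have "limitin mtopology \<sigma> (\<iota> l) sequentially"
      unfolding limit_metric_sequentially
    proof (intro conjI allI impI)
      show "\<iota> l \<in> carrier (sup_space \<iota>)" using l by simp
      fix e :: real assume e: "0 < e"
      then obtain M where M: "\<And>m n. m \<ge> M \<Longrightarrow> n \<ge> M \<Longrightarrow> cube_sup q N (f m - f n) < e / 2"
        using Cf[of "e / 2"] by auto
      have "vdist (sup_space \<iota>) (\<sigma> n) (\<iota> l) < e" if n: "n \<ge> M" for n
      proof -
        have "cube_sup q N (f n - l) \<le> e / 2"
        proof (rule cube_sup_le)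
          fix x assume x: "x \<in> cyclic_cube q N"
          have "(\<lambda>m. cmod (f n x - f m x)) \<longlonglongrightarrow> cmod (f n x - l x)"
            by (intro tendsto_intros lim x)
          moreover have "\<forall>m\<ge>M. cmod (f n x - f m x) \<le> e / 2"
            using M[OF n] up[OF x] by (meson le_less_trans less_imp_le)
          ultimately have "cmod (f n x - l x) \<le> e / 2"
            by (intro LIMSEQ_le_const2[where X = "\<lambda>m. cmod (f n x - f m x)"]) blast+
          then show "cmod ((f n - l) x) \<le> e / 2" by simp
        qed
        then show ?thesis using e by (simp add: f(2) vdist_sup_space[OF f(1) l])
      qed
      then show "\<exists>M. \<forall>n\<ge>M. \<sigma> n \<in> carrier (sup_space \<iota>) \<and> vdist (sup_space \<iota>) (\<sigma> n) (\<iota> l) < e"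
        using f by (intro exI[of _ M]) auto
    qed
    then show "\<exists>x. limitin mtopology \<sigma> x sequentially" by blast
  qed
  then show ?thesis
    by (intro complex_banach_space.intro complex_banach_space_axioms.intro complex_normed_space_axioms)
qed

end

section \<open>The two bounds for the projection constant\<close>

lemma bounded_degree_space_simps [simp]:
  "carrier (bounded_degree_space d q N) = bounded_degree_functions d q N"
  "f \<oplus>\<^bsub>bounded_degree_space d q N\<^esub> g = f + g" "c \<odot>\<^bsub>bounded_degree_space d q N\<^esub> f = fun_scale c f"
  "\<zero>\<^bsub>bounded_degree_space d q N\<^esub> = 0"
  "vnorm (bounded_degree_space d q N) f = cube_sup q N f"
  by (simp_all add: bounded_degree_space_def cube_sup_def)

lemma bounded_degree_functions_closed:
  "0 \<in> bounded_degree_functions d q N"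
  "f \<in> bounded_degree_functions d q N \<Longrightarrow> g \<in> bounded_degree_functions d q N \<Longrightarrow> f + g \<in> bounded_degree_functions d q N"
  "f \<in> bounded_degree_functions d q N \<Longrightarrow> fun_scale c f \<in> bounded_degree_functions d q N"
  unfolding bounded_degree_functions_eq
  by (auto intro: complex_fun.span_zero complex_fun.span_add complex_fun.span_scale)

lemma bounded_degree_functions_cube: "f \<in> bounded_degree_functions d q N \<Longrightarrow> f \<in> cube_functions q N"
  unfolding bounded_degree_functions_eq by (rule span_characters_vanish[OF q degree_freqs_subset])

text \<open>A real \<open>SUP\<close> is an upper bound only for sets bounded above, which
  boundedness of the map provides; \<open>\<bar>C\<bar>\<close> replaces \<open>C\<close>, as the
  constant in the definition may be negative.\<close>

lemma operator_norm_upper: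
  assumes "bounded_complex_linear_map V W T" "x \<in> carrier V" "vnorm V x \<le> 1"
    and nn: "\<And>x. x \<in> carrier V \<Longrightarrow> 0 \<le> vnorm V x"
  shows "vnorm W (T x) \<le> operator_norm V W T"
proof -
  obtain C where C: "\<And>x. x \<in> carrier V \<Longrightarrow> vnorm W (T x) \<le> C * vnorm V x"
    using assms(1) unfolding bounded_complex_linear_map_def by blast
  have "vnorm W (T y) \<le> \<bar>C\<bar>" if "y \<in> carrier V" "vnorm V y \<le> 1" for y
  proof -
    have "vnorm W (T y) \<le> \<bar>C\<bar> * vnorm V y"
      using C[OF that(1)] nn[OF that(1)] by (meson abs_ge_self mult_right_mono order.trans)
    also have "\<dots> \<le> \<bar>C\<bar>" using that nn[OF that(1)] by (intro mult_left_le) auto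
    finally show ?thesis .
  qed
  then show ?thesis
    unfolding operator_norm_def using assms(2,3) by (intro cSUP_upper bdd_aboveI[of _ "\<bar>C\<bar>"]) auto
qed

text \<open>A projection of the copied space is conjugated by \<open>\<iota>\<close> to a linear map
  \<open>Q\<close> of functions, to which \<open>projection_norm_lower_bound\<close>
  applies.\<close>

lemma projection_constant_lower:
  assumes "\<exists>f :: complex \<Rightarrow> 'u. inj f"
  shows "ereal (cube_mean q N (\<lambda>x. cmod (dirichlet q N (degree_freqs d q N) x)))
           \<le> projection_constant TYPE('u) (bounded_degree_space d q N)"
proof -
  let ?X = "bounded_degree_functions d q N" and ?L = "cube_functions q N"
  obtain \<epsilon> :: "complex \<Rightarrow> 'u" where \<epsilon>: "inj \<epsilon>" using assms by blast
  obtain \<iota>0 :: "((nat \<Rightarrow> complex) \<Rightarrow> complex) \<Rightarrow> complex" where \<iota>0: "inj_on \<iota>0 ?L"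
    using exists_inj_on_finite_support[OF finite_cube[OF q]] unfolding cube_functions_def by blast
  \<comment> \<open>Cube functions are coded by complex numbers, which are then sent into
    \<open>'u\<close>.\<close>
  define \<iota> where "\<iota> = \<epsilon> \<circ> \<iota>0"
  have \<iota>: "inj_on \<iota> ?L" unfolding \<iota>_def using \<epsilon> \<iota>0 by (meson comp_inj_on inj_on_subset subset_UNIV)
  let ?Y = "sup_space \<iota>" and ?\<kappa> = "inv_into ?L \<iota>"
  note Xc = bounded_degree_functions_cube[of _ d]
  note simps = sup_space_simps[OF \<iota>] \<kappa>_\<iota>[OF \<iota>]
  have emb: "isometric_embedding (bounded_degree_space d q N) ?Y \<iota>"
    by (auto simp: isometric_embedding_def complex_linear_map_def simps Xc)
  have "ereal (cube_mean q N (\<lambda>x. cmod (dirichlet q N (degree_freqs d q N) x)))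
      \<le> relative_projection_constant (\<iota> ` ?X) ?Y"
    unfolding relative_projection_constant_def
  proof (rule INF_greatest)
    fix P assume P: "P \<in> projections_onto (\<iota> ` ?X) ?Y"
    then have blin: "bounded_complex_linear_map ?Y ?Y P" and rng: "\<And>u. u \<in> carrier ?Y \<Longrightarrow> P u \<in> \<iota> ` ?X"
      and fix_X: "\<And>u. u \<in> \<iota> ` ?X \<Longrightarrow> P u = u"
      by (auto simp: projections_onto_def)
    then have add: "\<And>u v. u \<in> carrier ?Y \<Longrightarrow> v \<in> carrier ?Y \<Longrightarrow> P (u \<oplus>\<^bsub>?Y\<^esub> v) = P u \<oplus>\<^bsub>?Y\<^esub> P v"
      and scale: "\<And>c u. u \<in> carrier ?Y \<Longrightarrow> P (c \<odot>\<^bsub>?Y\<^esub> u) = c \<odot>\<^bsub>?Y\<^esub> P u"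
      by (auto simp: bounded_complex_linear_map_def complex_linear_map_def)
    define Q where "Q f = ?\<kappa> (P (\<iota> f))" for f
    have Q: "Q f \<in> ?X" "P (\<iota> f) = \<iota> (Q f)" if "f \<in> ?L" for f
    proof -
      have "\<iota> f \<in> carrier ?Y" using that by (simp add: simps)
      from rng[OF this] obtain g where "g \<in> ?X" "P (\<iota> f) = \<iota> g" by blast
      then show "Q f \<in> ?X" "P (\<iota> f) = \<iota> (Q f)" by (auto simp: Q_def simps Xc)
    qed
    have "cube_mean q N (\<lambda>x. cmod (dirichlet q N (degree_freqs d q N) x)) \<le> operator_norm ?Y ?Y P"
    proof (rule projection_norm_lower_bound[OF q degree_freqs_subset, where P = Q])
      fix f g assume fg: "f \<in> ?L" "g \<in> ?L"
      note Qc = Xc[OF Q(1)[OF fg(1)]] Xc[OF Q(1)[OF fg(2)]]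
      have "P (\<iota> (f + g)) = \<iota> (Q f + Q g)"
        using add[of "\<iota> f" "\<iota> g"] fg Qc by (simp add: simps Q(2))
      then show "Q (f + g) = Q f + Q g"
        unfolding Q_def[of "f + g"] using cube_functions_closed(2)[OF Qc] by (simp only: simps)
    next
      fix c f assume f: "f \<in> ?L"
      note Qc = Xc[OF Q(1)[OF f]]
      have "P (\<iota> (fun_scale c f)) = \<iota> (fun_scale c (Q f))"
        using scale[of "\<iota> f" c] f Qc by (simp add: simps Q(2))
      then show "Q (fun_scale c f) = fun_scale c (Q f)"
        unfolding Q_def[of "fun_scale c f"] using cube_functions_closed(3)[OF Qc, of c] by (simp only: simps)
    next
      fix f assume "f \<in> ?L"
      then show "Q f \<in> complex_fun_span (character q N ` degree_freqs d q N)"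
        using Q unfolding bounded_degree_functions_eq by simp
    next
      fix f assume "f \<in> complex_fun_span (character q N ` degree_freqs d q N)"
      then have "f \<in> ?X" unfolding bounded_degree_functions_eq .
      then show "Q f = f" by (simp add: Q_def fix_X simps Xc)
    next
      fix f x assume f: "f \<in> ?L" "\<And>y. y \<in> cyclic_cube q N \<Longrightarrow> cmod (f y) \<le> 1" and x: "x \<in> cyclic_cube q N"
      have "cmod (Q f x) \<le> cube_sup q N (Q f)" by (rule cube_sup_upper[OF x])
      also have "\<dots> = vnorm ?Y (P (\<iota> f))" by (simp add: simps Q_def)
      also have "\<dots> \<le> operator_norm ?Y ?Y P"
        using f by (intro operator_norm_upper[OF blin]) (auto simp: simps cube_sup_nonneg intro: cube_sup_le)
      finally show "cmod (Q f x) \<le> operator_norm ?Y ?Y P" .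
    qed
    then show "ereal (cube_mean q N (\<lambda>x. cmod (dirichlet q N (degree_freqs d q N) x))) \<le> ereal (operator_norm ?Y ?Y P)"
      by simp
  qed
  also have "\<dots> \<le> projection_constant TYPE('u) (bounded_degree_space d q N)"
    unfolding projection_constant_def
    by (rule Sup_upper) (use emb complex_banach_space_sup_space[OF \<iota>] in auto)
  finally show ?thesis .
qed

text \<open>The projection is \<open>I\<close> after the partial sum after \<open>T\<close>. The map
  \<open>T\<close> evaluates norm-preserving extensions of the point evaluations, so it contracts
  \<open>Y\<close> into the functions on the cube and inverts \<open>I\<close> on the subspace; the
  partial sum costs the mean of the kernel.\<close>

lemma projection_constant_upper:
  "projection_constant TYPE('u) (bounded_degree_space d q N)
     \<le> ereal (cube_mean q N (\<lambda>x. cmod (dirichlet q N (degree_freqs d q N) x)))"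
  unfolding projection_constant_def
proof (rule Sup_least, clarify)
  fix Y :: "'u complex_normed" and I
  assume Y: "complex_banach_space Y" and I: "isometric_embedding (bounded_degree_space d q N) Y I"
  let ?X = "bounded_degree_functions d q N" and ?S = "degree_freqs d q N"
  let ?c = "cube_mean q N (\<lambda>x. cmod (dirichlet q N ?S x))"
  let ?R = "partial_sum q N ?S"
  interpret complex_banach_space Y by (rule Y)
  have c0: "0 \<le> ?c" by (rule cube_mean_nonneg[OF q]) simp
  note Xcl = bounded_degree_functions_closed[where d = d]
  have I_in: "\<And>f. f \<in> ?X \<Longrightarrow> I f \<in> carrier Y"
    and I_add: "\<And>f g. f \<in> ?X \<Longrightarrow> g \<in> ?X \<Longrightarrow> I (f + g) = I f \<oplus>\<^bsub>Y\<^esub> I g"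
    and I_scale: "\<And>c f. f \<in> ?X \<Longrightarrow> I (fun_scale c f) = c \<odot>\<^bsub>Y\<^esub> I f"
    and I_norm: "\<And>f. f \<in> ?X \<Longrightarrow> vnorm Y (I f) = cube_sup q N f"
    using I by (auto simp: isometric_embedding_def complex_linear_map_def)
  have I_zero: "I 0 = \<zero>\<^bsub>Y\<^esub>"
  proof -
    have "vnorm Y (I 0) = 0" using I_norm[OF Xcl(1)] cube_sup_eq_0_iff[of 0] by simp
    then show ?thesis using vnorm_eq_0_iff[OF I_in[OF Xcl(1)]] by simp
  qed
  have I_inj: "inj_on I ?X"
  proof (rule inj_onI)
    fix f g assume fg: "f \<in> ?X" "g \<in> ?X" "I f = I g"
    let ?h = "f + fun_scale (- 1) g"
    have h: "?h \<in> ?X" using fg Xcl by blast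
    have "I ?h = I f \<oplus>\<^bsub>Y\<^esub> (- 1) \<odot>\<^bsub>Y\<^esub> I f"
      by (simp only: I_add[OF fg(1) Xcl(3)[OF fg(2)]] I_scale[OF fg(2)] fg(3))
    then have "I ?h = \<zero>\<^bsub>Y\<^esub>" by (simp only: add_neg_scale[OF I_in[OF fg(1)]])
    then have "cube_sup q N ?h = 0" using I_norm[OF h] vnorm_eq_0_iff[of "\<zero>\<^bsub>Y\<^esub>"] by simp
    then have "?h = 0" using cube_sup_eq_0_iff[OF bounded_degree_functions_cube[OF h]] by simp
    then show "f = g" by simp
  qed
  define J where "J = inv_into ?X I"
  have J [simp]: "J (I f) = f" if "f \<in> ?X" for f
    unfolding J_def by (rule inv_into_f_f[OF I_inj that])
  \<comment> \<open>All properties of an extension in one predicate, so that a single choice picks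
    the functionals for all points of the cube.\<close>
  define E where "E x \<psi> \<longleftrightarrow> (\<forall>f\<in>?X. \<psi> (I f) = f x) \<and>
      (\<forall>u\<in>carrier Y. \<forall>v\<in>carrier Y. \<psi> (u \<oplus>\<^bsub>Y\<^esub> v) = \<psi> u + \<psi> v) \<and>
      (\<forall>c. \<forall>u\<in>carrier Y. \<psi> (c \<odot>\<^bsub>Y\<^esub> u) = c * \<psi> u) \<and> (\<forall>u\<in>carrier Y. cmod (\<psi> u) \<le> vnorm Y u)"
    for x \<psi>
  have "\<exists>\<psi>. E x \<psi>" if x: "x \<in> cyclic_cube q N" for x
  proof (rule hahn_banach[of "I ` ?X" "\<lambda>u. J u x"])
    show "\<zero>\<^bsub>Y\<^esub> \<in> I ` ?X" using I_zero Xcl(1) by (metis imageI)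
    show "u \<oplus>\<^bsub>Y\<^esub> v \<in> I ` ?X" if "u \<in> I ` ?X" "v \<in> I ` ?X" for u v
      using that Xcl(2) I_add by (smt (verit) image_iff)
    show "c \<odot>\<^bsub>Y\<^esub> u \<in> I ` ?X" if "u \<in> I ` ?X" for c u
      using that Xcl(3) I_scale by (smt (verit) image_iff)
    show "J (u \<oplus>\<^bsub>Y\<^esub> v) x = J u x + J v x" if "u \<in> I ` ?X" "v \<in> I ` ?X" for u v
      using that by (auto simp: I_add[symmetric] Xcl)
    show "J (c \<odot>\<^bsub>Y\<^esub> u) x = c * J u x" if "u \<in> I ` ?X" for c u
      using that by (auto simp: I_scale[symmetric] Xcl fun_scale_apply)
    show "cmod (J u x) \<le> vnorm Y u" if "u \<in> I ` ?X" for u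
      using that by (auto simp: I_norm cube_sup_upper[OF x])
    show "I ` ?X \<subseteq> carrier Y" using I_in by auto
  next
    fix \<psi>
    assume "\<And>u. u \<in> I ` ?X \<Longrightarrow> \<psi> u = J u x"
      and "\<And>u v. u \<in> carrier Y \<Longrightarrow> v \<in> carrier Y \<Longrightarrow> \<psi> (u \<oplus>\<^bsub>Y\<^esub> v) = \<psi> u + \<psi> v"
      and "\<And>c u. u \<in> carrier Y \<Longrightarrow> \<psi> (c \<odot>\<^bsub>Y\<^esub> u) = c * \<psi> u"
      and "\<And>u. u \<in> carrier Y \<Longrightarrow> cmod (\<psi> u) \<le> vnorm Y u"
    then have "E x \<psi>" by (simp add: E_def)
    then show ?thesis by (rule exI[where x = \<psi>])
  qed
  then obtain \<psi> where E: "\<And>x. x \<in> cyclic_cube q N \<Longrightarrow> E x (\<psi> x)"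
    using bchoice[of "cyclic_cube q N" E] by blast
  have \<psi>: "\<And>x f. x \<in> cyclic_cube q N \<Longrightarrow> f \<in> ?X \<Longrightarrow> \<psi> x (I f) = f x"
    and \<psi>_add: "\<And>x u v. x \<in> cyclic_cube q N \<Longrightarrow> u \<in> carrier Y \<Longrightarrow> v \<in> carrier Y \<Longrightarrow> \<psi> x (u \<oplus>\<^bsub>Y\<^esub> v) = \<psi> x u + \<psi> x v"
    and \<psi>_scale: "\<And>x c u. x \<in> cyclic_cube q N \<Longrightarrow> u \<in> carrier Y \<Longrightarrow> \<psi> x (c \<odot>\<^bsub>Y\<^esub> u) = c * \<psi> x u"
    and \<psi>_norm: "\<And>x u. x \<in> cyclic_cube q N \<Longrightarrow> u \<in> carrier Y \<Longrightarrow> cmod (\<psi> x u) \<le> vnorm Y u"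
    using E by (simp_all add: E_def)
  \<comment> \<open>The value 0 off the cube makes \<open>T (I f) = f\<close> hold on the whole
    type.\<close>
  define T where "T u x = (if x \<in> cyclic_cube q N then \<psi> x u else 0)" for u x
  have T_add: "T (u \<oplus>\<^bsub>Y\<^esub> v) = T u + T v" if "u \<in> carrier Y" "v \<in> carrier Y" for u v
    using that by (auto simp: T_def \<psi>_add)
  have T_scale: "T (c \<odot>\<^bsub>Y\<^esub> u) = fun_scale c (T u)" if "u \<in> carrier Y" for c u
    using that by (auto simp: T_def \<psi>_scale fun_scale_apply)
  have T_I: "T (I f) = f" if "f \<in> ?X" for f
    using that bounded_degree_functions_cube[OF that] by (auto simp: T_def \<psi> cube_functions_def)
  have R_in: "?R f \<in> ?X" for f
    unfolding bounded_degree_functions_eq by (rule partial_sum_in_span[OF q])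
  define P where "P u = I (?R (T u))" for u
  have P_norm: "vnorm Y (P u) \<le> ?c * vnorm Y u" if u: "u \<in> carrier Y" for u
    unfolding P_def I_norm[OF R_in]
    using u by (intro cube_sup_le partial_sum_bound[OF q]) (auto simp: T_def \<psi>_norm)
  have P: "P \<in> projections_onto (I ` ?X) Y"
    unfolding projections_onto_def bounded_complex_linear_map_def complex_linear_map_def
  proof (intro CollectI conjI)
    show "P \<in> carrier Y \<rightarrow> carrier Y" using R_in I_in by (auto simp: P_def)
    show "\<forall>u\<in>carrier Y. \<forall>v\<in>carrier Y. P (u \<oplus>\<^bsub>Y\<^esub> v) = P u \<oplus>\<^bsub>Y\<^esub> P v"
      by (auto simp: P_def T_add partial_sum_add[OF q] I_add R_in)
    show "\<forall>c. \<forall>u\<in>carrier Y. P (c \<odot>\<^bsub>Y\<^esub> u) = c \<odot>\<^bsub>Y\<^esub> P u"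
      by (auto simp: P_def T_scale partial_sum_scale[OF q] I_scale R_in)
    show "\<exists>C. \<forall>u\<in>carrier Y. vnorm Y (P u) \<le> C * vnorm Y u" using P_norm by blast
    show "P ` carrier Y \<subseteq> I ` ?X" using R_in by (auto simp: P_def)
    show "\<forall>u\<in>I ` ?X. P u = u"
      using span_characters_expansion[OF q degree_freqs_subset]
      by (auto simp: P_def T_I bounded_degree_functions_eq)
  qed
  have "operator_norm Y Y P \<le> ?c"
    unfolding operator_norm_def
  proof (rule cSUP_least)
    show "{x \<in> carrier Y. vnorm Y x \<le> 1} \<noteq> {}"
      using vnorm_eq_0_iff[of "\<zero>\<^bsub>Y\<^esub>"] by (auto intro!: exI[of _ "\<zero>\<^bsub>Y\<^esub>"])
    fix u assume u: "u \<in> {x \<in> carrier Y. vnorm Y x \<le> 1}"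
    then have "vnorm Y (P u) \<le> ?c * vnorm Y u" by (intro P_norm) auto
    also have "\<dots> \<le> ?c * 1" using u c0 by (intro mult_left_mono) auto
    finally show "vnorm Y (P u) \<le> ?c" by simp
  qed
  then show "relative_projection_constant (I ` carrier (bounded_degree_space d q N)) Y \<le> ereal ?c"
    unfolding relative_projection_constant_def bounded_degree_space_simps
    by (intro INF_lower2[OF P]) simp
qed

lemma projection_constant_eq:
  assumes "\<exists>f :: complex \<Rightarrow> 'u. inj f"
  shows "projection_constant TYPE('u) (bounded_degree_space d q N)
           = ereal (cube_mean q N (\<lambda>x. cmod (dirichlet q N (degree_freqs d q N) x)))"
  using projection_constant_lower[OF assms] projection_constant_upper by (rule antisym[rotated])

end

section \<open>The Dirichlet kernel of bounded degree\<close>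

text \<open>Generating polynomial of the elementary symmetric polynomials in
  \<open>y 0, ..., y (N - 1)\<close>.\<close>

definition esym_fps :: "nat \<Rightarrow> (nat \<Rightarrow> 'a) \<Rightarrow> 'a :: field_char_0 fps" where
  "esym_fps N y = (\<Prod>j<N. 1 + fps_const (y j) * fps_X)"

text \<open>The logarithmic derivative is the sum of \<open>y_j / (1 + y_j t)\<close>. The quadratic
  equation for \<open>y_j\<close> gives
  \<open>(1 + a t - b t^2) y_j = (y_j - b t) (1 + y_j t)\<close>, so all these fractions share the
  denominator \<open>1 + a t - b t^2\<close> and only the sum of the \<open>y_j\<close>
  remains.\<close>

lemma esym_fps_deriv:
  fixes a b :: "'a :: field_char_0"
  assumes y: "\<And>j. j < N \<Longrightarrow> y j ^ 2 = b + a * y j"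
  shows "(1 + fps_const a * fps_X - fps_const b * fps_X ^ 2) * fps_deriv (esym_fps N y)
           = (fps_const (\<Sum>j<N. y j) - fps_const (of_nat N * b) * fps_X) * esym_fps N y"
  using assms
proof (induction N)
  case 0
  then show ?case by (simp add: esym_fps_def)
next
  case (Suc N)
  define P where "P = esym_fps N y"
  define Y where "Y = fps_const (y N)"
  define A where "A = fps_const a"
  define B where "B = fps_const b"
  define S where "S = fps_const (\<Sum>j<N. y j)"
  define K where "K = fps_const (of_nat N * b)"
  let ?X = "fps_X :: 'a fps"
  have YY: "Y * Y = B + A * Y"
    using Suc.prems[of N] by (simp add: Y_def A_def B_def power2_eq_square)
  have IH: "(1 + A * ?X - B * ?X ^ 2) * fps_deriv P = (S - K * ?X) * P"
    using Suc by (simp add: A_def B_def S_def K_def P_def)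
  have key: "(1 + A * ?X - B * ?X ^ 2) * Y = (Y - B * ?X) * (1 + Y * ?X)"
  proof -
    have "(Y - B * ?X) * (1 + Y * ?X) = Y + (Y * Y) * ?X - B * ?X - B * Y * ?X ^ 2"
      by (simp add: algebra_simps power2_eq_square)
    also have "\<dots> = (1 + A * ?X - B * ?X ^ 2) * Y"
      unfolding YY by (simp add: algebra_simps)
    finally show ?thesis ..
  qed
  have "esym_fps (Suc N) y = P * (1 + Y * ?X)"
    by (simp add: esym_fps_def P_def Y_def)
  moreover from this have "fps_deriv (esym_fps (Suc N) y) = fps_deriv P * (1 + Y * ?X) + P * Y"
    by (simp add: Y_def mult.commute)
  moreover have "fps_const (\<Sum>j<Suc N. y j) - fps_const (of_nat (Suc N) * b) * ?X = (S - K * ?X) + (Y - B * ?X)"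
    by (simp add: S_def K_def Y_def B_def algebra_simps flip: fps_const_add)
  moreover have "(1 + A * ?X - B * ?X ^ 2) * (fps_deriv P * (1 + Y * ?X) + P * Y)
      = ((S - K * ?X) + (Y - B * ?X)) * (P * (1 + Y * ?X))"
  proof -
    have "(1 + A * ?X - B * ?X ^ 2) * (fps_deriv P * (1 + Y * ?X) + P * Y)
        = ((1 + A * ?X - B * ?X ^ 2) * fps_deriv P) * (1 + Y * ?X) + P * ((1 + A * ?X - B * ?X ^ 2) * Y)"
      by (simp add: algebra_simps)
    also have "\<dots> = (S - K * ?X) * P * (1 + Y * ?X) + P * ((Y - B * ?X) * (1 + Y * ?X))"
      by (simp only: IH key)
    also have "\<dots> = ((S - K * ?X) + (Y - B * ?X)) * (P * (1 + Y * ?X))"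
      by (simp add: algebra_simps)
    finally show ?thesis .
  qed
  ultimately show ?case by (simp only: A_def[symmetric] B_def[symmetric])
qed

lemma esym_fps_nth_0 [simp]: "fps_nth (esym_fps N y) 0 = 1"
  by (induction N) (simp_all add: esym_fps_def)

lemma esym_fps_nth_1:
  fixes y :: "nat \<Rightarrow> 'a :: field_char_0"
  shows "fps_nth (esym_fps N y) (Suc 0) = (\<Sum>j<N. y j)"
proof (induction N)
  case (Suc N)
  have "esym_fps (Suc N) y = esym_fps N y + fps_const (y N) * (esym_fps N y * fps_X)"
    by (simp add: esym_fps_def algebra_simps)
  then show ?case using Suc by simp
qed (simp add: esym_fps_def)

text \<open>Comparison of the coefficients of \<open>t^(k+1)\<close> in
  \<open>esym_fps_deriv\<close>.\<close>

lemma esym_fps_recurrence: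
  fixes a b :: "'a :: field_char_0"
  assumes y: "\<And>j. j < N \<Longrightarrow> y j ^ 2 = b + a * y j"
  shows "of_nat (k + 2) * fps_nth (esym_fps N y) (Suc (Suc k))
     = ((\<Sum>j<N. y j) - a * of_nat (k + 1)) * fps_nth (esym_fps N y) (Suc k)
         - b * (of_nat N - of_nat k) * fps_nth (esym_fps N y) k"
proof -
  let ?P = "esym_fps N y"
  have l: "fps_nth ((1 + fps_const a * fps_X - fps_const b * fps_X ^ 2) * fps_deriv ?P) (Suc k)
      = of_nat (k + 2) * fps_nth ?P (Suc (Suc k)) + a * (of_nat (k + 1) * fps_nth ?P (Suc k))
        - b * (of_nat k * fps_nth ?P k)"
  proof -
    have "(1 + fps_const a * fps_X - fps_const b * fps_X ^ 2) * fps_deriv ?P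
        = fps_deriv ?P + fps_const a * (fps_X * fps_deriv ?P) - fps_const b * (fps_X * (fps_X * fps_deriv ?P))"
      by (simp add: algebra_simps power2_eq_square)
    then show ?thesis by (cases k) simp_all
  qed
  have r: "fps_nth ((fps_const (\<Sum>j<N. y j) - fps_const (of_nat N * b) * fps_X) * ?P) (Suc k)
      = (\<Sum>j<N. y j) * fps_nth ?P (Suc k) - of_nat N * b * fps_nth ?P k"
  proof -
    have "(fps_const (\<Sum>j<N. y j) - fps_const (of_nat N * b) * fps_X) * ?P
        = fps_const (\<Sum>j<N. y j) * ?P - fps_const (of_nat N * b) * (fps_X * ?P)"
      by (simp only: left_diff_distrib mult.assoc)
    then show ?thesis by (simp only: fps_sub_nth fps_mult_left_const_nth fps_X_mult_nth) simp
  qed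
  have "of_nat (k + 2) * fps_nth ?P (Suc (Suc k)) + a * (of_nat (k + 1) * fps_nth ?P (Suc k))
        - b * (of_nat k * fps_nth ?P k)
      = (\<Sum>j<N. y j) * fps_nth ?P (Suc k) - of_nat N * b * fps_nth ?P k"
    unfolding l[symmetric] r[symmetric] by (rule arg_cong[where f = "\<lambda>F. fps_nth F (Suc k)"]) (rule esym_fps_deriv[OF y])
  then show ?thesis by (simp add: algebra_simps)
qed

text \<open>Rescaling by \<open>s^k / k!\<close> turns the recurrence of the elementary symmetric
  polynomials into that of \<open>kraw\<close>. The identity \<open>s^2 = b N\<close> converts
  \<open>b (N - j)\<close> into \<open>s^2 (1 - j / N)\<close>.\<close>

lemma esym_fps_eq_kraw:
  fixes y :: "nat \<Rightarrow> real"
  assumes y: "\<And>j. j < N \<Longrightarrow> y j ^ 2 = b + a * y j" and N: "N > 0" and b: "b > 0"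
  defines "s \<equiv> sqrt (b * real N)"
  shows "fact k * fps_nth (esym_fps N y) k = s ^ k * kraw a s (real N) k ((\<Sum>j<N. y j) / s)"
proof (induction k rule: less_induct)
  case (less k)
  have s: "s > 0" "s * s = b * real N" using N b by (simp_all add: s_def)
  let ?w = "(\<Sum>j<N. y j) / s"
  consider "k = 0" | "k = 1" | j where "k = Suc (Suc j)"
    by (metis One_nat_def not0_implies_Suc)
  then show ?case
  proof cases
    case 3
    have IH: "fact (Suc j) * fps_nth (esym_fps N y) (Suc j) = s ^ Suc j * kraw a s (real N) (Suc j) ?w"
      "fact j * fps_nth (esym_fps N y) j = s ^ j * kraw a s (real N) j ?w"
      using less[of "Suc j"] less[of j] 3 by auto
    have "fact k * fps_nth (esym_fps N y) k = fact (Suc j) * (real (j + 2) * fps_nth (esym_fps N y) (Suc (Suc j)))"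
      by (simp add: 3 algebra_simps)
    also have "\<dots> = fact (Suc j) * (((\<Sum>j<N. y j) - a * real (j + 1)) * fps_nth (esym_fps N y) (Suc j)
         - b * (real N - real j) * fps_nth (esym_fps N y) j)"
      by (subst esym_fps_recurrence[OF y]) simp_all
    also have "\<dots> = ((\<Sum>j<N. y j) - a * real (j + 1)) * (fact (Suc j) * fps_nth (esym_fps N y) (Suc j))
         - real (Suc j) * b * (real N - real j) * (fact j * fps_nth (esym_fps N y) j)"
      by (simp add: algebra_simps)
    also have "\<dots> = ((\<Sum>j<N. y j) - a * real (j + 1)) * (s ^ Suc j * kraw a s (real N) (Suc j) ?w)
         - real (Suc j) * b * (real N - real j) * (s ^ j * kraw a s (real N) j ?w)"
      by (simp only: IH)
    also have "(\<Sum>j<N. y j) - a * real (j + 1) = s * (?w - a * real (Suc j) / s)"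
      using s by (simp add: field_simps)
    also have "real (Suc j) * b * (real N - real j) = real (Suc j) * ((s * s) * (1 - real j / real N))"
      using N unfolding s(2) by (simp add: field_simps)
    finally show ?thesis by (simp add: 3 algebra_simps)
  qed (use s in \<open>simp_all add: esym_fps_nth_1\<close>)
qed

text \<open>The binomial theorem. It evaluates the kernel at the neutral element of the group, where
  all variables equal \<open>q - 1\<close>, and thereby the dimension.\<close>

lemma esym_fps_const_nth:
  fixes c :: "'a :: field_char_0"
  shows "fps_nth (esym_fps N (\<lambda>_. c)) k = of_nat (N choose k) * c ^ k"
proof (induction N arbitrary: k)
  case 0
  then show ?case by (cases k) (simp_all add: esym_fps_def)
next
  case (Suc N)
  have "esym_fps (Suc N) (\<lambda>_. c) = esym_fps N (\<lambda>_. c) + fps_const c * (fps_X * esym_fps N (\<lambda>_. c))"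
    by (simp add: esym_fps_def algebra_simps)
  then show ?case using Suc by (cases k) (simp_all add: algebra_simps)
qed

lemma esym_fps_of_real:
  "fps_nth (esym_fps N (\<lambda>j. complex_of_real (y j))) k = of_real (fps_nth (esym_fps N y) k)"
proof (induction N arbitrary: k)
  case 0
  then show ?case by (cases k) (simp_all add: esym_fps_def)
next
  case (Suc N)
  have *: "esym_fps (Suc N) y = esym_fps N y + fps_const (y N) * (fps_X * esym_fps N y)"
    for y :: "nat \<Rightarrow> 'a :: field_char_0"
    by (simp add: esym_fps_def algebra_simps)
  show ?case unfolding * using Suc by (cases k) simp_all
qed

context
  fixes q :: nat
  assumes q: "2 \<le> q"
begin

lemma sum_powers_root:
  assumes "(z::complex) ^ q = 1"
  shows "(\<Sum>a\<in>{1..<q}. z ^ a) = of_real (root_sum q z)"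
proof -
  have "(\<Sum>a<q. z ^ a) = 1 + (\<Sum>a\<in>{1..<q}. z ^ a)"
    using q by (simp add: lessThan_atLeast0 sum.atLeast_Suc_lessThan)
  moreover have "(\<Sum>a<q. z ^ a) = (if z = 1 then of_nat q else 0)"
    using powers_sum_orthogonal[OF q assms, of 1] by simp
  ultimately have "(\<Sum>a\<in>{1..<q}. z ^ a) = (if z = 1 then of_nat q else 0) - 1"
    by (metis add_diff_cancel_left')
  then show ?thesis by (simp add: root_sum_def)
qed

text \<open>Expanding the product over \<open>j\<close> of the sums over \<open>a < q\<close> of
  \<open>x_j^a\<close>, with a factor \<open>t\<close> attached to each nonzero exponent, produces
  every character once, and the power of \<open>t\<close> counts its support.\<close>

lemma sum_characters_fixed_degree:
  assumes x: "x \<in> cyclic_cube q N"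
  shows "(\<Sum>m\<in>{m \<in> frequencies q N. card {j \<in> {..<N}. m j \<noteq> 0} = k}. character q N m x)
           = of_real (fps_nth (esym_fps N (\<lambda>j. root_sum q (x j))) k)"
proof -
  let ?t = "\<lambda>a::nat. if a = 0 then 1 else fps_X :: complex fps"
  have root: "x j ^ q = 1" if "j < N" for j using x that by (auto simp: cyclic_cube_def)
  have "1 + fps_const (complex_of_real (root_sum q (x j))) * fps_X
      = (\<Sum>a<q. fps_const (x j ^ a) * ?t a)" if "j < N" for j
  proof -
    have "(\<Sum>a<q. fps_const (x j ^ a) * ?t a)
        = 1 + (\<Sum>a\<in>{1..<q}. fps_const (x j ^ a) * ?t a)"
      using q by (simp add: lessThan_atLeast0 sum.atLeast_Suc_lessThan)
    also have "(\<Sum>a\<in>{1..<q}. fps_const (x j ^ a) * ?t a) = (\<Sum>a\<in>{1..<q}. fps_const (x j ^ a)) * fps_X"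
      unfolding sum_distrib_right by (intro sum.cong) auto
    also have "(\<Sum>a\<in>{1..<q}. fps_const (x j ^ a)) = fps_const (\<Sum>a\<in>{1..<q}. x j ^ a)"
      by (induction q) (simp_all add: sum.atLeastLessThan_Suc)
    finally show ?thesis using sum_powers_root[OF root[OF that]] by simp
  qed
  then have "esym_fps N (\<lambda>j. complex_of_real (root_sum q (x j))) = (\<Prod>j<N. \<Sum>a<q. fps_const (x j ^ a) * ?t a)"
    unfolding esym_fps_def by (intro prod.cong) auto
  also have "\<dots> = (\<Sum>m\<in>frequencies q N. \<Prod>j<N. fps_const (x j ^ m j) * ?t (m j))"
    unfolding frequencies_def by (rule prod_sum_PiE) auto
  also have "\<dots> = (\<Sum>m\<in>frequencies q N. fps_const (character q N m x) * fps_X ^ card {j \<in> {..<N}. m j \<noteq> 0})"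
  proof (intro sum.cong refl)
    fix m
    have "(\<Prod>j<N. fps_const (x j ^ m j)) = fps_const (character q N m x)"
    proof -
      have "(\<Prod>j\<in>A. fps_const (x j ^ m j)) = fps_const (\<Prod>j\<in>A. x j ^ m j)" for A :: "nat set"
        by (induction A rule: infinite_finite_induct) simp_all
      then show ?thesis using x by (simp add: character_def)
    qed
    moreover have "(\<Prod>j<N. ?t (m j)) = fps_X ^ card {j \<in> {..<N}. m j \<noteq> 0}"
    proof -
      have "(\<Prod>j<N. ?t (m j)) = (\<Prod>j\<in>{j \<in> {..<N}. m j \<noteq> 0}. fps_X)"
        by (rule prod.mono_neutral_cong_right) auto
      then show ?thesis by simp
    qed
    ultimately show "(\<Prod>j<N. fps_const (x j ^ m j) * ?t (m j))
        = fps_const (character q N m x) * fps_X ^ card {j \<in> {..<N}. m j \<noteq> 0}"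
      by (simp add: prod.distrib)
  qed
  finally have eq: "esym_fps N (\<lambda>j. complex_of_real (root_sum q (x j)))
      = (\<Sum>m\<in>frequencies q N. fps_const (character q N m x) * fps_X ^ card {j \<in> {..<N}. m j \<noteq> 0})" .
  have nth: "fps_nth (fps_const c * fps_X ^ n) k = (if n = k then c else 0)" for c :: complex and n
    by (simp add: fps_X_power_nth)
  have "fps_nth (esym_fps N (\<lambda>j. complex_of_real (root_sum q (x j)))) k
      = (\<Sum>m\<in>frequencies q N. if card {j \<in> {..<N}. m j \<noteq> 0} = k then character q N m x else 0)"
    unfolding eq fps_sum_nth nth ..
  also have "\<dots> = (\<Sum>m\<in>{m \<in> frequencies q N. card {j \<in> {..<N}. m j \<noteq> 0} = k}. character q N m x)"
    by (rule sum.inter_filter[symmetric]) (rule finite_frequencies[OF q])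
  finally show ?thesis by (simp add: esym_fps_of_real)
qed

end

section \<open>Asymptotics of the dimension and of the kernel\<close>

lemma Suc_mult_binomial_Suc: "Suc k * (n choose Suc k) = (n - k) * (n choose k)"
  by (metis binomial_absorb_comp times_binomial_minus1_eq diff_Suc_1 zero_less_Suc)

text \<open>Passing from \<open>k\<close> to \<open>k + 1\<close> multiplies the quotient by
  \<open>(1 - k/n) / (k + 1)\<close>.\<close>

lemma binomial_div_power_tendsto: "(\<lambda>n. real (n choose k) / real n ^ k) \<longlonglongrightarrow> 1 / fact k"
proof (induction k)
  case 0
  then show ?case by simp
next
  case (Suc k)
  have "(\<lambda>n. real k / real n) \<longlonglongrightarrow> 0"
    by (rule real_tendsto_divide_at_top[OF tendsto_const filterlim_real_sequentially])
  from tendsto_mult[OF Suc tendsto_divide[OF tendsto_diff[OF tendsto_const[of 1] this] tendsto_const[of "real (Suc k)"]]]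
  have "(\<lambda>n. real (n choose k) / real n ^ k * ((1 - real k / real n) / real (Suc k))) \<longlonglongrightarrow> 1 / fact (Suc k)"
    by (simp add: field_simps)
  moreover have "\<forall>\<^sub>F n in sequentially. real (n choose k) / real n ^ k * ((1 - real k / real n) / real (Suc k))
      = real (n choose Suc k) / real n ^ Suc k"
  proof (rule eventually_sequentiallyI[of "Suc k"])
    fix n assume n: "Suc k \<le> n"
    have "real (Suc k) * real (n choose Suc k) = (real n - real k) * real (n choose k)"
      using arg_cong[OF Suc_mult_binomial_Suc[of k n], of real] n by (simp only: of_nat_mult of_nat_diff)
    then have 1: "real (n choose Suc k) = (real n - real k) * real (n choose k) / real (Suc k)"
      by (simp add: field_simps)
    have 2: "1 - real k / real n = (real n - real k) / real n"
      using n by (simp add: field_simps)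
    show "real (n choose k) / real n ^ k * ((1 - real k / real n) / real (Suc k))
      = real (n choose Suc k) / real n ^ Suc k"
      unfolding 1 2 by (simp add: mult_ac del: of_nat_Suc)
  qed
  ultimately show ?case by (rule Lim_transform_eventually)
qed

context
  fixes q :: nat
  assumes q: "2 \<le> q"
begin

lemma dirichlet_degree_freqs:
  assumes x: "x \<in> cyclic_cube q N"
  shows "dirichlet q N (degree_freqs d q N) x
           = of_real (\<Sum>k\<le>d. fps_nth (esym_fps N (\<lambda>j. root_sum q (x j))) k)"
proof -
  let ?F = "\<lambda>k. {m \<in> frequencies q N. card {j \<in> {..<N}. m j \<noteq> 0} = k}"
  have "degree_freqs d q N = (\<Union>k\<in>{..d}. ?F k)" by (auto simp: degree_freqs_def)
  then have "dirichlet q N (degree_freqs d q N) x = (\<Sum>k\<le>d. \<Sum>m\<in>?F k. character q N m x)"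
    unfolding dirichlet_def using finite_frequencies[OF q] by (subst sum.UNION_disjoint[symmetric]) auto
  then show ?thesis by (simp only: sum_characters_fixed_degree[OF q x] of_real_sum)
qed

lemma cmod_dirichlet_degree_freqs:
  assumes x: "x \<in> cyclic_cube q N" and N: "0 < N"
  defines "s \<equiv> sqrt ((real q - 1) * real N)"
  shows "cmod (dirichlet q N (degree_freqs d q N) x)
           = \<bar>\<Sum>k\<le>d. s ^ k / fact k * kraw (real q - 2) s (real N) k (norm_sum q N x)\<bar>"
proof -
  have "fps_nth (esym_fps N (\<lambda>j. root_sum q (x j))) k
      = s ^ k / fact k * kraw (real q - 2) s (real N) k (norm_sum q N x)" for k
  proof -
    \<comment> \<open>The two values \<open>q - 1\<close> and \<open>-1\<close> are the roots of
      this quadratic; it supplies the parameters \<open>b = q - 1\<close> and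
      \<open>a = q - 2\<close>.\<close>
    have "(root_sum q z)\<^sup>2 = (real q - 1) + (real q - 2) * root_sum q z" for z
      by (simp add: root_sum_def power2_eq_square algebra_simps)
    then have "fact k * fps_nth (esym_fps N (\<lambda>j. root_sum q (x j))) k
        = s ^ k * kraw (real q - 2) s (real N) k (norm_sum q N x)"
      unfolding s_def norm_sum_def using q by (intro esym_fps_eq_kraw N) auto
    then show ?thesis by (simp add: field_simps)
  qed
  then have "(\<Sum>k\<le>d. fps_nth (esym_fps N (\<lambda>j. root_sum q (x j))) k)
      = (\<Sum>k\<le>d. s ^ k / fact k * kraw (real q - 2) s (real N) k (norm_sum q N x))"
    by (intro sum.cong) auto
  then show ?thesis unfolding dirichlet_degree_freqs[OF x] by (simp only: norm_of_real)
qed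

text \<open>All characters equal 1 at the neutral element, so the value of the kernel there counts
  the frequencies.\<close>

lemma card_degree_freqs:
  "real (card (degree_freqs d q N)) = (\<Sum>k\<le>d. real (N choose k) * (real q - 1) ^ k)"
proof -
  let ?e = "\<lambda>j\<in>{..<N}. 1 :: complex"
  have e: "?e \<in> cyclic_cube q N" by (simp add: cyclic_cube_def)
  have "complex_of_real (real (card (degree_freqs d q N))) = dirichlet q N (degree_freqs d q N) ?e"
    using e by (simp add: dirichlet_def character_def)
  also have "\<dots> = of_real (\<Sum>k\<le>d. fps_nth (esym_fps N (\<lambda>j. root_sum q (?e j))) k)"
    by (rule dirichlet_degree_freqs[OF e])
  also have "esym_fps N (\<lambda>j. root_sum q (?e j)) = esym_fps N (\<lambda>_. real q - 1)"
    unfolding esym_fps_def by (intro prod.cong) (auto simp: root_sum_def)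
  finally show ?thesis by (simp only: of_real_eq_iff esym_fps_const_nth)
qed

lemma card_degree_freqs_pos: "0 < card (degree_freqs d q N)"
proof -
  have "(\<lambda>j\<in>{..<N}. 0) \<in> degree_freqs d q N"
    using q by (auto simp: degree_freqs_def frequencies_def)
  moreover have "finite (degree_freqs d q N)"
    by (rule finite_subset[OF degree_freqs_subset finite_frequencies[OF q]])
  ultimately show ?thesis by (auto simp: card_gt_0_iff)
qed

text \<open>The term \<open>k = d\<close> has the order of the denominator; each lower term loses a
  factor \<open>((q - 1) N)^(d - k)\<close>.\<close>

lemma card_degree_freqs_tendsto:
  "(\<lambda>N. real (card (degree_freqs d q N)) / ((real q - 1) * real N) ^ d) \<longlonglongrightarrow> 1 / fact d"
proof -
  define b where "b = real q - 1"
  have b: "b > 0" using q by (simp add: b_def)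
  have top: "filterlim (\<lambda>N. b * real N) at_top sequentially"
    by (rule filterlim_tendsto_pos_mult_at_top[OF tendsto_const b filterlim_real_sequentially])
  have lower: "(\<lambda>N. real (N choose k) * b ^ k / (b * real N) ^ d) \<longlonglongrightarrow> 0" if k: "k < d" for k
  proof -
    have "filterlim (\<lambda>N. (b * real N) ^ (d - k)) at_top sequentially"
      by (rule filterlim_pow_at_top[OF _ top]) (use k in simp)
    then have "(\<lambda>N. 1 / (b * real N) ^ (d - k)) \<longlonglongrightarrow> 0"
      by (rule real_tendsto_divide_at_top[OF tendsto_const])
    from tendsto_mult[OF binomial_div_power_tendsto[of k] this]
    have "(\<lambda>N. real (N choose k) / real N ^ k * (1 / (b * real N) ^ (d - k))) \<longlonglongrightarrow> 0" by (simp only: mult_zero_right)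
    moreover have "\<forall>\<^sub>F N in sequentially. real (N choose k) / real N ^ k * (1 / (b * real N) ^ (d - k))
        = real (N choose k) * b ^ k / (b * real N) ^ d"
    proof (rule eventually_sequentiallyI[of 1])
      fix N :: nat assume "1 \<le> N"
      then have N: "real N > 0" by simp
      have "(b * real N) ^ d = (b * real N) ^ k * (b * real N) ^ (d - k)"
        using k by (simp flip: power_add)
      then have "(b * real N) ^ d = b ^ k * real N ^ k * (b * real N) ^ (d - k)"
        by (simp only: power_mult_distrib)
      then show "real (N choose k) / real N ^ k * (1 / (b * real N) ^ (d - k))
          = real (N choose k) * b ^ k / (b * real N) ^ d"
        using b N by simp
    qed
    ultimately show ?thesis by (rule Lim_transform_eventually)
  qed
  have "(\<lambda>N. real (N choose d) / real N ^ d + (\<Sum>k<d. real (N choose k) * b ^ k / (b * real N) ^ d))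
      \<longlonglongrightarrow> 1 / fact d + 0"
    by (intro tendsto_add binomial_div_power_tendsto tendsto_null_sum lower) auto
  moreover have "real (N choose d) / real N ^ d + (\<Sum>k<d. real (N choose k) * b ^ k / (b * real N) ^ d)
      = real (card (degree_freqs d q N)) / (b * real N) ^ d" for N
  proof -
    have "real (card (degree_freqs d q N)) = real (N choose d) * b ^ d + (\<Sum>k<d. real (N choose k) * b ^ k)"
      unfolding card_degree_freqs b_def by (simp add: lessThan_Suc_atMost[symmetric])
    moreover have "real (N choose d) * b ^ d / (b * real N) ^ d = real (N choose d) / real N ^ d"
      using b by (simp add: power_mult_distrib)
    ultimately show ?thesis by (simp only: add_divide_distrib sum_divide_distrib)
  qed
  ultimately show ?thesis by (simp add: b_def)
qed

text \<open>The mean of the kernel grows like \<open>s^d / d!\<close> times the Hermite moment, the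
  root of the dimension like \<open>s^d / sqrt (d!)\<close>; the quotient leaves the constant
  \<open>1 / sqrt (d!)\<close>.\<close>

lemma cube_mean_dirichlet_tendsto:
  "(\<lambda>N. cube_mean q N (\<lambda>x. cmod (dirichlet q N (degree_freqs d q N) x)) / sqrt (real (card (degree_freqs d q N))))
     \<longlonglongrightarrow> 1 / sqrt (fact d) * integral\<^sup>L std_normal_distribution (\<lambda>x. \<bar>He d x\<bar>)"
proof -
  define s where "s N = sqrt ((real q - 1) * real N)" for N
  define I where "I = integral\<^sup>L std_normal_distribution (\<lambda>x. \<bar>He d x\<bar>)"
  let ?L = "\<lambda>N. cube_mean q N (\<lambda>x. cmod (dirichlet q N (degree_freqs d q N) x))"
  let ?K = "\<lambda>N. cube_mean q N (\<lambda>x. \<bar>\<Sum>k\<le>d. s N ^ k / fact k * kraw (real q - 2) (s N) (real N) k (norm_sum q N x)\<bar>)"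
  let ?c = "\<lambda>N. real (card (degree_freqs d q N))"
  have K: "(\<lambda>N. ?K N / s N ^ d) \<longlonglongrightarrow> I / fact d"
    using cube_mean_kraw_sum_tendsto[OF q, of d] by (simp only: s_def I_def)
  have c: "(\<lambda>N. sqrt (?c N / ((real q - 1) * real N) ^ d)) \<longlonglongrightarrow> sqrt (1 / fact d)"
    by (intro tendsto_real_sqrt card_degree_freqs_tendsto)
  have "(\<lambda>N. (?K N / s N ^ d) / sqrt (?c N / ((real q - 1) * real N) ^ d)) \<longlonglongrightarrow> (I / fact d) / sqrt (1 / fact d)"
    by (rule tendsto_divide[OF K c]) simp
  moreover have "\<forall>\<^sub>F N in sequentially. (?K N / s N ^ d) / sqrt (?c N / ((real q - 1) * real N) ^ d) = ?L N / sqrt (?c N)"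
  proof (rule eventually_sequentiallyI[of 1])
    fix N :: nat assume N: "1 \<le> N"
    have s: "s N > 0" using N q by (simp add: s_def)
    have "sqrt (?c N / ((real q - 1) * real N) ^ d) = sqrt (?c N) / s N ^ d"
      by (simp add: real_sqrt_divide real_sqrt_power s_def)
    moreover have "?K N = ?L N"
      unfolding cube_mean_def s_def using N by (simp add: cmod_dirichlet_degree_freqs)
    ultimately show "(?K N / s N ^ d) / sqrt (?c N / ((real q - 1) * real N) ^ d) = ?L N / sqrt (?c N)"
      using s by simp
  qed
  ultimately have "(\<lambda>N. ?L N / sqrt (?c N)) \<longlonglongrightarrow> (I / fact d) / sqrt (1 / fact d)"
    by (rule Lim_transform_eventually)
  also have "(I / fact d) / sqrt (1 / fact d) = 1 / sqrt (fact d) * I"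
  proof -
    have "fact d = sqrt (fact d) * sqrt (fact d :: real)" by simp
    then show ?thesis by (simp add: real_sqrt_divide field_simps)
  qed
  finally show ?thesis unfolding I_def .
qed

end

theorem proposition4p6:
  fixes q d :: nat
    and M :: "'w measure" and Z :: "'w \<Rightarrow> real"
  assumes q: "2 \<le> q" and d: "1 \<le> d"
    and universe: "\<exists>f :: complex \<Rightarrow> 'u. inj f"
    and M: "prob_space M"
    and Z: "distributed M lborel Z std_normal_density"
  shows "(\<lambda>N. projection_constant TYPE('u) (bounded_degree_space d q N)
              / ereal (sqrt (real (complex_fun_dim (bounded_degree_functions d q N)))))
         \<longlonglongrightarrow> ereal (1 / sqrt (fact d) * (\<integral>\<omega>. \<bar>He d (Z \<omega>)\<bar> \<partial>M))"
proof -
  have [measurable]: "He d \<in> borel_measurable borel"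
    by (rule borel_measurable_continuous_onI) (rule continuous_He)
  have "(\<integral>\<omega>. \<bar>He d (Z \<omega>)\<bar> \<partial>M) = (\<integral>x. std_normal_density x * \<bar>He d x\<bar> \<partial>lborel)"
    by (rule distributed_integral[OF Z, symmetric]) (auto simp: normal_density_nonneg)
  also have "\<dots> = integral\<^sup>L std_normal_distribution (\<lambda>x. \<bar>He d x\<bar>)"
    by (subst integral_density) (auto simp: normal_density_nonneg)
  finally have I: "(\<integral>\<omega>. \<bar>He d (Z \<omega>)\<bar> \<partial>M) = integral\<^sup>L std_normal_distribution (\<lambda>x. \<bar>He d x\<bar>)" .
  have "projection_constant TYPE('u) (bounded_degree_space d q N)
          / ereal (sqrt (real (complex_fun_dim (bounded_degree_functions d q N))))
      = ereal (cube_mean q N (\<lambda>x. cmod (dirichlet q N (degree_freqs d q N) x)) / sqrt (real (card (degree_freqs d q N))))" for N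
  proof -
    have "complex_fun_dim (bounded_degree_functions d q N) = card (degree_freqs d q N)"
      unfolding bounded_degree_functions_eq by (rule dim_span_characters[OF q degree_freqs_subset])
    \<comment> \<open>A positive dimension makes the quotient in \<open>ereal\<close> an ordinary
      real quotient.\<close>
    then show ?thesis
      using card_degree_freqs_pos[OF q, of d N] by (simp add: projection_constant_eq[OF q universe])
  qed
  then show ?thesis
    unfolding I using cube_mean_dirichlet_tendsto[OF q, of d] by simp
qed

end
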